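(* Let $n\ge2$, $q\in(1,2)$, $p=q/(q-1)$, $\alpha\in(0,1)$, and let $\Omega\subset\mathbb{R}^n$ be a bounded connected open set with Lipschitz boundary. Let $f\in L^p(\Omega)$ with $\int_\Omega f\,dx=0$, and let $\sigma_0\in L^p(\Omega,\mathbb{R}^n)$ be the solution of the problem $$\inf_{\sigma\in L^p(\Omega,\mathbb{R}^n)}\left\{\int_\Omega\left(\tfrac1p|\sigma|^p+|\sigma|\right)dx:\ -\mathrm{div}\,\sigma=f \text{ in }\Omega,\ \langle\sigma,\nu\rangle=0\text{ on }\partial\Omega\right\}.$$ Then: $$f\in W^{1,p}_{loc}(\Omega)\ \Rightarrow\ \sigma_0\in L^r_{loc}(\Omega)\ \text{ for all } r\in\left[1,\frac{np(3-q)}{n(3-q)-2}\right);$$ and if $f\in B^\alpha_{p,\infty,loc}(\Omega)$, then - if $0<\alpha<\frac{q-1}{3-q}$, $\sigma_0\in L^s_{loc}(\Omega)$ for all $s\in\left[1,\frac{np}{n-\alpha-1}\right)$; - if $\frac{q-1}{3-q}\le\alpha<1$, $\sigma_0\in L^s_{loc}(\Omega)$ for all $s\in\left[1,\frac{np(3-q)}{n(3-q)-2}\right)$.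
   Context: $\nu$ is the outer normal on $\partial\Omega$. The constraint in the minimization problem is meant in the weak sense: $\int_\Omega\langle\sigma,\nabla\varphi\rangle\,dx=\int_\Omega f\varphi\,dx$ for all $\varphi\in W^{1,q}(\Omega)$. The infimum is assumed finite, so that the problem has exactly one solution. Besov spaces: for $0<\beta<1$, $1\le m<\infty$, $v\in B^\beta_{m,\infty}(\mathbb{R}^n)$ means $v\in L^m(\mathbb{R}^n)$ and $\sup_{h\in\mathbb{R}^n\setminus\{0\}}\left(\int_{\mathbb{R}^n}\frac{|v(x+h)-v(x)|^m}{|h|^{\beta m}}dx\right)^{1/m}<\infty$. $v\in B^\beta_{m,\infty,loc}(\Omega)$ means $\varphi v\in B^\beta_{m,\infty}(\mathbb{R}^n)$ for every $\varphi\in C_c^\infty(\Omega)$. *)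

theory Defs
  imports "HOL-Analysis.Analysis"
begin

text \<open>
  Functions on a set \<open>S\<close> are total functions whose values outside \<open>S\<close> are irrelevant; the function
  spaces below are sets of functions rather than of classes modulo null sets, and each of them is
  invariant under changes on null subsets of \<open>S\<close>.
\<close>

definition Lp_on :: "real \<Rightarrow> 'a::euclidean_space set \<Rightarrow> ('a \<Rightarrow> 'b::euclidean_space) set" where
  "Lp_on p S = {u \<in> borel_measurable (lebesgue_on S).
                 integrable (lebesgue_on S) (\<lambda>x. norm (u x) powr p)}"

definition Lp_loc :: "real \<Rightarrow> 'a::euclidean_space set \<Rightarrow> ('a \<Rightarrow> 'b::euclidean_space) set" where
  "Lp_loc p \<Omega> = {u. \<forall>K. compact K \<and> K \<subseteq> \<Omega> \<longrightarrow> u \<in> Lp_on p K}"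

definition partial_deriv :: "'a::euclidean_space \<Rightarrow> ('a \<Rightarrow> real) \<Rightarrow> 'a \<Rightarrow> real" where
  "partial_deriv i \<phi> x = frechet_derivative \<phi> (at x) i"

primrec Ck :: "nat \<Rightarrow> ('a::euclidean_space \<Rightarrow> real) \<Rightarrow> bool" where
  "Ck 0 \<phi> \<longleftrightarrow> continuous_on UNIV \<phi>"
| "Ck (Suc k) \<phi> \<longleftrightarrow> (\<forall>x. \<phi> differentiable (at x)) \<and> (\<forall>i\<in>Basis. Ck k (partial_deriv i \<phi>))"

definition test_functions :: "'a::euclidean_space set \<Rightarrow> ('a \<Rightarrow> real) set" where
  "test_functions \<Omega> = {\<phi>. (\<forall>k. Ck k \<phi>) \<and>
     compact (closure {x. \<phi> x \<noteq> 0}) \<and> closure {x. \<phi> x \<noteq> 0} \<subseteq> \<Omega>}"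

definition weak_gradient ::
    "'a::euclidean_space set \<Rightarrow> ('a \<Rightarrow> real) \<Rightarrow> ('a \<Rightarrow> 'a) \<Rightarrow> bool" where
  "weak_gradient \<Omega> u G \<longleftrightarrow> u \<in> Lp_loc 1 \<Omega> \<and> G \<in> Lp_loc 1 \<Omega> \<and>
     (\<forall>\<phi>\<in>test_functions \<Omega>. \<forall>i\<in>Basis.
        (\<integral>x. u x * partial_deriv i \<phi> x \<partial>lebesgue_on \<Omega>) =
        - (\<integral>x. (G x \<bullet> i) * \<phi> x \<partial>lebesgue_on \<Omega>))"

definition W1p :: "real \<Rightarrow> 'a::euclidean_space set \<Rightarrow> ('a \<Rightarrow> real) set" where
  "W1p p \<Omega> = {u \<in> Lp_on p \<Omega>. \<exists>G\<in>Lp_on p \<Omega>. weak_gradient \<Omega> u G}"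

definition W1p_loc :: "real \<Rightarrow> 'a::euclidean_space set \<Rightarrow> ('a \<Rightarrow> real) set" where
  "W1p_loc p \<Omega> = {u. \<forall>U. open U \<and> compact (closure U) \<and> closure U \<subseteq> \<Omega> \<longrightarrow> u \<in> W1p p U}"

text \<open>
  The Bochner integral is \<open>0\<close> on non-integrable functions, but the integrand below is integrable
  for every \<open>h \<noteq> 0\<close> because \<open>v \<in> L\<^sup>m\<close>.
\<close>

definition Besov :: "real \<Rightarrow> real \<Rightarrow> ('a::euclidean_space \<Rightarrow> real) set" where
  "Besov \<beta> m = {v \<in> Lp_on m UNIV.
     bdd_above ((\<lambda>h. (\<integral>x. \<bar>v (x + h) - v x\<bar> powr m / norm h powr (\<beta> * m) \<partial>lebesgue) powr (1 / m))
                ` (UNIV - {0}))}"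

definition Besov_loc :: "real \<Rightarrow> real \<Rightarrow> 'a::euclidean_space set \<Rightarrow> ('a \<Rightarrow> real) set" where
  "Besov_loc \<beta> m \<Omega> = {v. \<forall>\<phi>\<in>test_functions \<Omega>. (\<lambda>x. \<phi> x * v x) \<in> Besov \<beta> m}"

text \<open>
  Near each boundary point, \<open>\<Omega>\<close> is the strict epigraph of a Lipschitz function \<open>\<gamma>\<close> over the
  hyperplane orthogonal to some unit vector \<open>e\<close>.
\<close>

definition lipschitz_boundary :: "'a::euclidean_space set \<Rightarrow> bool" where
  "lipschitz_boundary \<Omega> \<longleftrightarrow>
     (\<forall>z\<in>frontier \<Omega>. \<exists>e r L \<gamma>. norm e = 1 \<and> r > 0 \<and> L-lipschitz_on {y. y \<bullet> e = 0} \<gamma> \<and>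
        \<Omega> \<inter> ball z r = {x \<in> ball z r. x \<bullet> e > (\<gamma> (x - (x \<bullet> e) *\<^sub>R e) :: real)})"

text \<open>
  The conditions \<open>- div \<sigma> = f\<close> in \<open>\<Omega>\<close> and \<open>\<langle>\<sigma>, \<nu>\<rangle> = 0\<close> on the boundary, in the weak sense: test
  functions range over all of \<open>W\<^sup>1\<^sup>,\<^sup>q(\<Omega>)\<close> with no boundary condition, and \<open>G\<close> is the gradient of \<open>\<phi>\<close>.
\<close>

definition admissible ::
    "real \<Rightarrow> real \<Rightarrow> 'a::euclidean_space set \<Rightarrow> ('a \<Rightarrow> real) \<Rightarrow> ('a \<Rightarrow> 'a) \<Rightarrow> bool" where
  "admissible p q \<Omega> f \<sigma> \<longleftrightarrow> \<sigma> \<in> Lp_on p \<Omega> \<and>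
     (\<forall>\<phi>\<in>W1p q \<Omega>. \<forall>G\<in>Lp_on q \<Omega>. weak_gradient \<Omega> \<phi> G \<longrightarrow>
        (\<integral>x. \<sigma> x \<bullet> G x \<partial>lebesgue_on \<Omega>) = (\<integral>x. f x * \<phi> x \<partial>lebesgue_on \<Omega>))"

definition energy :: "real \<Rightarrow> 'a::euclidean_space set \<Rightarrow> ('a \<Rightarrow> 'a) \<Rightarrow> real" where
  "energy p \<Omega> \<sigma> = (\<integral>x. (1 / p) * norm (\<sigma> x) powr p + norm (\<sigma> x) \<partial>lebesgue_on \<Omega>)"

end

theory Submission
  imports Defs "HOL-Probability.Probability_Measure" "HOL-Real_Asymp.Real_Asymp"
begin

text \<open>
  Write \<open>H(a) = |a|\<^sup>p/p + |a|\<close>. The minimizer is compared with averages of its own translates. If \<open>\<sigma>\<close>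
  were divergence free on the whole space, then \<open>(\<sigma>(x + h) + \<sigma>(x - h))/2\<close> would be a competitor of no
  larger energy, and the uniform convexity of \<open>H\<close> would measure how far it is from \<open>\<sigma>\<close>. The proof localizes
  this comparison.

  Multiplying \<open>\<sigma>(x + h) - \<sigma>(x)\<close> by a cutoff \<open>\<eta>\<close> destroys the constraint, and the cure is the homotopy
  formula for differential forms: the translate of a closed form differs from the form by an exact one, whose
  potential is the average of the form along the segments from \<open>x\<close> to \<open>x + h\<close>, contracted with \<open>h\<close>.
  Cutting off the potential instead of the field gives a divergence free field with principal part
  \<open>\<eta>(x) (\<sigma>(x + h) - \<sigma>(x))\<close> and with a correction of order \<open>h\<close> that contains no derivative of \<open>\<sigma>\<close>
  (\<open>local_shift_div_free\<close>). In the sum of these fields for \<open>h\<close> and \<open>-h\<close> the corrections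
  cancel up to differences of segment averages. Hence, if the differences of \<open>f\<close> have local \<open>L\<^sup>p\<close> size
  \<open>|h|\<^sup>\<alpha>\<close> and those of \<open>\<sigma>\<close> have local size \<open>|h|\<close> to the power \<open>t/p\<close>, then minimality and Clarkson's
  inequality bound the integral of \<open>|\<sigma>(x + h) - \<sigma>(x)|\<^sup>p\<close> by a multiple of \<open>|h|\<close> to the power
  \<open>min (1 + \<alpha>) (1 + t/p)\<close> (\<open>diff_bound_improve\<close>). The map \<open>t \<mapsto> 1 + t/p\<close> has the fixed point
  \<open>q\<close>, so iteration from \<open>t = 0\<close> reaches every exponent \<open>T < q\<close> with \<open>T \<le> 1 + \<alpha>\<close>
  (\<open>minimizer_diff_bound\<close>).

  It remains to embed. If the differences of \<open>u\<close> obey such a bound with exponent \<open>t < n\<close> and \<open>u\<close> is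
  locally in \<open>L\<^sup>s\<close>, then comparing \<open>u(x)\<close> with its values on a ball of suitable radius about \<open>x\<close>
  makes the measure of \<open>{|u| > \<mu>}\<close> decay like \<open>\<mu>\<close> to the power \<open>-(p + ts/n)\<close>
  (\<open>superlevel_decay\<close>). The fixed point of \<open>s \<mapsto> p + ts/n\<close> is \<open>np/(n - t)\<close>, so iteration gives every
  exponent below it (\<open>loc_integrable_of_diff_bound\<close>).

  The hypotheses on \<open>f\<close> enter as bounds on differences: with exponent \<open>1\<close> for \<open>f\<close> in
  \<open>W\<^sup>1\<^sup>,\<^sup>p\<close>, with exponent \<open>\<alpha>\<close> for \<open>f\<close> in the Besov space. The exponent
  \<open>np(3 - q)/(n(3 - q) - 2)\<close> is \<open>np/(n - T)\<close> for \<open>T = 2/(3 - q)\<close>, which is \<open>1 + (q - 1)/(3 - q)\<close> and lies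
  below \<open>q\<close> because \<open>(q - 1)(2 - q) > 0\<close>; for \<open>\<alpha>\<close> below \<open>(q - 1)/(3 - q)\<close> one takes \<open>T = 1 + \<alpha>\<close>.
\<close>

section \<open>Smooth functions\<close>

definition smooth :: "('a::euclidean_space \<Rightarrow> real) \<Rightarrow> bool" where
  "smooth \<phi> \<longleftrightarrow> (\<forall>k. Ck k \<phi>)"

lemma partial_deriv_eqI:
  "(\<phi> has_derivative D) (at x) \<Longrightarrow> partial_deriv v \<phi> x = D v"
  unfolding partial_deriv_def using frechet_derivative_at by metis

lemma Ck_Suc_imp_Ck: "Ck (Suc k) \<phi> \<Longrightarrow> Ck k \<phi>"
proof (induction k arbitrary: \<phi>)
  case 0
  then show ?case
    by (auto intro!: continuous_at_imp_continuous_on differentiable_imp_continuous_within)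
qed auto

lemma Ck_const: "Ck k (\<lambda>x. c)"
proof (induction k arbitrary: c)
  case (Suc k)
  have "partial_deriv i (\<lambda>x::'a. c) = (\<lambda>x. 0)" for i
    by (rule ext, rule partial_deriv_eqI[where D = "\<lambda>v. 0"]) (auto intro!: derivative_eq_intros)
  then show ?case using Suc[of 0] by auto
qed auto

lemma Ck_add: "Ck k \<phi> \<Longrightarrow> Ck k \<psi> \<Longrightarrow> Ck k (\<lambda>x. \<phi> x + \<psi> x)"
proof (induction k arbitrary: \<phi> \<psi>)
  case (Suc k)
  have "partial_deriv i (\<lambda>x. \<phi> x + \<psi> x) = (\<lambda>x. partial_deriv i \<phi> x + partial_deriv i \<psi> x)" for i
  proof
    fix x
    have "(\<phi> has_derivative frechet_derivative \<phi> (at x)) (at x)"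
         "(\<psi> has_derivative frechet_derivative \<psi> (at x)) (at x)"
      using Suc.prems unfolding frechet_derivative_works[symmetric] by auto
    then show "partial_deriv i (\<lambda>x. \<phi> x + \<psi> x) x = partial_deriv i \<phi> x + partial_deriv i \<psi> x"
      by (subst partial_deriv_eqI, rule has_derivative_add) (auto simp: partial_deriv_def)
  qed
  then show ?case using Suc by auto
qed (auto intro: continuous_intros)

lemma partial_deriv_mult:
  assumes "\<phi> differentiable (at x)" "\<psi> differentiable (at x)"
  shows "partial_deriv v (\<lambda>x. \<phi> x * \<psi> x) x = \<phi> x * partial_deriv v \<psi> x + partial_deriv v \<phi> x * \<psi> x"
proof -
  have "(\<phi> has_derivative frechet_derivative \<phi> (at x)) (at x)"
       "(\<psi> has_derivative frechet_derivative \<psi> (at x)) (at x)"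
    using assms frechet_derivative_works by auto
  then show ?thesis
    by (subst partial_deriv_eqI, rule has_derivative_mult) (auto simp: partial_deriv_def)
qed

lemma Ck_mult: "Ck k \<phi> \<Longrightarrow> Ck k \<psi> \<Longrightarrow> Ck k (\<lambda>x. \<phi> x * \<psi> x)"
proof (induction k arbitrary: \<phi> \<psi>)
  case (Suc k)
  have "partial_deriv i (\<lambda>x. \<phi> x * \<psi> x) = (\<lambda>x. \<phi> x * partial_deriv i \<psi> x + partial_deriv i \<phi> x * \<psi> x)" for i
    using Suc.prems by (intro ext partial_deriv_mult) auto
  then show ?case using Suc Ck_Suc_imp_Ck[OF Suc.prems(1)] Ck_Suc_imp_Ck[OF Suc.prems(2)]
    by (auto intro!: Ck_add)
qed (auto intro: continuous_intros)

lemma smooth_const: "smooth (\<lambda>x. c)"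
  and smooth_add: "smooth \<phi> \<Longrightarrow> smooth \<psi> \<Longrightarrow> smooth (\<lambda>x. \<phi> x + \<psi> x)"
  and smooth_mult: "smooth \<phi> \<Longrightarrow> smooth \<psi> \<Longrightarrow> smooth (\<lambda>x. \<phi> x * \<psi> x)"
  unfolding smooth_def by (auto intro: Ck_const Ck_add Ck_mult)

lemma smooth_sum: "(\<And>i. i \<in> I \<Longrightarrow> smooth (\<phi> i)) \<Longrightarrow> smooth (\<lambda>x. \<Sum>i\<in>I. \<phi> i x)"
  by (induction I rule: infinite_finite_induct) (auto intro: smooth_const smooth_add)

lemma smooth_prod: "(\<And>i. i \<in> I \<Longrightarrow> smooth (\<phi> i)) \<Longrightarrow> smooth (\<lambda>x. \<Prod>i\<in>I. \<phi> i x)"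
  by (induction I rule: infinite_finite_induct) (auto intro: smooth_const smooth_mult)

lemma smooth_inner: "smooth (\<lambda>x. x \<bullet> v)"
proof -
  have *: "partial_deriv i (\<lambda>x. x \<bullet> v) = (\<lambda>x. i \<bullet> v)" for i
    by (rule ext, rule partial_deriv_eqI) (auto intro!: derivative_eq_intros)
  have "Ck k (\<lambda>x. x \<bullet> v)" for k
  proof (cases k)
    case (Suc m)
    then show ?thesis using * by (auto intro!: Ck_const differentiableI derivative_eq_intros
      simp: differentiable_def)
  qed (auto intro!: continuous_intros)
  then show ?thesis unfolding smooth_def by simp
qed

lemma smooth_differentiable: "smooth \<phi> \<Longrightarrow> \<phi> differentiable (at x)"
  unfolding smooth_def using Ck.simps(2) by blast

lemma smooth_has_derivative:
  "smooth \<phi> \<Longrightarrow> (\<phi> has_derivative (\<lambda>v. partial_deriv v \<phi> x)) (at x)"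
  using smooth_differentiable frechet_derivative_works unfolding partial_deriv_def
  by (metis eta_contract_eq)

lemma smooth_continuous: "smooth \<phi> \<Longrightarrow> continuous_on S \<phi>"
  unfolding smooth_def using Ck.simps(1) continuous_on_subset by blast

lemma partial_deriv_basis_sum:
  assumes "smooth \<phi>"
  shows "partial_deriv v \<phi> x = (\<Sum>i\<in>Basis. (v \<bullet> i) * partial_deriv i \<phi> x)"
proof -
  interpret D: bounded_linear "\<lambda>v. partial_deriv v \<phi> x"
    using smooth_has_derivative[OF assms] has_derivative_bounded_linear by blast
  have "partial_deriv v \<phi> x = partial_deriv (\<Sum>i\<in>Basis. (v \<bullet> i) *\<^sub>R i) \<phi> x"
    by (simp add: euclidean_representation)
  also have "\<dots> = (\<Sum>i\<in>Basis. (v \<bullet> i) * partial_deriv i \<phi> x)"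
    by (simp add: D.sum D.scaleR)
  finally show ?thesis .
qed

lemma smooth_partial_deriv:
  assumes "smooth \<phi>" shows "smooth (partial_deriv v \<phi>)"
proof -
  have "smooth (partial_deriv i \<phi>)" if "i \<in> Basis" for i
    using assms that Ck.simps(2) unfolding smooth_def by blast
  then have "smooth (\<lambda>x. \<Sum>i\<in>Basis. (v \<bullet> i) * partial_deriv i \<phi> x)"
    by (intro smooth_sum smooth_mult smooth_const)
  moreover have "partial_deriv v \<phi> = (\<lambda>x. \<Sum>i\<in>Basis. (v \<bullet> i) * partial_deriv i \<phi> x)"
    by (intro ext partial_deriv_basis_sum assms)
  ultimately show ?thesis by (simp only:)
qed

lemma smooth_along_line:
  assumes "smooth \<phi>"
  shows "((\<lambda>s. \<phi> (x + s *\<^sub>R h)) has_real_derivative partial_deriv h \<phi> (x + s *\<^sub>R h)) (at s within S)"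
proof -
  interpret D: bounded_linear "\<lambda>v. partial_deriv v \<phi> (x + s *\<^sub>R h)"
    using smooth_has_derivative[OF assms] has_derivative_bounded_linear by blast
  have "((\<lambda>s. \<phi> (x + s *\<^sub>R h)) has_derivative (\<lambda>t. partial_deriv (t *\<^sub>R h) \<phi> (x + s *\<^sub>R h))) (at s within S)"
    by (rule has_derivative_compose[OF _ smooth_has_derivative[OF assms], where f = "\<lambda>s. x + s *\<^sub>R h"])
       (auto intro!: derivative_eq_intros)
  moreover have "(\<lambda>t. partial_deriv (t *\<^sub>R h) \<phi> (x + s *\<^sub>R h)) = (*) (partial_deriv h \<phi> (x + s *\<^sub>R h))"
    by (auto simp: D.scaleR)
  ultimately show ?thesis by (simp add: has_field_derivative_def)
qed

text \<open>Both mixed differences of \<open>\<phi>\<close> over a small parallelogram are the same number, and each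
  is a value of one of the two mixed derivatives near \<open>x\<close>.\<close>

lemma partial_deriv_commute:
  assumes "smooth \<phi>"
  shows "partial_deriv u (partial_deriv v \<phi>) x = partial_deriv v (partial_deriv u \<phi>) x"
proof -
  have mixed: "\<exists>s t. 0 < s \<and> s < e \<and> 0 < t \<and> t < e \<and>
      \<phi> (x + e *\<^sub>R u + e *\<^sub>R v) - \<phi> (x + e *\<^sub>R u) - \<phi> (x + e *\<^sub>R v) + \<phi> x
      = e * e * partial_deriv v (partial_deriv u \<phi>) (x + s *\<^sub>R u + t *\<^sub>R v)"
    if e: "e > 0" for u v and e :: real
  proof -
    have "\<exists>s>0. s < e \<and> (\<phi> (x + e *\<^sub>R v + e *\<^sub>R u) - \<phi> (x + e *\<^sub>R u)) - (\<phi> (x + e *\<^sub>R v + 0 *\<^sub>R u) - \<phi> (x + 0 *\<^sub>R u))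
      = (e - 0) * (partial_deriv u \<phi> (x + e *\<^sub>R v + s *\<^sub>R u) - partial_deriv u \<phi> (x + s *\<^sub>R u))"
      using e by (intro MVT2 derivative_intros smooth_along_line assms) auto
    then obtain s where s: "s > 0" "s < e" "(\<phi> (x + e *\<^sub>R v + e *\<^sub>R u) - \<phi> (x + e *\<^sub>R u)) - (\<phi> (x + e *\<^sub>R v) - \<phi> x)
      = e * (partial_deriv u \<phi> (x + e *\<^sub>R v + s *\<^sub>R u) - partial_deriv u \<phi> (x + s *\<^sub>R u))"
      by auto
    have "\<exists>t>0. t < e \<and> partial_deriv u \<phi> (x + s *\<^sub>R u + e *\<^sub>R v) - partial_deriv u \<phi> (x + s *\<^sub>R u + 0 *\<^sub>R v)
        = (e - 0) * partial_deriv v (partial_deriv u \<phi>) (x + s *\<^sub>R u + t *\<^sub>R v)"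
      using e by (intro MVT2 smooth_along_line smooth_partial_deriv assms) auto
    then obtain t where t: "t > 0" "t < e" "partial_deriv u \<phi> (x + s *\<^sub>R u + e *\<^sub>R v) - partial_deriv u \<phi> (x + s *\<^sub>R u)
        = e * partial_deriv v (partial_deriv u \<phi>) (x + s *\<^sub>R u + t *\<^sub>R v)"
      by auto
    show ?thesis using s t
      by (intro exI[of _ s] exI[of _ t]) (simp add: algebra_simps)
  qed
  have "\<exists>a b. dist a x < e \<and> dist b x < e \<and> partial_deriv u (partial_deriv v \<phi>) a = partial_deriv v (partial_deriv u \<phi>) b"
    if e: "e > 0" for e
  proof -
    define d where "d = e / (norm u + norm v + 1)"
    have d: "d > 0" using e unfolding d_def by (auto intro!: divide_pos_pos add_nonneg_pos)
    have small: "dist (x + s *\<^sub>R u + t *\<^sub>R v) x < e" if "0 < s" "s < d" "0 < t" "t < d" for s t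
    proof -
      have "norm (s *\<^sub>R u + t *\<^sub>R v) \<le> s * norm u + t * norm v"
        using that by (intro order_trans[OF norm_triangle_ineq]) auto
      also have "\<dots> \<le> d * norm u + d * norm v" using that by (intro add_mono mult_right_mono) auto
      also have "\<dots> < d * (norm u + norm v + 1)" using d by (simp add: algebra_simps)
      also have "\<dots> = e" unfolding d_def by (simp add: add_nonneg_eq_0_iff)
      finally show ?thesis by (simp add: dist_norm algebra_simps)
    qed
    obtain s t where 1: "0 < s" "s < d" "0 < t" "t < d"
      "\<phi> (x + d *\<^sub>R u + d *\<^sub>R v) - \<phi> (x + d *\<^sub>R u) - \<phi> (x + d *\<^sub>R v) + \<phi> x
      = d * d * partial_deriv v (partial_deriv u \<phi>) (x + s *\<^sub>R u + t *\<^sub>R v)"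
      using mixed[OF d] by metis
    obtain s' t' where 2: "0 < s'" "s' < d" "0 < t'" "t' < d"
      "\<phi> (x + d *\<^sub>R v + d *\<^sub>R u) - \<phi> (x + d *\<^sub>R v) - \<phi> (x + d *\<^sub>R u) + \<phi> x
      = d * d * partial_deriv u (partial_deriv v \<phi>) (x + s' *\<^sub>R v + t' *\<^sub>R u)"
      using mixed[OF d] by metis
    have "d * d * partial_deriv v (partial_deriv u \<phi>) (x + s *\<^sub>R u + t *\<^sub>R v)
        = d * d * partial_deriv u (partial_deriv v \<phi>) (x + s' *\<^sub>R v + t' *\<^sub>R u)"
      using 1(5) 2(5) by (simp add: algebra_simps)
    then have "partial_deriv v (partial_deriv u \<phi>) (x + s *\<^sub>R u + t *\<^sub>R v)
        = partial_deriv u (partial_deriv v \<phi>) (x + t' *\<^sub>R u + s' *\<^sub>R v)"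
      using d by (simp add: algebra_simps)
    then show ?thesis using small[of s t] small[of t' s'] 1 2 by metis
  qed
  then have "\<forall>n::nat. \<exists>a b. dist a x < 1 / Suc n \<and> dist b x < 1 / Suc n \<and> partial_deriv u (partial_deriv v \<phi>) a = partial_deriv v (partial_deriv u \<phi>) b"
    by simp
  then obtain a b where ab: "\<And>n::nat. dist (a n) x < 1 / Suc n" "\<And>n::nat. dist (b n) x < 1 / Suc n"
    "\<And>n. partial_deriv u (partial_deriv v \<phi>) (a n) = partial_deriv v (partial_deriv u \<phi>) (b n)"
    by metis
  have lim: "c \<longlonglongrightarrow> x" if "\<And>n::nat. dist (c n) x < 1 / Suc n" for c
    using that by (intro metric_LIMSEQ_I) (meson less_trans nat_approx_posE  order.strict_trans2 le_less_trans frac_le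
      of_nat_0_less_iff zero_less_Suc of_nat_mono Suc_le_mono zero_le_one order_refl less_imp_le)
  have "continuous_on UNIV (partial_deriv u (partial_deriv v \<phi>))" "continuous_on UNIV (partial_deriv v (partial_deriv u \<phi>))"
    using assms by (auto intro!: smooth_continuous smooth_partial_deriv)
  then have "(\<lambda>n. partial_deriv u (partial_deriv v \<phi>) (a n)) \<longlonglongrightarrow> partial_deriv u (partial_deriv v \<phi>) x"
    "(\<lambda>n. partial_deriv v (partial_deriv u \<phi>) (b n)) \<longlonglongrightarrow> partial_deriv v (partial_deriv u \<phi>) x"
    using lim[OF ab(1)] lim[OF ab(2)] by (auto intro: continuous_on_tendsto_compose)
  then show ?thesis unfolding ab(3) using LIMSEQ_unique by blast
qed

text \<open>The profiles \<open>t \<mapsto> p(1/t) e\<^sup>-\<^sup>1\<^sup>/\<^sup>t\<close>, continued by \<open>0\<close> to \<open>t \<le> 0\<close>: a family of flat functions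
  that is closed under differentiation, so that all its members are smooth.\<close>

definition flat :: "real poly \<Rightarrow> real \<Rightarrow> real" where
  "flat p t = (if t > 0 then poly p (1 / t) * exp (- (1 / t)) else 0)"

lemma poly_exp_tendsto_0: "((\<lambda>t. poly p t * exp (- t)) \<longlongrightarrow> (0::real)) at_top"
proof -
  have "((\<lambda>t. \<Sum>i\<le>degree p. coeff p i * (t ^ i / exp t)) \<longlongrightarrow> (\<Sum>i\<le>degree p. coeff p i * 0)) at_top"
    by (intro tendsto_sum tendsto_mult tendsto_const tendsto_power_div_exp_0)
  then show ?thesis by (simp add: poly_altdef exp_minus field_simps sum_distrib_left)
qed

lemma flat_tendsto_0: "((\<lambda>t. flat p t) \<longlongrightarrow> 0) (at 0)"
proof (rule filterlim_split_at)
  show "((\<lambda>t. flat p t) \<longlongrightarrow> 0) (at_left 0)"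
    by (rule tendsto_eventually) (auto simp: flat_def eventually_at_left_field intro: exI[of _ "-1"])
  have "((\<lambda>t. poly p (inverse t) * exp (- inverse t)) \<longlongrightarrow> 0) (at_right 0)"
    by (rule filterlim_compose[OF poly_exp_tendsto_0 filterlim_inverse_at_top_right])
  then show "((\<lambda>t. flat p t) \<longlongrightarrow> 0) (at_right 0)"
    by (rule Lim_transform_eventually)
       (auto simp: flat_def eventually_at_right_field field_simps intro: exI[of _ 1])
qed

lemma flat_deriv: "(flat p has_real_derivative flat ([:0, 0, 1:] * (p - pderiv p)) t) (at t)"
proof -
  consider "t > 0" | "t < 0" | "t = 0" by linarith
  then show ?thesis
  proof cases
    case 1
    have "((\<lambda>t. poly p (1 / t) * exp (- (1 / t))) has_real_derivative flat ([:0, 0, 1:] * (p - pderiv p)) t) (at t)"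
      using 1 by (auto intro!: derivative_eq_intros DERIV_chain2[OF poly_DERIV] simp: flat_def field_simps power2_eq_square)
    then show ?thesis
      using 1 by (subst DERIV_cong_ev[OF refl _ refl])
        (auto simp: flat_def eventually_nhds intro!: exI[of _ "{0<..}"])
  next
    case 2
    have "((\<lambda>t. 0) has_real_derivative flat ([:0, 0, 1:] * (p - pderiv p)) t) (at t)"
      using 2 by (auto simp: flat_def)
    then show ?thesis
      using 2 by (subst DERIV_cong_ev[OF refl _ refl, where g = "\<lambda>t. 0"])
        (auto simp: flat_def eventually_nhds intro!: exI[of _ "{..<0}"])
  next
    case 3
    have "((\<lambda>y. (flat p y - flat p 0) / (y - 0)) \<longlongrightarrow> 0) (at 0)"
      by (rule Lim_transform_eventually[OF flat_tendsto_0[of "[:0, 1:] * p"]])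
         (auto simp: flat_def eventually_at_filter)
    then show ?thesis using 3 by (simp add: has_field_derivative_iff flat_def)
  qed
qed

lemma Ck_flat_compose:
  assumes "smooth \<phi>"
  shows "Ck k (\<lambda>x. flat p (\<phi> x))"
proof (induction k arbitrary: p)
  case 0
  have "continuous_on UNIV (flat p)"
    using flat_deriv by (auto intro!: continuous_at_imp_continuous_on DERIV_isCont)
  then show ?case
    using smooth_continuous[OF assms] by (auto intro: continuous_on_compose2)
next
  case (Suc k)
  have D: "((\<lambda>x. flat p (\<phi> x)) has_derivative (\<lambda>v. flat ([:0, 0, 1:] * (p - pderiv p)) (\<phi> x) * partial_deriv v \<phi> x)) (at x)" for x
    by (rule has_derivative_compose[OF smooth_has_derivative[OF assms], of "flat p", unfolded has_field_derivative_def[symmetric]])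
       (use flat_deriv in \<open>auto simp: has_field_derivative_def\<close>)
  have "partial_deriv i (\<lambda>x. flat p (\<phi> x)) = (\<lambda>x. flat ([:0, 0, 1:] * (p - pderiv p)) (\<phi> x) * partial_deriv i \<phi> x)" for i
    by (rule ext, rule partial_deriv_eqI[OF D])
  moreover have "Ck k (partial_deriv i \<phi>)" for i
    using smooth_partial_deriv[OF assms] unfolding smooth_def by blast
  ultimately show ?case using D Suc by (auto intro!: Ck_mult simp: differentiable_def)
qed

lemma smooth_flat_compose: "smooth \<phi> \<Longrightarrow> smooth (\<lambda>x. flat p (\<phi> x))"
  unfolding smooth_def[of "\<lambda>x. flat p (\<phi> x)"] using Ck_flat_compose by blast

text \<open>A bump on the box between \<open>a\<close> and \<open>b\<close>; as \<open>k\<close> grows it increases to the indicator of the box.\<close>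

definition box_bump :: "real \<Rightarrow> 'a::euclidean_space \<Rightarrow> 'a \<Rightarrow> 'a \<Rightarrow> real" where
  "box_bump k a b x = (\<Prod>i\<in>Basis. flat 1 (k * ((x \<bullet> i - a \<bullet> i) * (b \<bullet> i - x \<bullet> i))))"

lemma flat_1: "flat 1 t = (if t > 0 then exp (- (1 / t)) else 0)"
  by (simp add: flat_def)

lemma flat_1_bounds: "0 \<le> flat 1 t" "flat 1 t \<le> 1" "flat 1 t > 0 \<longleftrightarrow> t > 0"
  by (auto simp: flat_1)

lemma smooth_box_bump: "smooth (box_bump k a b)"
proof -
  have "smooth (\<lambda>x. k * ((x \<bullet> i + (- (a \<bullet> i))) * (b \<bullet> i + (-1) * (x \<bullet> i))))" for i :: 'a
    by (intro smooth_mult smooth_add smooth_const smooth_inner)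
  then have "smooth (\<lambda>x. k * ((x \<bullet> i - a \<bullet> i) * (b \<bullet> i - x \<bullet> i)))" for i :: 'a
    by simp
  then show ?thesis unfolding box_bump_def[abs_def]
    by (intro smooth_prod smooth_flat_compose)
qed

lemma box_bump_bounds: "0 \<le> box_bump k a b x" "box_bump k a b x \<le> 1"
  unfolding box_bump_def by (auto intro!: prod_nonneg prod_le_1 flat_1_bounds)

lemma box_bump_pos:
  assumes "k > 0" "box a b \<noteq> {}"
  shows "box_bump k a b x > 0 \<longleftrightarrow> x \<in> box a b"
proof -
  have "box_bump k a b x > 0 \<longleftrightarrow> (\<forall>i\<in>Basis. flat 1 (k * ((x \<bullet> i - a \<bullet> i) * (b \<bullet> i - x \<bullet> i))) > 0)"
    unfolding box_bump_def
    by (metis (no_types, lifting) box_bump_bounds(1) box_bump_def flat_1_bounds(1) finite_Basis less_eq_real_def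
        less_irrefl prod_pos prod_zero_iff)
  also have "\<dots> \<longleftrightarrow> (\<forall>i\<in>Basis. a \<bullet> i < x \<bullet> i \<and> x \<bullet> i < b \<bullet> i)"
  proof (rule ball_cong[OF refl])
    fix i :: 'a assume "i \<in> Basis"
    then have "a \<bullet> i < b \<bullet> i" using assms(2) by (auto simp: box_ne_empty)
    then show "flat 1 (k * ((x \<bullet> i - a \<bullet> i) * (b \<bullet> i - x \<bullet> i))) > 0 \<longleftrightarrow> a \<bullet> i < x \<bullet> i \<and> x \<bullet> i < b \<bullet> i"
      using assms(1) by (auto simp: flat_1_bounds zero_less_mult_iff)
  qed
  finally show ?thesis by (simp add: mem_box)
qed

text \<open>Test functions therefore determine the integrals of a function over boxes.\<close>

lemma box_bump_tendsto:
  assumes "box a b \<noteq> {}"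
  shows "(\<lambda>n. box_bump (real (Suc n)) a b x) \<longlonglongrightarrow> indicator (box a b) x"
proof (cases "x \<in> box a b")
  case True
  have "(\<lambda>n. flat 1 (real (Suc n) * c)) \<longlonglongrightarrow> 1" if "c > 0" for c
    using that unfolding flat_1 by (simp add: zero_less_mult_iff) real_asymp
  moreover have "(x \<bullet> i - a \<bullet> i) * (b \<bullet> i - x \<bullet> i) > 0" if "i \<in> Basis" for i
    using True that by (auto simp: mem_box)
  ultimately have "(\<lambda>n. box_bump (real (Suc n)) a b x) \<longlonglongrightarrow> (\<Prod>i\<in>(Basis::'a set). 1)"
    unfolding box_bump_def by (intro tendsto_prod) auto
  then show ?thesis using True by simp
next
  case False
  then have "box_bump (real (Suc n)) a b x = 0" for n
    using box_bump_pos[OF _ assms, of "real (Suc n)" x] box_bump_bounds(1)[of "real (Suc n)" a b x] by auto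
  then show ?thesis using False by simp
qed

lemma test_function_smooth: "\<phi> \<in> test_functions \<Omega> \<Longrightarrow> smooth \<phi>"
  by (simp add: test_functions_def smooth_def)

lemma test_functionI:
  assumes "smooth \<phi>" "compact K" "K \<subseteq> \<Omega>" "\<And>x. x \<notin> K \<Longrightarrow> \<phi> x = 0"
  shows "\<phi> \<in> test_functions \<Omega>"
proof -
  have "closure {x. \<phi> x \<noteq> 0} \<subseteq> K"
    using assms by (intro closure_minimal) (auto intro: compact_imp_closed)
  then show ?thesis using assms compact_closure compact_imp_bounded bounded_subset
    by (auto simp: test_functions_def smooth_def compact_eq_bounded_closed)
qed

lemma test_functionE:
  assumes "\<phi> \<in> test_functions \<Omega>"
  obtains K where "compact K" "K \<subseteq> \<Omega>" "\<And>x. x \<notin> K \<Longrightarrow> \<phi> x = 0"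
proof (rule that[of "closure {x. \<phi> x \<noteq> 0}"])
  show "\<phi> x = 0" if "x \<notin> closure {x. \<phi> x \<noteq> 0}" for x
    using that closure_subset[of "{x. \<phi> x \<noteq> 0}"] by auto
qed (use assms in \<open>auto simp: test_functions_def\<close>)

lemma test_function_mult:
  assumes "\<phi> \<in> test_functions \<Omega>" "smooth \<psi>"
  shows "(\<lambda>x. \<phi> x * \<psi> x) \<in> test_functions \<Omega>"
proof -
  obtain K where "compact K" "K \<subseteq> \<Omega>" "\<And>x. x \<notin> K \<Longrightarrow> \<phi> x = 0"
    using test_functionE[OF assms(1)] by metis
  then show ?thesis
    using assms test_function_smooth by (intro test_functionI[of _ K] smooth_mult) auto
qed

lemma partial_deriv_outside_support:
  assumes "closed K" "\<And>x. x \<notin> K \<Longrightarrow> \<phi> x = 0" "x \<notin> K"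
  shows "partial_deriv v \<phi> x = 0"
proof -
  have "(\<phi> has_derivative (\<lambda>v. 0)) (at x)"
    by (rule has_derivative_transform_within_open[of "\<lambda>x. 0" _ _ _ "- K"])
       (use assms in \<open>auto simp: open_Compl\<close>)
  then show ?thesis using partial_deriv_eqI by blast
qed

lemma test_function_partial_deriv:
  assumes "\<phi> \<in> test_functions \<Omega>"
  shows "partial_deriv v \<phi> \<in> test_functions \<Omega>"
proof -
  obtain K where K: "compact K" "K \<subseteq> \<Omega>" "\<And>x. x \<notin> K \<Longrightarrow> \<phi> x = 0"
    using test_functionE[OF assms] by metis
  show ?thesis
    using partial_deriv_outside_support[OF compact_imp_closed[OF K(1)] K(3)] K(1,2)
      test_function_smooth[OF assms]
    by (intro test_functionI[of _ K]) (auto intro: smooth_partial_deriv)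
qed

lemma test_function_bounded:
  assumes "\<phi> \<in> test_functions \<Omega>"
  obtains B where "B > 0" "\<And>x. \<bar>\<phi> x\<bar> \<le> B"
proof -
  obtain K where K: "compact K" "K \<subseteq> \<Omega>" "\<And>x. x \<notin> K \<Longrightarrow> \<phi> x = 0"
    using test_functionE[OF assms] by metis
  have "bounded (\<phi> ` K)"
    using K smooth_continuous[OF test_function_smooth[OF assms]]
    by (intro compact_imp_bounded compact_continuous_image) auto
  then obtain B where "B > 0" "\<And>x. x \<in> K \<Longrightarrow> \<bar>\<phi> x\<bar> \<le> B"
    by (auto simp: bounded_pos)
  then show ?thesis using K(3) that[of B] by (metis abs_zero less_eq_real_def)
qed

lemma test_function_lipschitz:
  assumes "\<phi> \<in> test_functions \<Omega>"
  obtains B where "B > 0" "\<And>x h. \<bar>\<phi> (x + h) - \<phi> x\<bar> \<le> B * norm h"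
proof -
  have "\<exists>B>0. \<forall>x. \<bar>partial_deriv i \<phi> x\<bar> \<le> B" for i
    using test_function_bounded[OF test_function_partial_deriv[OF assms]] by metis
  then obtain B where B: "\<And>i. B i > 0" "\<And>i x. \<bar>partial_deriv i \<phi> x\<bar> \<le> B i" by metis
  have D: "\<bar>partial_deriv h \<phi> x\<bar> \<le> (\<Sum>i\<in>Basis. B i) * norm h" for h x
  proof -
    have "\<bar>partial_deriv h \<phi> x\<bar> \<le> (\<Sum>i\<in>Basis. \<bar>(h \<bullet> i) * partial_deriv i \<phi> x\<bar>)"
      unfolding partial_deriv_basis_sum[OF test_function_smooth[OF assms], of h] by (rule sum_abs)
    also have "\<dots> \<le> (\<Sum>i\<in>Basis. norm h * B i)"
      using B by (intro sum_mono) (auto simp: abs_mult Basis_le_norm intro!: mult_mono)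
    finally show ?thesis by (simp add: sum_distrib_left mult.commute)
  qed
  show ?thesis
  proof (rule that[of "\<Sum>i\<in>Basis. B i"])
    show "(\<Sum>i\<in>Basis. B i) > 0" using B by (intro sum_pos) auto
    fix x h
    have "\<exists>s>0. s < 1 \<and> \<phi> (x + 1 *\<^sub>R h) - \<phi> (x + 0 *\<^sub>R h) = (1 - 0) * partial_deriv h \<phi> (x + s *\<^sub>R h)"
      by (intro MVT2 smooth_along_line test_function_smooth[OF assms]) auto
    then show "\<bar>\<phi> (x + h) - \<phi> x\<bar> \<le> (\<Sum>i\<in>Basis. B i) * norm h" using D by auto
  qed
qed

text \<open>The exponents below reach beyond \<open>1\<close>, so a Lipschitz bound for the cutoff would not suffice where two
  translates of the energy density are balanced against the density itself.\<close>

lemma test_function_second_difference: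
  assumes "\<phi> \<in> test_functions \<Omega>"
  obtains B where "B > 0" "\<And>x h. \<bar>\<phi> (x + h) + \<phi> (x - h) - 2 * \<phi> x\<bar> \<le> B * (norm h)\<^sup>2"
proof -
  have "\<exists>B>0. \<forall>x h. \<bar>partial_deriv i \<phi> (x + h) - partial_deriv i \<phi> x\<bar> \<le> B * norm h" for i
    using test_function_lipschitz[OF test_function_partial_deriv[OF assms]] by metis
  then obtain B where B: "\<And>i. B i > 0" "\<And>i x h. \<bar>partial_deriv i \<phi> (x + h) - partial_deriv i \<phi> x\<bar> \<le> B i * norm h" by metis
  have D: "\<bar>partial_deriv h \<phi> (x + k) - partial_deriv h \<phi> x\<bar> \<le> (\<Sum>i\<in>Basis. B i) * norm h * norm k" for h x k
  proof -
    have "\<bar>partial_deriv h \<phi> (x + k) - partial_deriv h \<phi> x\<bar> = \<bar>\<Sum>i\<in>Basis. (h \<bullet> i) * (partial_deriv i \<phi> (x + k) - partial_deriv i \<phi> x)\<bar>"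
      unfolding partial_deriv_basis_sum[OF test_function_smooth[OF assms], of h] by (simp add: algebra_simps sum_subtractf)
    also have "\<dots> \<le> (\<Sum>i\<in>Basis. \<bar>(h \<bullet> i) * (partial_deriv i \<phi> (x + k) - partial_deriv i \<phi> x)\<bar>)"
      by (rule sum_abs)
    also have "\<dots> \<le> (\<Sum>i\<in>Basis. norm h * (B i * norm k))"
      using B by (intro sum_mono) (auto simp: abs_mult Basis_le_norm intro!: mult_mono)
    finally show ?thesis by (simp add: sum_distrib_left sum_distrib_right mult.commute mult.left_commute)
  qed
  have nn: "(\<Sum>i\<in>Basis. B i) \<ge> 0" using B by (intro sum_nonneg) (auto intro: less_imp_le)
  show ?thesis
  proof (rule that[of "2 * (\<Sum>i\<in>Basis. B i)"])
    show "2 * (\<Sum>i\<in>Basis. B i) > 0" using B by (auto intro!: sum_pos)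
    fix x h
    have "((\<lambda>s. \<phi> (x + s *\<^sub>R h) + \<phi> (x + s *\<^sub>R (-h))) has_real_derivative
        partial_deriv h \<phi> (x + s *\<^sub>R h) + partial_deriv (-h) \<phi> (x + s *\<^sub>R (-h))) (at s)" for s
      by (intro derivative_intros smooth_along_line test_function_smooth[OF assms])
    then have "\<exists>s>0. s < 1 \<and> (\<phi> (x + 1 *\<^sub>R h) + \<phi> (x + 1 *\<^sub>R (-h))) - (\<phi> (x + 0 *\<^sub>R h) + \<phi> (x + 0 *\<^sub>R (-h)))
      = (1 - 0) * (partial_deriv h \<phi> (x + s *\<^sub>R h) + partial_deriv (-h) \<phi> (x + s *\<^sub>R (-h)))"
      by (intro MVT2) auto
    then obtain s where s: "s > 0" "s < 1" "\<phi> (x + h) + \<phi> (x - h) - 2 * \<phi> x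
      = partial_deriv h \<phi> (x + s *\<^sub>R h) + partial_deriv (-h) \<phi> (x - s *\<^sub>R h)" by auto
    have minus: "partial_deriv (-h) \<phi> (x - s *\<^sub>R h) = - partial_deriv h \<phi> (x - s *\<^sub>R h)"
      unfolding partial_deriv_basis_sum[OF test_function_smooth[OF assms], of h]
        partial_deriv_basis_sum[OF test_function_smooth[OF assms], of "-h"] by (simp add: sum_negf)
    have shift: "(x - s *\<^sub>R h) + (2 * s) *\<^sub>R h = x + s *\<^sub>R h"
      by (simp only: mult_2 scaleR_left_distrib) simp
    have "\<bar>\<phi> (x + h) + \<phi> (x - h) - 2 * \<phi> x\<bar> =
      \<bar>partial_deriv h \<phi> ((x - s *\<^sub>R h) + (2 * s) *\<^sub>R h) - partial_deriv h \<phi> (x - s *\<^sub>R h)\<bar>"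
      unfolding s(3) minus shift by (simp only: add_uminus_conv_diff)
    also have "\<dots> \<le> (\<Sum>i\<in>Basis. B i) * norm h * norm ((2 * s) *\<^sub>R h)" by (rule D)
    also have "\<dots> \<le> (\<Sum>i\<in>Basis. B i) * norm h * (2 * norm h)"
      using s nn by (intro mult_left_mono) (auto intro!: mult_left_le_one_le)
    finally show "\<bar>\<phi> (x + h) + \<phi> (x - h) - 2 * \<phi> x\<bar> \<le> 2 * (\<Sum>i\<in>Basis. B i) * (norm h)\<^sup>2"
      by (simp add: power2_eq_square algebra_simps)
  qed
qed

text \<open>The bound \<open>1/2\<close> makes a localized second difference of a field a convex combination of midpoints, as
  \<open>flux_density_second_difference\<close> needs it.\<close>

lemma cutoff_exists:
  assumes "compact K" "open \<Omega>" "K \<subseteq> \<Omega>"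
  obtains \<eta> c where "\<eta> \<in> test_functions \<Omega>" "c > 0" "\<And>x. 0 \<le> \<eta> x" "\<And>x. \<eta> x \<le> 1 / 2" "\<And>x. x \<in> K \<Longrightarrow> c \<le> \<eta> x"
proof -
  have "\<exists>a b. x \<in> box a b \<and> cbox a b \<subseteq> \<Omega>" if "x \<in> K" for x
    using open_contains_cbox[OF assms(2), of x] assms(3) that by (metis subsetD)
  then obtain a b where ab: "\<And>x. x \<in> K \<Longrightarrow> x \<in> box (a x) (b x)" "\<And>x. x \<in> K \<Longrightarrow> cbox (a x) (b x) \<subseteq> \<Omega>"
    by metis
  obtain F where F: "F \<subseteq> K" "finite F" "K \<subseteq> (\<Union>x\<in>F. box (a x) (b x))"
  proof (rule compactE_image[OF assms(1), of K "\<lambda>x. box (a x) (b x)"])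
    show "K \<subseteq> (\<Union>x\<in>K. box (a x) (b x))" using ab(1) by blast
  qed auto
  define \<beta> where "\<beta> = (\<lambda>x. 1 / (2 * real (card F) + 2) * (\<Sum>z\<in>F. box_bump 1 (a z) (b z) x))"
  have sm: "smooth \<beta>" unfolding \<beta>_def by (intro smooth_mult smooth_const smooth_sum smooth_box_bump)
  have T: "\<beta> \<in> test_functions \<Omega>"
  proof (rule test_functionI[OF sm])
    show "compact (\<Union>z\<in>F. cbox (a z) (b z))" using F by (intro compact_UN) auto
    show "(\<Union>z\<in>F. cbox (a z) (b z)) \<subseteq> \<Omega>" using ab F by blast
    fix x assume x: "x \<notin> (\<Union>z\<in>F. cbox (a z) (b z))"
    have "box_bump 1 (a z) (b z) x = 0" if "z \<in> F" for z
      using box_bump_pos[of 1 "a z" "b z" x] box_bump_bounds(1)[of 1 "a z" "b z" x] x that ab(1) F(1) box_subset_cbox[of "a z" "b z"]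
      by (force simp: less_eq_real_def)
    then show "\<beta> x = 0" by (simp add: \<beta>_def)
  qed
  have pos: "\<beta> x > 0" if "x \<in> K" for x
  proof -
    obtain z where z: "z \<in> F" "x \<in> box (a z) (b z)" using F(3) \<open>x \<in> K\<close> by auto
    have "0 < box_bump 1 (a z) (b z) x" using z box_bump_pos[of 1 "a z" "b z" x] by auto
    also have "\<dots> \<le> (\<Sum>z\<in>F. box_bump 1 (a z) (b z) x)"
      using F z box_bump_bounds(1) by (intro member_le_sum) auto
    finally show ?thesis by (auto simp: \<beta>_def intro!: divide_pos_pos)
  qed
  have ge: "0 \<le> \<beta> x" for x unfolding \<beta>_def
    by (intro mult_nonneg_nonneg sum_nonneg box_bump_bounds) auto
  have le: "\<beta> x \<le> 1 / 2" for x
  proof -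
    have "(\<Sum>z\<in>F. box_bump 1 (a z) (b z) x) \<le> (\<Sum>z\<in>F. 1)" by (intro sum_mono box_bump_bounds)
    then show ?thesis by (simp add: \<beta>_def field_simps)
  qed
  have "\<exists>c>0. \<forall>x\<in>K. c \<le> \<beta> x"
  proof (cases "K = {}")
    case False
    then obtain y where "y \<in> K" "\<And>x. x \<in> K \<Longrightarrow> \<beta> y \<le> \<beta> x"
      using continuous_attains_inf[OF assms(1) False smooth_continuous[OF sm]] by auto
    then show ?thesis using pos by blast
  qed (auto intro: exI[of _ 1])
  then show ?thesis using that[OF T] ge le by metis
qed

section \<open>Powers of norms\<close>

text \<open>The graph of a power lies above its tangent at \<open>c\<close>: Young's inequality for \<open>x\<close> and
  \<open>c powr (p - 1)\<close>, valid also at \<open>c = 0\<close>. Convexity and Jensen's inequality both follow from it.\<close>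

lemma powr_tangent:
  fixes x c p :: real
  assumes "p > 1" "x \<ge> 0" "c \<ge> 0"
  shows "p * (x * c powr (p - 1)) - (p - 1) * c powr p \<le> x powr p"
proof -
  have q: "p / (p - 1) > 1" "1 / p + 1 / (p / (p - 1)) = 1" using assms by (auto simp: field_simps)
  have "x * c powr (p - 1) \<le> x powr p / p + (c powr (p - 1)) powr (p / (p - 1)) / (p / (p - 1))"
    using assms q by (intro Youngs_inequality) auto
  also have "(c powr (p - 1)) powr (p / (p - 1)) = c powr p" using assms by (simp add: powr_powr)
  finally have "x * c powr (p - 1) * p \<le> (x powr p / p + c powr p / (p / (p - 1))) * p"
    using assms by (intro mult_right_mono) auto
  also have "\<dots> = x powr p + (p - 1) * c powr p" using assms by (simp add: field_simps)
  finally show ?thesis by (simp add: algebra_simps)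
qed

lemma powr_mult_pred: "c \<ge> 0 \<Longrightarrow> c * c powr (p - 1) = c powr (p::real)"
  using powr_mult_base[of c "p - 1"] by simp

lemma powr_convex_combination:
  fixes x y p \<theta> :: real
  assumes "p > 1" "x \<ge> 0" "y \<ge> 0" "0 \<le> \<theta>" "\<theta> \<le> 1"
  shows "((1 - \<theta>) * x + \<theta> * y) powr p \<le> (1 - \<theta>) * x powr p + \<theta> * y powr p"
proof -
  define c where "c = (1 - \<theta>) * x + \<theta> * y"
  have c: "c \<ge> 0" using assms by (auto simp: c_def)
  have "(1 - \<theta>) * (p * (x * c powr (p - 1)) - (p - 1) * c powr p)
      + \<theta> * (p * (y * c powr (p - 1)) - (p - 1) * c powr p) \<le> (1 - \<theta>) * x powr p + \<theta> * y powr p"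
    using assms c by (intro add_mono mult_left_mono powr_tangent) auto
  also have "(1 - \<theta>) * (p * (x * c powr (p - 1)) - (p - 1) * c powr p)
      + \<theta> * (p * (y * c powr (p - 1)) - (p - 1) * c powr p) = p * (c * c powr (p - 1)) - (p - 1) * c powr p"
    by (simp add: c_def algebra_simps)
  also have "\<dots> = c powr p" unfolding powr_mult_pred[OF c] by (simp add: algebra_simps)
  finally show ?thesis by (simp add: c_def)
qed

lemma norm_powr_convex:
  fixes a b :: "'b::real_normed_vector" and p \<theta> :: real
  assumes "p > 1" "0 \<le> \<theta>" "\<theta> \<le> 1"
  shows "norm ((1 - \<theta>) *\<^sub>R a + \<theta> *\<^sub>R b) powr p \<le> (1 - \<theta>) * norm a powr p + \<theta> * norm b powr p"
proof -
  have "norm ((1 - \<theta>) *\<^sub>R a + \<theta> *\<^sub>R b) \<le> (1 - \<theta>) * norm a + \<theta> * norm b"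
    using assms by (intro order_trans[OF norm_triangle_ineq]) auto
  then have "norm ((1 - \<theta>) *\<^sub>R a + \<theta> *\<^sub>R b) powr p \<le> ((1 - \<theta>) * norm a + \<theta> * norm b) powr p"
    using assms by (intro powr_mono2) auto
  also have "\<dots> \<le> (1 - \<theta>) * norm a powr p + \<theta> * norm b powr p"
    using assms by (intro powr_convex_combination) auto
  finally show ?thesis .
qed

lemma norm_add_powr_le:
  fixes a b :: "'b::real_normed_vector" and p :: real
  assumes "p > 0"
  shows "norm (a + b) powr p \<le> 2 powr p * (norm a powr p + norm b powr p)"
proof -
  have "norm (a + b) \<le> 2 * max (norm a) (norm b)"
    by (smt (verit) norm_triangle_ineq)
  then have "norm (a + b) powr p \<le> (2 * max (norm a) (norm b)) powr p"
    using assms by (intro powr_mono2) auto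
  also have "\<dots> = 2 powr p * max (norm a) (norm b) powr p" by (simp add: powr_mult)
  also have "\<dots> \<le> 2 powr p * (norm a powr p + norm b powr p)"
    by (intro mult_left_mono) (auto simp: max_def)
  finally show ?thesis .
qed

lemma norm_diff_powr_le:
  fixes a b :: "'b::real_normed_vector" and p :: real
  assumes "p > 0"
  shows "norm (a - b) powr p \<le> 2 powr p * (norm a powr p + norm b powr p)"
  using norm_add_powr_le[OF assms, of a "- b"] by simp

lemma le_one_plus_powr: "x \<ge> 0 \<Longrightarrow> p \<ge> 1 \<Longrightarrow> x \<le> 1 + x powr (p::real)"
proof (cases "x \<le> 1")
  case False
  assume "x \<ge> 0" "p \<ge> 1"
  then have "x powr 1 \<le> x powr p" using False by (intro powr_mono) auto
  then show ?thesis using False by simp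
qed (simp add: add_increasing2)

section \<open>Borel functions with integrable powers\<close>

text \<open>Everything is computed with Borel functions on the whole space: unlike Lebesgue measurable ones, they remain
  jointly measurable after the substitution \<open>(x, s) \<mapsto> x + s h\<close>, so that Tonelli's theorem applies.\<close>

definition Lp_borel :: "real \<Rightarrow> ('a::euclidean_space \<Rightarrow> 'b::euclidean_space) \<Rightarrow> bool" where
  "Lp_borel p u \<longleftrightarrow> u \<in> borel_measurable borel \<and> integrable lborel (\<lambda>x. norm (u x) powr p)"

lemma Lp_borelD [measurable_dest]: "Lp_borel p u \<Longrightarrow> u \<in> borel_measurable borel"
  by (simp add: Lp_borel_def)

lemma Lp_borel_integrable: "Lp_borel p u \<Longrightarrow> integrable lborel (\<lambda>x. norm (u x) powr p)"
  by (simp add: Lp_borel_def)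

lemma Lp_borel_iff:
  "Lp_borel p u \<longleftrightarrow> u \<in> borel_measurable borel \<and> (\<integral>\<^sup>+x. ennreal (norm (u x) powr p) \<partial>lborel) < \<infinity>"
  unfolding Lp_borel_def by (auto simp: integrable_iff_bounded)

lemmas integral_linear =
  Bochner_Integration.integral_add Bochner_Integration.integral_diff integral_mult_right_zero
  Bochner_Integration.integrable_add Bochner_Integration.integrable_diff integrable_mult_right

lemma Lp_borel_bound:
  assumes "u \<in> borel_measurable borel" "integrable lborel g" "\<And>x. norm (u x) powr p \<le> g x"
  shows "Lp_borel p u"
  unfolding Lp_borel_def
proof safe
  show "integrable lborel (\<lambda>x. norm (u x) powr p)"
    by (rule Bochner_Integration.integrable_bound[OF assms(2)])
       (use assms in \<open>auto intro!: AE_I2 intro: order_trans[OF _ abs_ge_self]\<close>)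
qed (use assms in auto)

lemma Lp_borel_add:
  assumes "Lp_borel p u" "Lp_borel p v" "p > 0"
  shows "Lp_borel p (\<lambda>x. u x + v x)"
  using assms
  by (intro Lp_borel_bound[where g = "\<lambda>x. 2 powr p * (norm (u x) powr p + norm (v x) powr p)"]
        norm_add_powr_le) (auto simp: Lp_borel_def)

lemma Lp_borel_scale:
  fixes c :: "'a::euclidean_space \<Rightarrow> real" and u :: "'a \<Rightarrow> 'b::euclidean_space"
  assumes "Lp_borel p u" "c \<in> borel_measurable borel" "\<And>x. \<bar>c x\<bar> \<le> B" "p > 0"
  shows "Lp_borel p (\<lambda>x. c x *\<^sub>R u x)"
proof (rule Lp_borel_bound[where g = "\<lambda>x. B powr p * norm (u x) powr p"])
  have B: "B \<ge> 0" using assms(3)[of 0] by linarith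
  show "norm (c x *\<^sub>R u x) powr p \<le> B powr p * norm (u x) powr p" for x
    using B assms(3)[of x] assms(4) by (auto simp: powr_mult[symmetric] intro!: powr_mono2 mult_right_mono)
qed (use assms in \<open>auto simp: Lp_borel_def\<close>)

lemma Lp_borel_cmult: "Lp_borel p u \<Longrightarrow> p > 0 \<Longrightarrow> Lp_borel p (\<lambda>x. (c::real) *\<^sub>R u x)"
  by (rule Lp_borel_scale[where B = "\<bar>c\<bar>"]) auto

lemma Lp_borel_minus: "Lp_borel p u \<Longrightarrow> Lp_borel p (\<lambda>x. - u x)"
  by (simp add: Lp_borel_def)

lemma Lp_borel_diff: "Lp_borel p u \<Longrightarrow> Lp_borel p v \<Longrightarrow> p > 0 \<Longrightarrow> Lp_borel p (\<lambda>x. u x - v x)"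
  using Lp_borel_add[of p u "\<lambda>x. - v x"] Lp_borel_minus[of p v] by simp

lemma Lp_borel_inner_right:
  fixes u :: "'a::euclidean_space \<Rightarrow> 'b::euclidean_space"
  assumes "Lp_borel p u" "p > 0"
  shows "Lp_borel p (\<lambda>x. u x \<bullet> v)"
proof (rule Lp_borel_bound[where g = "\<lambda>x. norm v powr p * norm (u x) powr p"])
  show "norm (u x \<bullet> v) powr p \<le> norm v powr p * norm (u x) powr p" for x
    using assms(2) Cauchy_Schwarz_ineq2[of "u x" v]
    by (auto simp: powr_mult[symmetric] mult.commute intro!: powr_mono2)
qed (use assms in \<open>auto simp: Lp_borel_def\<close>)

lemma Lp_borel_integrable_inner:
  fixes u v :: "'a::euclidean_space \<Rightarrow> 'b::euclidean_space"
  assumes "Lp_borel p u" "Lp_borel q v" "p > 1" "q > 1" "1 / p + 1 / q = 1"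
  shows "integrable lborel (\<lambda>x. u x \<bullet> v x)"
proof (rule Bochner_Integration.integrable_bound)
  show "integrable lborel (\<lambda>x. norm (u x) powr p / p + norm (v x) powr q / q)"
    using assms by (auto simp: Lp_borel_def)
  show "AE x in lborel. norm (u x \<bullet> v x) \<le> norm (norm (u x) powr p / p + norm (v x) powr q / q)"
  proof (rule AE_I2)
    fix x
    have "norm (u x \<bullet> v x) \<le> norm (u x) * norm (v x)" by (rule Cauchy_Schwarz_ineq2[folded real_norm_def])
    also have "\<dots> \<le> norm (u x) powr p / p + norm (v x) powr q / q"
      using assms by (intro Youngs_inequality) auto
    finally show "norm (u x \<bullet> v x) \<le> norm (norm (u x) powr p / p + norm (v x) powr q / q)" by simp
  qed
qed (use assms in \<open>auto simp: Lp_borel_def\<close>)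

abbreviation int_powr :: "real \<Rightarrow> 'a::euclidean_space set \<Rightarrow> ('a \<Rightarrow> 'b::euclidean_space) \<Rightarrow> ennreal" where
  "int_powr p L u \<equiv> \<integral>\<^sup>+x. ennreal (indicator L x * norm (u x) powr p) \<partial>lborel"

lemma nn_integral_translate:
  fixes h :: "'a::euclidean_space"
  assumes [measurable]: "f \<in> borel_measurable borel"
  shows "(\<integral>\<^sup>+x. f (x + h) \<partial>lborel) = (\<integral>\<^sup>+x. f x \<partial>lborel)"
  by (subst lborel_distr_plus[of h, symmetric], subst nn_integral_distr) (auto simp: add.commute)

lemma integral_translate:
  fixes h :: "'a::euclidean_space" and f :: "'a \<Rightarrow> 'b::euclidean_space"
  assumes [measurable]: "f \<in> borel_measurable borel"
  shows "(LBINT x. f (x + h)) = (LBINT x. f x)"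
  by (subst (2) lborel_distr_plus[of h, symmetric], subst integral_distr) (auto simp: add.commute)

lemma integrable_translate:
  fixes h :: "'a::euclidean_space" and f :: "'a \<Rightarrow> 'b::euclidean_space"
  assumes [measurable]: "f \<in> borel_measurable borel" and "integrable lborel f"
  shows "integrable lborel (\<lambda>x. f (x + h))"
  using assms(2)
  by (subst (asm) lborel_distr_plus[of h, symmetric], subst (asm) integrable_distr_eq) (auto simp: add.commute)

lemma Lp_borel_translate: "Lp_borel p u \<Longrightarrow> Lp_borel p (\<lambda>x. u (x + h))"
  unfolding Lp_borel_def using integrable_translate[of "\<lambda>x. norm (u x) powr p" h] by auto

lemma AE_translate:
  fixes h :: "'a::euclidean_space"
  assumes "AE x in lborel. P x"
  shows "AE x in lborel. P (x + h)"
proof -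
  obtain N where N: "N \<in> sets borel" "emeasure lborel N = 0" "{x. \<not> P x} \<subseteq> N"
    using assms by (rule AE_E) (use that in auto)
  have [measurable]: "N \<in> sets borel" by fact
  have "(\<integral>\<^sup>+x. indicator N (x + h) \<partial>lborel) = (\<integral>\<^sup>+x. indicator N x \<partial>lborel)"
    by (rule nn_integral_translate) measurable
  also have "\<dots> = 0" using N by simp
  finally have "AE x in lborel. (indicator N (x + h) :: ennreal) = 0"
    by (subst (asm) nn_integral_0_iff_AE) auto
  then show ?thesis using N(3) by (auto simp: indicator_eq_0_iff elim!: eventually_mono)
qed

section \<open>Averages along segments\<close>

text \<open>A density, not a restriction: the measurable sets are then all Borel sets of the line.\<close>

definition unit_iv :: "real measure" where
  "unit_iv = density lborel (\<lambda>s. ennreal (indicator {0..1} s))"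

lemma sets_unit_iv [simp, measurable_cong]: "sets unit_iv = sets borel"
  by (simp add: unit_iv_def)

lemma space_unit_iv [simp]: "space unit_iv = UNIV"
  by (simp add: unit_iv_def)

lemma prob_space_unit_iv: "prob_space unit_iv"
  by (rule prob_spaceI) (simp add: unit_iv_def emeasure_density ennreal_indicator)

interpretation unit_iv: prob_space unit_iv
  by (rule prob_space_unit_iv)

lemma measure_unit_iv [simp]: "measure unit_iv UNIV = 1"
  using unit_iv.prob_space by simp

interpretation lborel_unit: pair_sigma_finite "lborel :: 'a::euclidean_space measure" unit_iv ..

lemma AE_unit_iv: "AE s in unit_iv. s \<in> {0..1}"
  unfolding unit_iv_def by (subst AE_density) (auto simp: indicator_def split: if_splits)

text \<open>The average of \<open>u\<close> over the segment from \<open>x\<close> to \<open>x + h\<close>. Where \<open>u\<close> is not integrable along the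
  segment the value is \<open>0\<close>; for \<open>u\<close> in \<open>L\<^sup>p\<close> this concerns a null set of \<open>x\<close>.\<close>

definition seg_avg :: "'a::euclidean_space \<Rightarrow> ('a \<Rightarrow> 'b::euclidean_space) \<Rightarrow> 'a \<Rightarrow> 'b" where
  "seg_avg h u x = (\<integral>s. u (x + s *\<^sub>R h) \<partial>unit_iv)"

lemma measurable_seg_avg [measurable]:
  assumes [measurable]: "u \<in> borel_measurable borel"
  shows "seg_avg h u \<in> borel_measurable borel"
  unfolding seg_avg_def[abs_def] by measurable

text \<open>Jensen's inequality by integrating the tangent at the norm of the mean. With the extended integral on the
  right it also holds for \<open>g\<close> that are not integrable, because the left side is then \<open>0\<close>.\<close>

lemma (in prob_space) norm_integral_powr_le:
  fixes g :: "'a \<Rightarrow> 'b::euclidean_space"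
  assumes [measurable]: "g \<in> borel_measurable M" and p: "p > 1"
  shows "ennreal (norm (\<integral>x. g x \<partial>M) powr p) \<le> (\<integral>\<^sup>+x. ennreal (norm (g x) powr p) \<partial>M)"
proof (cases "integrable M g \<and> integrable M (\<lambda>x. norm (g x) powr p)")
  case True
  define c where "c = norm (\<integral>x. g x \<partial>M)"
  have c0: "c \<ge> 0" by (simp add: c_def)
  have c: "c \<le> (\<integral>x. norm (g x) \<partial>M)"
    unfolding c_def by (rule integral_norm_bound)
  have "c powr p = p * (c * c powr (p - 1)) - (p - 1) * c powr p"
    unfolding powr_mult_pred[OF c0] by (simp add: algebra_simps)
  also have "\<dots> \<le> p * ((\<integral>x. norm (g x) \<partial>M) * c powr (p - 1)) - (p - 1) * c powr p"
    using c p by (intro diff_right_mono mult_left_mono mult_right_mono) auto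
  also have "\<dots> = (\<integral>x. p * (norm (g x) * c powr (p - 1)) - (p - 1) * c powr p \<partial>M)"
    using True by (simp add: prob_space)
  also have "\<dots> \<le> (\<integral>x. norm (g x) powr p \<partial>M)"
    using True p c0 by (intro integral_mono powr_tangent) auto
  finally have "ennreal (c powr p) \<le> ennreal (\<integral>x. norm (g x) powr p \<partial>M)" by (rule ennreal_leI)
  also have "\<dots> = (\<integral>\<^sup>+x. ennreal (norm (g x) powr p) \<partial>M)"
    using True by (intro nn_integral_eq_integral[symmetric]) auto
  finally show ?thesis by (simp add: c_def)
next
  case False
  then consider "\<not> integrable M g" | "\<not> integrable M (\<lambda>x. norm (g x) powr p)" by blast
  then show ?thesis
  proof cases
    case 1
    then show ?thesis using p by (simp add: not_integrable_integral_eq)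
  next
    case 2
    then have "(\<integral>\<^sup>+x. ennreal (norm (g x) powr p) \<partial>M) = \<infinity>"
      by (auto simp: integrable_iff_bounded less_top[symmetric])
    then show ?thesis by simp
  qed
qed

lemma seg_avg_powr_le:
  assumes [measurable]: "u \<in> borel_measurable borel" "L \<in> sets borel" and p: "p > 1"
    and "\<And>s. s \<in> {0..1} \<Longrightarrow> int_powr p L (\<lambda>x. u (x + s *\<^sub>R h)) \<le> B"
  shows "int_powr p L (\<lambda>x. seg_avg h u x) \<le> B"
proof -
  have "int_powr p L (\<lambda>x. seg_avg h u x)
      \<le> (\<integral>\<^sup>+x. \<integral>\<^sup>+s. ennreal (indicator L x * norm (u (x + s *\<^sub>R h)) powr p) \<partial>unit_iv \<partial>lborel)"
  proof (rule nn_integral_mono)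
    fix x
    show "ennreal (indicator L x * norm (seg_avg h u x) powr p)
      \<le> (\<integral>\<^sup>+s. ennreal (indicator L x * norm (u (x + s *\<^sub>R h)) powr p) \<partial>unit_iv)"
      using unit_iv.norm_integral_powr_le[of "\<lambda>s. u (x + s *\<^sub>R h)" p] p
      by (auto simp: seg_avg_def indicator_def)
  qed
  also have "\<dots> = (\<integral>\<^sup>+s. \<integral>\<^sup>+x. ennreal (indicator L x * norm (u (x + s *\<^sub>R h)) powr p) \<partial>lborel \<partial>unit_iv)"
    (is "_ = (\<integral>\<^sup>+s. ?I s \<partial>unit_iv)")
    by (rule lborel_unit.Fubini'[symmetric]) measurable
  also have "\<dots> \<le> (\<integral>\<^sup>+s. B \<partial>unit_iv)"
  proof (rule nn_integral_mono_AE)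
    show "AE s in unit_iv. ?I s \<le> B"
      using AE_unit_iv by eventually_elim (rule assms(4))
  qed
  also have "\<dots> = B" using unit_iv.emeasure_space_1 by simp
  finally show ?thesis .
qed

lemma Lp_borel_seg_avg:
  assumes "Lp_borel p u" "p > 1"
  shows "Lp_borel p (seg_avg h u)"
proof -
  have m[measurable]: "u \<in> borel_measurable borel" using assms by (rule_tac Lp_borelD)
  have "int_powr p UNIV (\<lambda>x. seg_avg h u x)
    \<le> (\<integral>\<^sup>+x. ennreal (norm (u x) powr p) \<partial>lborel)"
  proof (rule seg_avg_powr_le)
    fix s :: real
    show "int_powr p UNIV (\<lambda>x. u (x + s *\<^sub>R h))
      \<le> (\<integral>\<^sup>+x. ennreal (norm (u x) powr p) \<partial>lborel)"
      using nn_integral_translate[of "\<lambda>x. ennreal (norm (u x) powr p)" "s *\<^sub>R h"] by simp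
  qed (use assms in auto)
  then show ?thesis using assms by (auto simp: Lp_borel_iff intro: le_less_trans)
qed

lemma AE_segment_integrable:
  assumes "Lp_borel p u" "p \<ge> 1"
  shows "AE x in lborel. integrable unit_iv (\<lambda>s. u (x + s *\<^sub>R h))"
proof -
  have m[measurable]: "u \<in> borel_measurable borel" using assms by (rule_tac Lp_borelD)
  have "(\<integral>\<^sup>+x. \<integral>\<^sup>+s. ennreal (norm (u (x + s *\<^sub>R h)) powr p) \<partial>unit_iv \<partial>lborel)
      = (\<integral>\<^sup>+s. \<integral>\<^sup>+x. ennreal (norm (u (x + s *\<^sub>R h)) powr p) \<partial>lborel \<partial>unit_iv)"
    by (rule lborel_unit.Fubini'[symmetric]) measurable
  also have "\<dots> = (\<integral>\<^sup>+s. \<integral>\<^sup>+x. ennreal (norm (u x) powr p) \<partial>lborel \<partial>unit_iv)"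
    by (intro nn_integral_cong nn_integral_translate) measurable
  also have "\<dots> = (\<integral>\<^sup>+x. ennreal (norm (u x) powr p) \<partial>lborel)"
    using unit_iv.emeasure_space_1 by simp
  also have "\<dots> < \<infinity>" using assms by (simp add: Lp_borel_iff)
  finally have "AE x in lborel. (\<integral>\<^sup>+s. ennreal (norm (u (x + s *\<^sub>R h)) powr p) \<partial>unit_iv) \<noteq> \<infinity>"
    by (intro nn_integral_PInf_AE) auto
  then show ?thesis
  proof eventually_elim
    case (elim x)
    have "integrable unit_iv (\<lambda>s. norm (u (x + s *\<^sub>R h)) powr p)"
      using elim by (auto simp: integrable_iff_bounded less_top[symmetric])
    then have "integrable unit_iv (\<lambda>s. 1 + norm (u (x + s *\<^sub>R h)) powr p)" by simp
    then show ?case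
      by (rule Bochner_Integration.integrable_bound)
         (use assms in \<open>auto intro!: AE_I2 le_one_plus_powr intro: order_trans[OF le_one_plus_powr]\<close>)
  qed
qed

lemma seg_avg_minus_self_powr_le:
  assumes "Lp_borel p u" and L: "L \<in> sets borel" and p: "p > 1"
    and "\<And>s. s \<in> {0..1} \<Longrightarrow> int_powr p L (\<lambda>x. u (x + s *\<^sub>R h) - u x) \<le> B"
  shows "int_powr p L (\<lambda>x. seg_avg h u x - u x) \<le> B"
proof -
  have m[measurable]: "u \<in> borel_measurable borel" using assms by (rule_tac Lp_borelD)
  have [measurable]: "L \<in> sets borel" by fact
  have "int_powr p L (\<lambda>x. seg_avg h u x - u x)
      \<le> (\<integral>\<^sup>+x. \<integral>\<^sup>+s. ennreal (indicator L x * norm (u (x + s *\<^sub>R h) - u x) powr p) \<partial>unit_iv \<partial>lborel)"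
  proof (rule nn_integral_mono_AE)
    show "AE x in lborel. ennreal (indicator L x * norm (seg_avg h u x - u x) powr p)
      \<le> (\<integral>\<^sup>+s. ennreal (indicator L x * norm (u (x + s *\<^sub>R h) - u x) powr p) \<partial>unit_iv)"
      using AE_segment_integrable[OF assms(1) less_imp_le[OF p], of h]
    proof (eventually_elim)
      case (elim x)
      then have "seg_avg h u x - u x = (\<integral>s. u (x + s *\<^sub>R h) - u x \<partial>unit_iv)"
        by (simp add: seg_avg_def)
      then show ?case
        using unit_iv.norm_integral_powr_le[of "\<lambda>s. u (x + s *\<^sub>R h) - u x" p] p
        by (auto simp: indicator_def)
    qed
  qed
  also have "\<dots> = (\<integral>\<^sup>+s. \<integral>\<^sup>+x. ennreal (indicator L x * norm (u (x + s *\<^sub>R h) - u x) powr p) \<partial>lborel \<partial>unit_iv)"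
    (is "_ = (\<integral>\<^sup>+s. ?I s \<partial>unit_iv)")
    by (rule lborel_unit.Fubini'[symmetric]) measurable
  also have "\<dots> \<le> (\<integral>\<^sup>+s. B \<partial>unit_iv)"
  proof (rule nn_integral_mono_AE)
    show "AE s in unit_iv. ?I s \<le> B"
      using AE_unit_iv by eventually_elim (rule assms(4))
  qed
  also have "\<dots> = B" using unit_iv.emeasure_space_1 by simp
  finally show ?thesis .
qed

lemma integrable_pair_segment:
  fixes u v :: "'a::euclidean_space \<Rightarrow> 'b::euclidean_space"
  assumes "Lp_borel p u" "Lp_borel q v" "p > 1" "q > 1" "1 / p + 1 / q = 1"
  shows "integrable (lborel \<Otimes>\<^sub>M unit_iv) (\<lambda>(x, s). u (x + s *\<^sub>R h) \<bullet> v x)"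
proof (rule integrableI_bounded)
  have m[measurable]: "u \<in> borel_measurable borel" "v \<in> borel_measurable borel"
    using assms by (auto intro: Lp_borelD)
  show "(\<lambda>(x, s). u (x + s *\<^sub>R h) \<bullet> v x) \<in> borel_measurable (lborel \<Otimes>\<^sub>M unit_iv)" by measurable
  have "(\<integral>\<^sup>+z. ennreal (norm (case z of (x, s) \<Rightarrow> u (x + s *\<^sub>R h) \<bullet> v x)) \<partial>(lborel \<Otimes>\<^sub>M unit_iv))
     = (\<integral>\<^sup>+s. \<integral>\<^sup>+x. ennreal (norm (u (x + s *\<^sub>R h) \<bullet> v x)) \<partial>lborel \<partial>unit_iv)"
    by (subst lborel_unit.nn_integral_snd[symmetric]) auto
  also have "\<dots> \<le> (\<integral>\<^sup>+s. \<integral>\<^sup>+x. ennreal (norm (u (x + s *\<^sub>R h)) powr p / p) + ennreal (norm (v x) powr q / q) \<partial>lborel \<partial>unit_iv)"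
  proof (intro nn_integral_mono)
    fix s x
    have "norm (u (x + s *\<^sub>R h) \<bullet> v x) \<le> norm (u (x + s *\<^sub>R h)) * norm (v x)"
      by (rule Cauchy_Schwarz_ineq2[folded real_norm_def])
    also have "\<dots> \<le> norm (u (x + s *\<^sub>R h)) powr p / p + norm (v x) powr q / q"
      using assms by (intro Youngs_inequality) auto
    finally show "ennreal (norm (u (x + s *\<^sub>R h) \<bullet> v x))
      \<le> ennreal (norm (u (x + s *\<^sub>R h)) powr p / p) + ennreal (norm (v x) powr q / q)"
      using assms by (simp flip: ennreal_plus)
  qed
  also have "\<dots> = (\<integral>\<^sup>+s. (\<integral>\<^sup>+x. ennreal (norm (u x) powr p / p) \<partial>lborel) + (\<integral>\<^sup>+x. ennreal (norm (v x) powr q / q) \<partial>lborel) \<partial>unit_iv)"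
  proof (intro nn_integral_cong)
    fix s :: real
    show "(\<integral>\<^sup>+x. ennreal (norm (u (x + s *\<^sub>R h)) powr p / p) + ennreal (norm (v x) powr q / q) \<partial>lborel)
      = (\<integral>\<^sup>+x. ennreal (norm (u x) powr p / p) \<partial>lborel) + (\<integral>\<^sup>+x. ennreal (norm (v x) powr q / q) \<partial>lborel)"
      using nn_integral_translate[of "\<lambda>x. ennreal (norm (u x) powr p / p)" "s *\<^sub>R h"]
      by (subst nn_integral_add) auto
  qed
  also have "\<dots> = (\<integral>\<^sup>+x. ennreal (norm (u x) powr p / p) \<partial>lborel) + (\<integral>\<^sup>+x. ennreal (norm (v x) powr q / q) \<partial>lborel)"
    using unit_iv.emeasure_space_1 by simp
  also have "\<dots> < \<infinity>"
  proof -
    have "integrable lborel (\<lambda>x. norm (u x) powr p / p)" "integrable lborel (\<lambda>x. norm (v x) powr q / q)"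
      using assms by (auto simp: Lp_borel_def)
    then show ?thesis using assms by (auto simp: integrable_iff_bounded)
  qed
  finally show "(\<integral>\<^sup>+z. ennreal (norm (case z of (x, s) \<Rightarrow> u (x + s *\<^sub>R h) \<bullet> v x)) \<partial>(lborel \<Otimes>\<^sub>M unit_iv)) < \<infinity>" .
qed

text \<open>Fubini's theorem and a translation by \<open>s h\<close>; the segment is traversed backwards on the other side.\<close>

lemma seg_avg_adjoint:
  fixes u v :: "'a::euclidean_space \<Rightarrow> 'b::euclidean_space"
  assumes "Lp_borel p u" "Lp_borel q v" "p > 1" "q > 1" "1 / p + 1 / q = 1"
  shows "(LBINT x. seg_avg h u x \<bullet> v x) = (LBINT x. u x \<bullet> seg_avg (- h) v x)"
proof -
  have m[measurable]: "u \<in> borel_measurable borel" "v \<in> borel_measurable borel"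
    using assms by (auto intro: Lp_borelD)
  have "(LBINT x. seg_avg h u x \<bullet> v x) = (LBINT x. \<integral>s. u (x + s *\<^sub>R h) \<bullet> v x \<partial>unit_iv)"
  proof (rule integral_cong_AE)
    show "AE x in lborel. seg_avg h u x \<bullet> v x = (\<integral>s. u (x + s *\<^sub>R h) \<bullet> v x \<partial>unit_iv)"
      using AE_segment_integrable[OF assms(1), of h] assms(3)
      by (auto simp: seg_avg_def elim!: eventually_mono)
  qed measurable
  also have "\<dots> = (\<integral>s. (LBINT x. u (x + s *\<^sub>R h) \<bullet> v x) \<partial>unit_iv)"
    by (rule lborel_unit.Fubini_integral[symmetric], rule integrable_pair_segment[OF assms])
  also have "\<dots> = (\<integral>s. (LBINT x. u x \<bullet> v (x + s *\<^sub>R (- h))) \<partial>unit_iv)"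
  proof (rule Bochner_Integration.integral_cong[OF refl])
    fix s :: real
    show "(LBINT x. u (x + s *\<^sub>R h) \<bullet> v x) = (LBINT x. u x \<bullet> v (x + s *\<^sub>R (- h)))"
      using integral_translate[of "\<lambda>x. u x \<bullet> v (x + s *\<^sub>R (- h))" "s *\<^sub>R h"] by simp
  qed
  also have "\<dots> = (LBINT x. \<integral>s. u x \<bullet> v (x + s *\<^sub>R (- h)) \<partial>unit_iv)"
    using integrable_pair_segment[OF assms(2,1,4,3), of "- h"] assms(5)
    by (intro lborel_unit.Fubini_integral) (simp add: inner_commute add.commute)
  also have "\<dots> = (LBINT x. u x \<bullet> seg_avg (- h) v x)"
  proof (rule integral_cong_AE)
    show "AE x in lborel. (\<integral>s. u x \<bullet> v (x + s *\<^sub>R (- h)) \<partial>unit_iv) = u x \<bullet> seg_avg (- h) v x"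
      using AE_segment_integrable[OF assms(2), of "-h"] assms(4)
      by (auto simp: seg_avg_def elim!: eventually_mono)
  qed measurable
  finally show ?thesis .
qed

subsection \<open>Segment averages of smooth functions\<close>

lemma seg_avg_eq_integral:
  assumes "continuous_on UNIV u"
  shows "seg_avg h u x = integral {0..1} (\<lambda>s. u (x + s *\<^sub>R h))"
proof -
  have c: "continuous_on {0..1} (\<lambda>s. u (x + s *\<^sub>R h))"
    by (rule continuous_on_compose2[OF assms]) (auto intro!: continuous_intros)
  have "u \<in> borel_measurable borel" using assms by (rule borel_measurable_continuous_onI)
  then have "seg_avg h u x = set_lebesgue_integral lborel {0..1} (\<lambda>s. u (x + s *\<^sub>R h))"
    unfolding seg_avg_def unit_iv_def set_lebesgue_integral_def
    by (subst integral_density) auto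
  also have "\<dots> = integral {0..1} (\<lambda>s. u (x + s *\<^sub>R h))"
    using borel_integrable_compact[OF _ c] by (intro set_borel_integral_eq_integral) (auto simp: set_integrable_def)
  finally show ?thesis .
qed

lemma seg_avg_has_derivative:
  assumes "smooth \<psi>"
  shows "(seg_avg h \<psi> has_derivative (\<lambda>v. seg_avg h (partial_deriv v \<psi>) x)) (at x)"
proof -
  define D where "D x s = (\<Sum>i\<in>Basis. partial_deriv i \<psi> (x + s *\<^sub>R h) *\<^sub>R blinfun_inner_left i)" for x and s :: real
  have D: "blinfun_apply (D x s) v = partial_deriv v \<psi> (x + s *\<^sub>R h)" for x s v
    unfolding D_def partial_deriv_basis_sum[OF assms, of v]
    by (simp add: blinfun.sum_left blinfun.scaleR_left mult.commute inner_commute)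
  have cD: "continuous_on UNIV (\<lambda>(x, s). D x s)"
    unfolding D_def split_beta
    by (intro continuous_intros continuous_on_compose2[OF smooth_continuous[OF smooth_partial_deriv[OF assms], of UNIV]]) auto
  have "((\<lambda>x. integral (cbox 0 1) (\<lambda>s. \<psi> (x + s *\<^sub>R h))) has_derivative integral (cbox 0 1) (D x)) (at x within UNIV)"
  proof (rule leibniz_rule)
    fix y s
    have "((\<lambda>x. \<psi> (x + s *\<^sub>R h)) has_derivative (\<lambda>v. partial_deriv v \<psi> (y + s *\<^sub>R h))) (at y)"
      by (rule has_derivative_compose[OF _ smooth_has_derivative[OF assms], where f = "\<lambda>x. x + s *\<^sub>R h"])
         (auto intro!: derivative_eq_intros)
    then show "((\<lambda>x. \<psi> (x + s *\<^sub>R h)) has_derivative blinfun_apply (D y s)) (at y within UNIV)"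
      by (simp add: D[abs_def])
  next
    fix y
    show "(\<lambda>s. \<psi> (y + s *\<^sub>R h)) integrable_on cbox 0 1"
      by (intro integrable_continuous continuous_on_compose2[OF smooth_continuous[OF assms, of UNIV]] continuous_intros) auto
  next
    show "continuous_on (UNIV \<times> cbox 0 1) (\<lambda>(x, s). D x s)"
      using cD by (rule continuous_on_subset) auto
  qed auto
  moreover have "blinfun_apply (integral (cbox 0 1) (D x)) = (\<lambda>v. seg_avg h (partial_deriv v \<psi>) x)"
  proof
    fix v
    have "continuous_on (cbox 0 1) (D x)"
      using continuous_on_compose2[OF cD continuous_on_Pair[OF continuous_on_const[of _ x] continuous_on_id], where s = "cbox 0 1"]
      by simp
    then have "D x integrable_on cbox 0 1" by (rule integrable_continuous)
    then have "blinfun_apply (integral (cbox 0 1) (D x)) v = integral (cbox 0 1) (\<lambda>s. D x s v)"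
      by (rule blinfun_apply_integral)
    then show "blinfun_apply (integral (cbox 0 1) (D x)) v = seg_avg h (partial_deriv v \<psi>) x"
      using seg_avg_eq_integral[OF smooth_continuous[OF smooth_partial_deriv[OF assms]], of h v x] D by simp
  qed
  moreover have "seg_avg h \<psi> = (\<lambda>x. integral (cbox 0 1) (\<lambda>s. \<psi> (x + s *\<^sub>R h)))"
    using seg_avg_eq_integral[OF smooth_continuous[OF assms]] by auto
  ultimately show ?thesis by simp
qed

lemma partial_deriv_seg_avg:
  assumes "smooth \<psi>"
  shows "partial_deriv v (seg_avg h \<psi>) = seg_avg h (partial_deriv v \<psi>)"
  by (rule ext, rule partial_deriv_eqI, rule seg_avg_has_derivative, rule assms)

lemma smooth_seg_avg:
  assumes "smooth \<psi>"
  shows "smooth (seg_avg h \<psi>)"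
proof -
  have "Ck k (seg_avg h \<psi>)" for k
    using assms
  proof (induction k arbitrary: \<psi>)
    case 0
    then show ?case
      using seg_avg_has_derivative[OF 0]
      by (auto intro!: continuous_at_imp_continuous_on has_derivative_continuous)
  next
    case (Suc k)
    then show ?case
      using seg_avg_has_derivative[OF Suc.prems] smooth_partial_deriv[OF Suc.prems]
      by (auto simp: partial_deriv_seg_avg differentiable_def)
  qed
  then show ?thesis by (simp add: smooth_def)
qed

text \<open>Differences are derivatives of averages. This is the homotopy formula for functions, and it lets
  translations act on weak gradients.\<close>

lemma partial_deriv_seg_avg_self:
  assumes "smooth \<psi>"
  shows "partial_deriv h (seg_avg h \<psi>) x = \<psi> (x + h) - \<psi> x"
proof -
  have "((\<lambda>s. partial_deriv h \<psi> (x + s *\<^sub>R h)) has_integral \<psi> (x + 1 *\<^sub>R h) - \<psi> (x + 0 *\<^sub>R h)) {0..1}"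
    using smooth_along_line[OF assms]
    by (intro fundamental_theorem_of_calculus) (auto simp: has_real_derivative_iff_has_vector_derivative[symmetric])
  then show ?thesis
    unfolding partial_deriv_seg_avg[OF assms]
      seg_avg_eq_integral[OF smooth_continuous[OF smooth_partial_deriv[OF assms]]]
    by (simp add: integral_unique)
qed

lemma test_function_seg_avg:
  assumes "\<psi> \<in> test_functions V" "\<And>x s. x \<in> V \<Longrightarrow> s \<in> {0..1} \<Longrightarrow> x - s *\<^sub>R h \<in> U"
  shows "seg_avg h \<psi> \<in> test_functions U"
proof -
  obtain K where K: "compact K" "K \<subseteq> V" "\<And>x. x \<notin> K \<Longrightarrow> \<psi> x = 0"
    using test_functionE[OF assms(1)] by metis
  define C where "C = (\<lambda>(x, s::real). x - s *\<^sub>R h) ` (K \<times> {0..1})"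
  show ?thesis
  proof (rule test_functionI)
    show "smooth (seg_avg h \<psi>)" by (intro smooth_seg_avg test_function_smooth[OF assms(1)])
    show "compact C" unfolding C_def split_beta
      using K by (intro compact_continuous_image continuous_intros compact_Times) auto
    show "C \<subseteq> U" using K assms(2) by (auto simp: C_def)
    fix x assume x: "x \<notin> C"
    have "\<psi> (x + s *\<^sub>R h) = 0" if "s \<in> {0..1}" for s
    proof -
      have "x + s *\<^sub>R h \<notin> K" using x that unfolding C_def by force
      then show ?thesis using K by blast
    qed
    note vanish = this
    have "seg_avg h \<psi> x = (\<integral>s. 0 \<partial>unit_iv)"
      unfolding seg_avg_def
    proof (rule integral_cong_AE)
      have [measurable]: "\<psi> \<in> borel_measurable borel"
        using smooth_continuous[OF test_function_smooth[OF assms(1)]] by (rule borel_measurable_continuous_onI)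
      show "(\<lambda>s. \<psi> (x + s *\<^sub>R h)) \<in> borel_measurable unit_iv" by measurable
      show "AE s in unit_iv. \<psi> (x + s *\<^sub>R h) = 0"
        using AE_unit_iv by eventually_elim (rule vanish)
    qed simp
    then show "seg_avg h \<psi> x = 0" by simp
  qed
qed

lemma test_function_measurable [measurable_dest]: "\<psi> \<in> test_functions \<Omega> \<Longrightarrow> \<psi> \<in> borel_measurable borel"
  using smooth_continuous[OF test_function_smooth] by (intro borel_measurable_continuous_onI)

lemma Lp_borel_test_function:
  assumes "\<psi> \<in> test_functions \<Omega>" "p > 0"
  shows "Lp_borel p \<psi>"
proof -
  obtain K where K: "compact K" "K \<subseteq> \<Omega>" "\<And>x. x \<notin> K \<Longrightarrow> \<psi> x = 0"
    using test_functionE[OF assms(1)] by metis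
  obtain B where B: "B > 0" "\<And>x. \<bar>\<psi> x\<bar> \<le> B" using test_function_bounded[OF assms(1)] by metis
  show ?thesis
  proof (rule Lp_borel_bound[where g = "\<lambda>x. indicator K x * B powr p"])
    show "\<psi> \<in> borel_measurable borel" using assms by (rule_tac test_function_measurable)
    show "integrable lborel (\<lambda>x. indicator K x * B powr p)"
      using K by (intro integrable_mult_left) (auto intro!: integrable_real_indicator emeasure_bounded_finite
        borel_compact compact_imp_bounded)
    show "norm (\<psi> x) powr p \<le> indicator K x * B powr p" for x
      using K(3)[of x] B assms(2) by (cases "x \<in> K") (auto intro!: powr_mono2)
  qed
qed

section \<open>Borel representatives\<close>

lemma borel_measurable_lebesgue_on: "u \<in> borel_measurable borel \<Longrightarrow> u \<in> borel_measurable (lebesgue_on S)"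
  by (intro measurable_restrict_space1 measurable_completion) simp

text \<open>The representative vanishes off \<open>\<Omega>\<close>, so that integrals over \<open>\<Omega>\<close> become integrals over the whole
  space, where translations act.\<close>

definition represents :: "'a::euclidean_space set \<Rightarrow> ('a \<Rightarrow> 'b::euclidean_space) \<Rightarrow> ('a \<Rightarrow> 'b) \<Rightarrow> bool" where
  "represents \<Omega> u v \<longleftrightarrow> v \<in> borel_measurable borel \<and> (\<forall>x. x \<notin> \<Omega> \<longrightarrow> v x = 0)
     \<and> (AE x in lborel. x \<in> \<Omega> \<longrightarrow> u x = v x)"

lemma representative_exists:
  fixes u :: "'a::euclidean_space \<Rightarrow> 'b::euclidean_space"
  assumes \<Omega>: "\<Omega> \<in> sets borel" and u: "u \<in> borel_measurable (lebesgue_on \<Omega>)"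
  obtains v where "represents \<Omega> u v"
proof -
  have [measurable]: "\<Omega> \<in> sets borel" by fact
  have "\<exists>g\<in>borel_measurable lborel. AE x in lborel. indicator \<Omega> x * (u x \<bullet> i) = g x" for i
  proof (rule completion_ex_borel_measurable_real)
    have "(\<lambda>x. u x \<bullet> i) \<in> borel_measurable (lebesgue_on \<Omega>)" using u by measurable
    then show "(\<lambda>x. indicator \<Omega> x * (u x \<bullet> i)) \<in> borel_measurable lebesgue"
      using \<Omega> by (subst (asm) borel_measurable_restrict_space_iff) auto
  qed
  then obtain g where g [measurable]: "\<And>i. g i \<in> borel_measurable lborel"
    and eq: "\<And>i. AE x in lborel. indicator \<Omega> x * (u x \<bullet> i) = g i x"
    by metis
  show ?thesis
  proof (rule that[of "\<lambda>x. indicator \<Omega> x *\<^sub>R (\<Sum>i\<in>Basis. g i x *\<^sub>R i)"])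
    have "AE x in lborel. \<forall>i\<in>Basis. indicator \<Omega> x * (u x \<bullet> i) = g i x"
      using eq by (subst AE_finite_all) auto
    then have "AE x in lborel. x \<in> \<Omega> \<longrightarrow> u x = indicator \<Omega> x *\<^sub>R (\<Sum>i\<in>Basis. g i x *\<^sub>R i)"
    proof eventually_elim
      case (elim x)
      show ?case
      proof
        assume "x \<in> \<Omega>"
        then have "(\<Sum>i\<in>Basis. g i x *\<^sub>R i) = (\<Sum>i\<in>Basis. (u x \<bullet> i) *\<^sub>R i)"
          using elim by (intro sum.cong) auto
        then show "u x = indicator \<Omega> x *\<^sub>R (\<Sum>i\<in>Basis. g i x *\<^sub>R i)"
          using \<open>x \<in> \<Omega>\<close> by (simp add: euclidean_representation)
      qed
    qed
    then show "represents \<Omega> u (\<lambda>x. indicator \<Omega> x *\<^sub>R (\<Sum>i\<in>Basis. g i x *\<^sub>R i))"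
      by (auto simp: represents_def)
  qed
qed

lemma integral_lebesgue_on_eq:
  fixes F F' :: "'a::euclidean_space \<Rightarrow> 'b::euclidean_space"
  assumes \<Omega>: "\<Omega> \<in> sets borel" and F: "F \<in> borel_measurable (lebesgue_on \<Omega>)"
    and F': "F' \<in> borel_measurable borel"
    and eq: "AE x in lborel. x \<in> \<Omega> \<longrightarrow> F x = F' x"
  shows "(\<integral>x. F x \<partial>lebesgue_on \<Omega>) = (LBINT x. indicator \<Omega> x *\<^sub>R F' x)"
    and "integrable (lebesgue_on \<Omega>) F \<longleftrightarrow> integrable lborel (\<lambda>x. indicator \<Omega> x *\<^sub>R F' x)"
proof -
  have [measurable]: "\<Omega> \<in> sets borel" "F' \<in> borel_measurable borel" by fact+
  have \<Omega>': "\<Omega> \<inter> space lebesgue \<in> sets lebesgue" using \<Omega> by auto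
  have m1: "(\<lambda>x. indicator \<Omega> x *\<^sub>R F x) \<in> borel_measurable lebesgue"
    using F borel_measurable_restrict_space_iff[OF \<Omega>', of F] by simp
  have m2: "(\<lambda>x. indicator \<Omega> x *\<^sub>R F' x) \<in> borel_measurable lborel" by measurable
  then have m2': "(\<lambda>x. indicator \<Omega> x *\<^sub>R F' x) \<in> borel_measurable lebesgue"
    by (rule measurable_completion)
  have ae: "AE x in lebesgue. indicator \<Omega> x *\<^sub>R F x = indicator \<Omega> x *\<^sub>R F' x"
    using eq by (intro AE_completion) (auto elim!: eventually_mono simp: indicator_def)
  show "(\<integral>x. F x \<partial>lebesgue_on \<Omega>) = (LBINT x. indicator \<Omega> x *\<^sub>R F' x)"
    using integral_restrict_space[OF \<Omega>', of F] integral_cong_AE[OF m1 m2' ae] integral_completion[OF m2] by simp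
  show "integrable (lebesgue_on \<Omega>) F \<longleftrightarrow> integrable lborel (\<lambda>x. indicator \<Omega> x *\<^sub>R F' x)"
    using integrable_restrict_space[OF \<Omega>', of F] integrable_cong_AE[OF m1 m2' ae] integrable_completion[OF m2] by simp
qed

lemma Lp_on_represents:
  assumes "\<Omega> \<in> sets borel" "represents \<Omega> u v" "u \<in> borel_measurable (lebesgue_on \<Omega>)"
  shows "u \<in> Lp_on p \<Omega> \<longleftrightarrow> Lp_borel p v"
proof -
  have [measurable]: "v \<in> borel_measurable borel" "u \<in> borel_measurable (lebesgue_on \<Omega>)"
    using assms by (auto simp: represents_def)
  have "integrable (lebesgue_on \<Omega>) (\<lambda>x. norm (u x) powr p)
     \<longleftrightarrow> integrable lborel (\<lambda>x. indicator \<Omega> x *\<^sub>R (norm (v x) powr p))"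
    using assms by (intro integral_lebesgue_on_eq) (auto simp: represents_def elim!: eventually_mono)
  also have "(\<lambda>x. indicator \<Omega> x *\<^sub>R (norm (v x) powr p)) = (\<lambda>x. norm (v x) powr p)"
    using assms(2) by (auto simp: represents_def indicator_def fun_eq_iff)
  finally show ?thesis using assms by (simp add: Lp_on_def Lp_borel_def)
qed

lemma represents_self:
  assumes "u \<in> borel_measurable borel" "\<And>x. x \<notin> \<Omega> \<Longrightarrow> u x = 0"
  shows "represents \<Omega> u u"
  using assms by (auto simp: represents_def)

lemma represents_indicator:
  assumes "u \<in> borel_measurable borel" "\<Omega> \<in> sets borel"
  shows "represents \<Omega> u (\<lambda>x. indicator \<Omega> x *\<^sub>R u x)"
  using assms by (auto simp: represents_def)

lemma integral_represents_inner:
  fixes u v u' v' :: "'a::euclidean_space \<Rightarrow> 'b::euclidean_space"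
  assumes \<Omega>: "\<Omega> \<in> sets borel" and u: "represents \<Omega> u u'" "u \<in> borel_measurable (lebesgue_on \<Omega>)"
    and v: "v \<in> borel_measurable (lebesgue_on \<Omega>)" "v' \<in> borel_measurable borel" "AE x in lborel. x \<in> \<Omega> \<longrightarrow> v x = v' x"
  shows "(\<integral>x. u x \<bullet> v x \<partial>lebesgue_on \<Omega>) = (LBINT x. u' x \<bullet> v' x)"
proof -
  have [measurable]: "u \<in> borel_measurable (lebesgue_on \<Omega>)" "v \<in> borel_measurable (lebesgue_on \<Omega>)" "v' \<in> borel_measurable borel" "u' \<in> borel_measurable borel"
    using assms by (auto simp: represents_def)
  have "AE x in lborel. x \<in> \<Omega> \<longrightarrow> u x = u' x" using u by (auto simp: represents_def)
  then have "AE x in lborel. x \<in> \<Omega> \<longrightarrow> u x \<bullet> v x = u' x \<bullet> v' x" using v(3)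
    by eventually_elim auto
  then have "(\<integral>x. u x \<bullet> v x \<partial>lebesgue_on \<Omega>) = (LBINT x. indicator \<Omega> x *\<^sub>R (u' x \<bullet> v' x))"
    using \<Omega> by (intro integral_lebesgue_on_eq) auto
  also have "(\<lambda>x. indicator \<Omega> x *\<^sub>R (u' x \<bullet> v' x)) = (\<lambda>x. u' x \<bullet> v' x)"
    using u(1) by (auto simp: represents_def indicator_def fun_eq_iff)
  finally show ?thesis .
qed

lemma Lp_on_mono_exponent:
  fixes u :: "'a::euclidean_space \<Rightarrow> 'b::euclidean_space"
  assumes "u \<in> Lp_on p S" "S \<in> sets lebesgue" "bounded S" "0 < r" "r \<le> p"
  shows "u \<in> Lp_on r S"
proof -
  interpret finite_measure "lebesgue_on S"
    by (intro finite_measure_lebesgue_on bounded_set_imp_lmeasurable assms)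
  have [measurable]: "u \<in> borel_measurable (lebesgue_on S)" using assms by (simp add: Lp_on_def)
  have "integrable (lebesgue_on S) (\<lambda>x. 1 + norm (u x) powr p)"
    using assms by (auto simp: Lp_on_def)
  then have "integrable (lebesgue_on S) (\<lambda>x. norm (u x) powr r)"
  proof (rule Bochner_Integration.integrable_bound)
    show "AE x in lebesgue_on S. norm (norm (u x) powr r) \<le> norm (1 + norm (u x) powr p)"
    proof (rule AE_I2)
      fix x
      have "norm (u x) powr r \<le> 1 + (norm (u x) powr r) powr (p / r)"
        using assms by (intro le_one_plus_powr) auto
      then show "norm (norm (u x) powr r) \<le> norm (1 + norm (u x) powr p)"
        using assms by (simp add: powr_powr)
    qed
  qed measurable
  then show ?thesis using assms by (simp add: Lp_on_def)
qed

lemma Lp_on_subset: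
  assumes "u \<in> Lp_on p S" "S \<in> sets lebesgue" "T \<in> sets lebesgue" "T \<subseteq> S"
  shows "u \<in> Lp_on p T"
proof -
  have "u \<in> borel_measurable (lebesgue_on T)"
    using assms(1) by (intro measurable_restrict_mono[OF _ assms(4)]) (simp add: Lp_on_def)
  moreover have "set_integrable lebesgue S (\<lambda>x. norm (u x) powr p)"
    using assms(1,2) integrable_restrict_space[of S lebesgue "\<lambda>x. norm (u x) powr p"]
    by (simp add: Lp_on_def set_integrable_def)
  then have "set_integrable lebesgue T (\<lambda>x. norm (u x) powr p)"
    by (rule set_integrable_subset[OF _ assms(3,4)])
  then have "integrable (lebesgue_on T) (\<lambda>x. norm (u x) powr p)"
    using assms(3) integrable_restrict_space[of T lebesgue "\<lambda>x. norm (u x) powr p"]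
    by (simp add: set_integrable_def)
  ultimately show ?thesis by (simp add: Lp_on_def)
qed

lemma Lp_on_imp_Lp_loc:
  assumes "u \<in> Lp_on p \<Omega>" "\<Omega> \<in> sets borel" "0 < r" "r \<le> p"
  shows "u \<in> Lp_loc r \<Omega>"
  using assms by (auto simp: Lp_loc_def compact_imp_bounded lmeasurable_compact[THEN fmeasurableD]
      intro!: Lp_on_mono_exponent[of u p _ r] Lp_on_subset[of u p \<Omega>])

section \<open>Weak gradients and the Neumann condition for Borel functions\<close>

text \<open>The test functions live in \<open>\<Omega>\<close>, so nothing is said about the behaviour of \<open>w\<close> across the boundary.\<close>

definition borel_weak_grad ::
    "real \<Rightarrow> 'a::euclidean_space set \<Rightarrow> ('a \<Rightarrow> real) \<Rightarrow> ('a \<Rightarrow> 'a) \<Rightarrow> bool" where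
  "borel_weak_grad q \<Omega> w G \<longleftrightarrow> Lp_borel q w \<and> Lp_borel q G \<and>
     (\<forall>\<psi>\<in>test_functions \<Omega>. \<forall>v.
        (LBINT x. w x * partial_deriv v \<psi> x) = - (LBINT x. (G x \<bullet> v) * \<psi> x))"

text \<open>For \<open>\<sigma>\<close> and \<open>f\<close> that vanish off \<open>\<Omega>\<close> the equation involves \<open>w\<close> and \<open>G\<close> on \<open>\<Omega>\<close> only.
  Because \<open>w\<close> is unconstrained at the boundary, the extension of \<open>\<sigma>\<close> by zero has divergence \<open>-f\<close> on the
  whole space, so \<open>\<sigma>\<close> may be translated by arbitrary \<open>h\<close>.\<close>

definition borel_neumann ::
    "real \<Rightarrow> 'a::euclidean_space set \<Rightarrow> ('a \<Rightarrow> real) \<Rightarrow> ('a \<Rightarrow> 'a) \<Rightarrow> bool" where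
  "borel_neumann q \<Omega> f \<sigma> \<longleftrightarrow>
     (\<forall>w G. borel_weak_grad q \<Omega> w G \<longrightarrow> (LBINT x. \<sigma> x \<bullet> G x) = (LBINT x. f x * w x))"

lemma integrable_mult_test_function:
  fixes u :: "'a::euclidean_space \<Rightarrow> real"
  assumes "Lp_borel q u" "q > 1" "\<psi> \<in> test_functions \<Omega>"
  shows "integrable lborel (\<lambda>x. u x * \<psi> x)"
proof -
  define p where "p = q / (q - 1)"
  have p: "p > 1" "1 / q + 1 / p = 1" using assms by (auto simp: p_def field_simps)
  have "Lp_borel p \<psi>" using p by (intro Lp_borel_test_function[OF assms(3)]) auto
  then show ?thesis using Lp_borel_integrable_inner[OF assms(1), of p \<psi>] assms p by simp
qed

lemma borel_weak_gradI:
  assumes w: "Lp_borel q w" and G: "Lp_borel q G" and q: "q > 1"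
    and basis: "\<And>\<psi> i. \<psi> \<in> test_functions \<Omega> \<Longrightarrow> i \<in> Basis \<Longrightarrow>
        (LBINT x. w x * partial_deriv i \<psi> x) = - (LBINT x. (G x \<bullet> i) * \<psi> x)"
  shows "borel_weak_grad q \<Omega> w G"
  unfolding borel_weak_grad_def
proof (intro conjI ballI allI w G)
  fix \<psi> and v :: 'a assume \<psi>: "\<psi> \<in> test_functions \<Omega>"
  have i1: "integrable lborel (\<lambda>x. w x * partial_deriv i \<psi> x)" for i
    by (rule integrable_mult_test_function[OF w q test_function_partial_deriv[OF \<psi>]])
  have i2: "integrable lborel (\<lambda>x. (G x \<bullet> i) * \<psi> x)" for i
    using q by (intro integrable_mult_test_function[OF _ q \<psi>] Lp_borel_inner_right G) auto
  have "(LBINT x. w x * partial_deriv v \<psi> x)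
      = (LBINT x. (\<Sum>i\<in>Basis. (v \<bullet> i) * (w x * partial_deriv i \<psi> x)))"
    unfolding partial_deriv_basis_sum[OF test_function_smooth[OF \<psi>], of v]
    by (simp add: sum_distrib_left algebra_simps)
  also have "\<dots> = (\<Sum>i\<in>Basis. (v \<bullet> i) * (LBINT x. w x * partial_deriv i \<psi> x))"
    using i1 by simp
  also have "\<dots> = - (\<Sum>i\<in>Basis. (v \<bullet> i) * (LBINT x. (G x \<bullet> i) * \<psi> x))"
    using basis[OF \<psi>] by (simp add: sum_negf)
  also have "(\<Sum>i\<in>Basis. (v \<bullet> i) * (LBINT x. (G x \<bullet> i) * \<psi> x))
      = (LBINT x. (\<Sum>i\<in>Basis. (v \<bullet> i) * ((G x \<bullet> i) * \<psi> x)))"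
    using i2 by simp
  also have "\<dots> = (LBINT x. (G x \<bullet> v) * \<psi> x)"
    by (simp add: euclidean_inner[of "G _" v] sum_distrib_left mult.commute mult.left_commute)
  finally show "(LBINT x. w x * partial_deriv v \<psi> x) = - (LBINT x. (G x \<bullet> v) * \<psi> x)" .
qed

lemma borel_weak_grad_represents:
  assumes \<Omega>: "\<Omega> \<in> sets borel" and q: "q > 1"
    and w: "represents \<Omega> w w'" "w \<in> Lp_on q \<Omega>" and G: "represents \<Omega> G G'" "G \<in> Lp_on q \<Omega>"
    and wg: "weak_gradient \<Omega> w G"
  shows "borel_weak_grad q \<Omega> w' G'"
proof (rule borel_weak_gradI[OF _ _ q])
  have m: "w \<in> borel_measurable (lebesgue_on \<Omega>)" "G \<in> borel_measurable (lebesgue_on \<Omega>)"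
    using w G by (auto simp: Lp_on_def)
  have m' [measurable]: "w' \<in> borel_measurable borel" "G' \<in> borel_measurable borel"
    using w G by (auto simp: represents_def)
  show "Lp_borel q w'" "Lp_borel q G'"
    using Lp_on_represents[OF \<Omega> w(1) m(1), of q] Lp_on_represents[OF \<Omega> G(1) m(2), of q] w G by auto
  fix \<psi> and i :: 'a assume \<psi>: "\<psi> \<in> test_functions \<Omega>" "i \<in> Basis"
  have [measurable]: "\<psi> \<in> borel_measurable borel" "partial_deriv i \<psi> \<in> borel_measurable borel"
    using \<psi> test_function_partial_deriv[OF \<psi>(1)] by (auto intro: test_function_measurable)
  have "(LBINT x. w' x * partial_deriv i \<psi> x) = (\<integral>x. w x * partial_deriv i \<psi> x \<partial>lebesgue_on \<Omega>)"
    using integral_represents_inner[OF \<Omega> w(1) m(1) borel_measurable_lebesgue_on, of "partial_deriv i \<psi>" "partial_deriv i \<psi>"]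
    by simp
  also have "\<dots> = - (\<integral>x. (G x \<bullet> i) * \<psi> x \<partial>lebesgue_on \<Omega>)"
    using wg \<psi> by (simp add: weak_gradient_def)
  also have "(\<integral>x. (G x \<bullet> i) * \<psi> x \<partial>lebesgue_on \<Omega>) = (\<integral>x. G x \<bullet> (\<psi> x *\<^sub>R i) \<partial>lebesgue_on \<Omega>)"
    by (simp add: mult.commute)
  also have "\<dots> = (LBINT x. G' x \<bullet> (\<psi> x *\<^sub>R i))"
    by (rule integral_represents_inner[OF \<Omega> G(1) m(2) borel_measurable_lebesgue_on]) auto
  finally show "(LBINT x. w' x * partial_deriv i \<psi> x) = - (LBINT x. (G' x \<bullet> i) * \<psi> x)"
    by (simp add: mult.commute)
qed

lemma weak_gradient_of_borel:
  assumes \<Omega>: "\<Omega> \<in> sets borel" and q: "q > 1" and wg: "borel_weak_grad q \<Omega> w G"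
  shows "w \<in> W1p q \<Omega>" "G \<in> Lp_on q \<Omega>" "weak_gradient \<Omega> w G"
proof -
  have L: "Lp_borel q w" "Lp_borel q G" using wg by (auto simp: borel_weak_grad_def)
  have m [measurable]: "w \<in> borel_measurable borel" "G \<in> borel_measurable borel"
    using L by (auto intro: Lp_borelD)
  have on: "u \<in> Lp_on q \<Omega>" if "Lp_borel q u" for u :: "'a \<Rightarrow> 'b::euclidean_space"
  proof -
    have [measurable]: "u \<in> borel_measurable borel" "\<Omega> \<in> sets borel" using that \<Omega> by (auto intro: Lp_borelD)
    have "Lp_borel q (\<lambda>x. indicator \<Omega> x *\<^sub>R u x)"
      using that q by (intro Lp_borel_scale[where B = 1]) (auto simp: indicator_def)
    then show ?thesis
      using Lp_on_represents[OF \<Omega> represents_indicator[OF _ \<Omega>] borel_measurable_lebesgue_on, of u q] by auto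
  qed
  have "(\<integral>x. w x * partial_deriv i \<psi> x \<partial>lebesgue_on \<Omega>) = - (\<integral>x. (G x \<bullet> i) * \<psi> x \<partial>lebesgue_on \<Omega>)"
    if \<psi>: "\<psi> \<in> test_functions \<Omega>" for \<psi> i
  proof -
    have [measurable]: "\<psi> \<in> borel_measurable borel" "partial_deriv i \<psi> \<in> borel_measurable borel"
      using \<psi> test_function_partial_deriv[OF \<psi>(1)] by (auto intro: test_function_measurable)
    have van: "x \<notin> \<Omega> \<Longrightarrow> \<phi> x = 0" if "\<phi> \<in> test_functions \<Omega>" for \<phi> x
      using test_functionE[OF that] by (metis subsetD)
    have "(\<integral>x. partial_deriv i \<psi> x \<bullet> w x \<partial>lebesgue_on \<Omega>) = (LBINT x. partial_deriv i \<psi> x \<bullet> w x)"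
      using van[OF test_function_partial_deriv[OF \<psi>]]
      by (intro integral_represents_inner[OF \<Omega> represents_self borel_measurable_lebesgue_on borel_measurable_lebesgue_on]) auto
    moreover have "(\<integral>x. \<psi> x \<bullet> (G x \<bullet> i) \<partial>lebesgue_on \<Omega>) = (LBINT x. \<psi> x \<bullet> (G x \<bullet> i))"
      using van[OF \<psi>]
      by (intro integral_represents_inner[OF \<Omega> represents_self borel_measurable_lebesgue_on borel_measurable_lebesgue_on]) auto
    ultimately show ?thesis using wg \<psi> by (simp add: borel_weak_grad_def mult.commute)
  qed
  then show "weak_gradient \<Omega> w G"
    unfolding weak_gradient_def using q \<Omega> L
    by (auto intro: Lp_on_imp_Lp_loc[of _ q] on)
  then show "w \<in> W1p q \<Omega>" "G \<in> Lp_on q \<Omega>" using L on[of w] on[of G] by (auto simp: W1p_def intro: bexI[of _ G])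
qed

lemma admissible_imp_borel_neumann:
  assumes \<Omega>: "\<Omega> \<in> sets borel" and q: "q > 1"
    and \<sigma>: "represents \<Omega> \<sigma> \<sigma>'" and f: "represents \<Omega> f f'" "f \<in> borel_measurable (lebesgue_on \<Omega>)"
    and adm: "admissible p q \<Omega> f \<sigma>"
  shows "borel_neumann q \<Omega> f' \<sigma>'"
  unfolding borel_neumann_def
proof (intro allI impI)
  fix w G assume wg: "borel_weak_grad q \<Omega> w G"
  have m [measurable]: "w \<in> borel_measurable borel" "G \<in> borel_measurable borel"
    using wg by (auto simp: borel_weak_grad_def intro: Lp_borelD)
  have ms: "\<sigma> \<in> borel_measurable (lebesgue_on \<Omega>)" using adm by (simp add: admissible_def Lp_on_def)
  have "(\<integral>x. \<sigma> x \<bullet> G x \<partial>lebesgue_on \<Omega>) = (\<integral>x. f x * w x \<partial>lebesgue_on \<Omega>)"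
    using adm weak_gradient_of_borel[OF \<Omega> q wg] by (simp add: admissible_def)
  moreover have "(\<integral>x. \<sigma> x \<bullet> G x \<partial>lebesgue_on \<Omega>) = (LBINT x. \<sigma>' x \<bullet> G x)"
    by (rule integral_represents_inner[OF \<Omega> \<sigma> ms borel_measurable_lebesgue_on]) auto
  moreover have "(\<integral>x. f x \<bullet> w x \<partial>lebesgue_on \<Omega>) = (LBINT x. f' x \<bullet> w x)"
    by (rule integral_represents_inner[OF \<Omega> f borel_measurable_lebesgue_on]) auto
  ultimately show "(LBINT x. \<sigma>' x \<bullet> G x) = (LBINT x. f' x * w x)" by simp
qed

lemma borel_neumann_imp_admissible:
  assumes \<Omega>: "\<Omega> \<in> sets borel" and q: "q > 1"
    and \<sigma>: "Lp_borel p \<sigma>" "\<And>x. x \<notin> \<Omega> \<Longrightarrow> \<sigma> x = 0"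
    and f: "represents \<Omega> f f'" "f \<in> borel_measurable (lebesgue_on \<Omega>)"
    and neu: "borel_neumann q \<Omega> f' \<sigma>"
  shows "admissible p q \<Omega> f \<sigma>"
  unfolding admissible_def
proof (intro conjI ballI impI)
  have m [measurable]: "\<sigma> \<in> borel_measurable borel" using \<sigma> by (auto intro: Lp_borelD)
  have rep: "represents \<Omega> \<sigma> \<sigma>" using \<sigma> by (intro represents_self) auto
  show "\<sigma> \<in> Lp_on p \<Omega>"
    using Lp_on_represents[OF \<Omega> rep borel_measurable_lebesgue_on[OF m]] \<sigma> by simp
  fix w G assume w: "w \<in> W1p q \<Omega>" and G: "G \<in> Lp_on q \<Omega>" and wg: "weak_gradient \<Omega> w G"
  have mw: "w \<in> borel_measurable (lebesgue_on \<Omega>)" and w': "w \<in> Lp_on q \<Omega>" using w by (auto simp: W1p_def Lp_on_def)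
  have mG: "G \<in> borel_measurable (lebesgue_on \<Omega>)" using G by (auto simp: Lp_on_def)
  obtain w' G' where rw: "represents \<Omega> w w'" and rG: "represents \<Omega> G G'"
    using representative_exists[OF \<Omega> mw] representative_exists[OF \<Omega> mG] by metis
  have "(LBINT x. \<sigma> x \<bullet> G' x) = (LBINT x. f' x * w' x)"
    using neu borel_weak_grad_represents[OF \<Omega> q rw w' rG G wg] by (simp add: borel_neumann_def)
  moreover have "(\<integral>x. \<sigma> x \<bullet> G x \<partial>lebesgue_on \<Omega>) = (LBINT x. \<sigma> x \<bullet> G' x)"
    using rG by (intro integral_represents_inner[OF \<Omega> rep borel_measurable_lebesgue_on[OF m] mG]) (auto simp: represents_def)
  moreover have "(\<integral>x. f x \<bullet> w x \<partial>lebesgue_on \<Omega>) = (LBINT x. f' x \<bullet> w' x)"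
    using rw by (intro integral_represents_inner[OF \<Omega> f mw]) (auto simp: represents_def)
  ultimately show "(\<integral>x. \<sigma> x \<bullet> G x \<partial>lebesgue_on \<Omega>) = (\<integral>x. f x * w x \<partial>lebesgue_on \<Omega>)" by simp
qed

section \<open>Localized translations that preserve the Neumann condition\<close>

definition grad :: "('a::euclidean_space \<Rightarrow> real) \<Rightarrow> 'a \<Rightarrow> 'a" where
  "grad \<eta> x = (\<Sum>i\<in>Basis. partial_deriv i \<eta> x *\<^sub>R i)"

lemma grad_inner: "smooth \<eta> \<Longrightarrow> grad \<eta> x \<bullet> v = partial_deriv v \<eta> x"
  unfolding grad_def inner_sum_left partial_deriv_basis_sum[of \<eta> v]
  by (intro sum.cong refl) (simp add: inner_commute)

lemma test_function_grad_bounded: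
  assumes "\<eta> \<in> test_functions \<Omega>"
  obtains B where "B > 0" "\<And>x. norm (grad \<eta> x) \<le> B"
proof -
  have "\<exists>B>0. \<forall>x. \<bar>partial_deriv i \<eta> x\<bar> \<le> B" for i
    using test_function_bounded[OF test_function_partial_deriv[OF assms]] by metis
  then obtain B where B: "\<And>i. B i > 0" "\<And>i x. \<bar>partial_deriv i \<eta> x\<bar> \<le> B i" by metis
  show ?thesis
  proof (rule that[of "\<Sum>i\<in>Basis. B i"])
    show "(\<Sum>i\<in>Basis. B i) > 0" using B by (intro sum_pos) auto
    show "norm (grad \<eta> x) \<le> (\<Sum>i\<in>Basis. B i)" for x
      unfolding grad_def using B by (intro sum_norm_le) auto
  qed
qed

lemma grad_measurable:
  assumes "\<eta> \<in> test_functions \<Omega>"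
  shows "grad \<eta> \<in> borel_measurable borel"
proof -
  have [measurable]: "partial_deriv i \<eta> \<in> borel_measurable borel" for i
    using test_function_partial_deriv[OF assms] by (rule test_function_measurable)
  show ?thesis unfolding grad_def[abs_def] by measurable
qed

lemma Lp_borel_test_scale:
  fixes u :: "'a::euclidean_space \<Rightarrow> 'b::euclidean_space"
  assumes "\<eta> \<in> test_functions \<Omega>" "Lp_borel p u" "p > 0"
  shows "Lp_borel p (\<lambda>x. \<eta> x *\<^sub>R u x)"
proof -
  obtain B where "\<And>x. \<bar>\<eta> x\<bar> \<le> B" using test_function_bounded[OF assms(1)] by metis
  then show ?thesis using assms by (intro Lp_borel_scale[where B = B] test_function_measurable)
qed

lemma Lp_borel_mult_grad:
  fixes u :: "'a::euclidean_space \<Rightarrow> real"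
  assumes "\<eta> \<in> test_functions \<Omega>" "Lp_borel p u" "p > 0"
  shows "Lp_borel p (\<lambda>x. u x *\<^sub>R grad \<eta> x)"
proof -
  obtain B where B: "\<And>x. norm (grad \<eta> x) \<le> B" using test_function_grad_bounded[OF assms(1)] by metis
  have [measurable]: "u \<in> borel_measurable borel" "grad \<eta> \<in> borel_measurable borel"
    using assms grad_measurable by (auto intro: Lp_borelD)
  show ?thesis
  proof (rule Lp_borel_bound[where g = "\<lambda>x. B powr p * norm (u x) powr p"])
    show "norm (u x *\<^sub>R grad \<eta> x) powr p \<le> B powr p * norm (u x) powr p" for x
      using B[of x] assms(3) norm_ge_zero[of "grad \<eta> x"]
      by (auto simp: powr_mult[symmetric] mult.commute[of B] simp del: norm_ge_zero intro!: powr_mono2 mult_left_mono)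
  qed (use assms in \<open>auto simp: Lp_borel_def\<close>)
qed

lemma seg_avg_test_scaleR:
  assumes "\<psi> \<in> test_functions \<Omega>"
  shows "seg_avg h (\<lambda>x. \<psi> x *\<^sub>R v) x = seg_avg h \<psi> x *\<^sub>R v"
proof -
  obtain B where B: "\<And>x. \<bar>\<psi> x\<bar> \<le> B" using test_function_bounded[OF assms] by metis
  have [measurable]: "\<psi> \<in> borel_measurable borel" using assms by (rule test_function_measurable)
  have "integrable unit_iv (\<lambda>s. \<psi> (x + s *\<^sub>R h))"
    using B by (intro unit_iv.integrable_const_bound[of _ B]) auto
  then show ?thesis by (simp add: seg_avg_def)
qed

text \<open>A gradient field, localized by \<open>\<eta>\<close> and translated, is again a gradient up to a correction that
  has size \<open>h\<close> and involves no derivative of \<open>G\<close>. Against a test function the claim becomes equality of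
  the two mixed second derivatives of \<open>\<eta> \<Psi>\<close>, where \<open>\<Psi>\<close> is the segment average of the test function:
  the derivative of \<open>\<Psi>\<close> along \<open>h\<close> is the difference of the test function.\<close>

lemma borel_weak_grad_localized_translation:
  fixes w :: "'a::euclidean_space \<Rightarrow> real" and G :: "'a \<Rightarrow> 'a" and h :: 'a
  assumes wg: "borel_weak_grad q \<Omega> w G" and q: "q > 1" and \<eta>: "\<eta> \<in> test_functions \<Omega>"
  defines "Y \<equiv> \<lambda>x. \<eta> x *\<^sub>R G x"
    and "X \<equiv> \<lambda>x. partial_deriv h \<eta> x *\<^sub>R G x - (G x \<bullet> h) *\<^sub>R grad \<eta> x"
  shows "borel_weak_grad q \<Omega> (\<lambda>x. - seg_avg (- h) (\<lambda>x. Y x \<bullet> h) x)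
           (\<lambda>x. Y (x - h) - Y x + seg_avg (- h) X x)"
    and "Lp_borel q Y" and "Lp_borel q X"
proof -
  define p where "p = q / (q - 1)"
  have p: "p > 1" "1 / q + 1 / p = 1" using q by (auto simp: p_def field_simps)
  have q0: "q > 0" using q by simp
  have w: "Lp_borel q w" and G: "Lp_borel q G" using wg by (auto simp: borel_weak_grad_def)
  have sm: "smooth \<eta>" using \<eta> by (rule test_function_smooth)
  show Y: "Lp_borel q Y" unfolding Y_def by (rule Lp_borel_test_scale[OF \<eta> G q0])
  show X: "Lp_borel q X" unfolding X_def
    by (intro Lp_borel_diff Lp_borel_test_scale[OF test_function_partial_deriv[OF \<eta>]] Lp_borel_mult_grad[OF \<eta>]
        Lp_borel_inner_right G q0)
  have y: "Lp_borel q (\<lambda>x. Y x \<bullet> h)" by (intro Lp_borel_inner_right Y q0)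
  have mY [measurable]: "Y \<in> borel_measurable borel" using Y by (rule Lp_borelD)
  show "borel_weak_grad q \<Omega> (\<lambda>x. - seg_avg (- h) (\<lambda>x. Y x \<bullet> h) x) (\<lambda>x. Y (x - h) - Y x + seg_avg (- h) X x)"
    unfolding borel_weak_grad_def
  proof (intro conjI ballI allI)
    show "Lp_borel q (\<lambda>x. - seg_avg (- h) (\<lambda>x. Y x \<bullet> h) x)"
      by (intro Lp_borel_minus Lp_borel_seg_avg y q)
    have Yt: "Lp_borel q (\<lambda>x. Y (x - h))" using Lp_borel_translate[OF Y, of "- h"] by simp
    show "Lp_borel q (\<lambda>x. Y (x - h) - Y x + seg_avg (- h) X x)"
      by (intro Lp_borel_add Lp_borel_diff Lp_borel_seg_avg Yt Y X q q0)
    fix \<psi> and v :: 'a assume \<psi>: "\<psi> \<in> test_functions \<Omega>"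
    have [measurable]: "\<psi> \<in> borel_measurable borel" using \<psi> by (rule test_function_measurable)
    have sp: "smooth \<psi>" using \<psi> by (rule test_function_smooth)
    define \<Psi> where "\<Psi> = seg_avg h \<psi>"
    define \<theta> where "\<theta> = (\<lambda>x. \<eta> x * \<Psi> x)"
    have s\<Psi>: "smooth \<Psi>" unfolding \<Psi>_def by (rule smooth_seg_avg[OF sp])
    have \<theta>: "\<theta> \<in> test_functions \<Omega>" unfolding \<theta>_def by (rule test_function_mult[OF \<eta> s\<Psi>])
    have D\<theta>: "partial_deriv u \<theta> x = \<eta> x * partial_deriv u \<Psi> x + partial_deriv u \<eta> x * \<Psi> x" for u x
      unfolding \<theta>_def by (intro partial_deriv_mult smooth_differentiable sm s\<Psi>)
    have \<Psi>: "\<Psi> \<in> test_functions UNIV" unfolding \<Psi>_def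
      by (rule test_function_seg_avg[of _ UNIV]) (use \<psi> in \<open>auto simp: test_functions_def\<close>)
    have \<psi>t: "(\<lambda>x. \<psi> (x + h)) \<in> test_functions UNIV"
    proof -
      have "(\<lambda>x. \<psi> (x + h)) = (\<lambda>x. partial_deriv h \<Psi> x + \<psi> x)"
        unfolding \<Psi>_def using partial_deriv_seg_avg_self[OF sp, of h] by auto
      moreover obtain K where "compact K" "\<And>x. x \<notin> K \<Longrightarrow> partial_deriv h \<Psi> x = 0"
        using test_functionE[OF test_function_partial_deriv[OF \<Psi>]] by metis
      moreover obtain L where "compact L" "\<And>x. x \<notin> L \<Longrightarrow> \<psi> x = 0"
        using test_functionE[OF \<psi>] by metis
      ultimately show ?thesis
        using smooth_add[OF smooth_partial_deriv[OF s\<Psi>, of h] sp]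
        by (intro test_functionI[of _ "K \<union> L"]) (auto simp: fun_eq_iff)
    qed
    have "(LBINT x. seg_avg (- h) (\<lambda>x. Y x \<bullet> h) x * partial_deriv v \<psi> x)
        = (LBINT x. (Y x \<bullet> h) * seg_avg h (partial_deriv v \<psi>) x)"
      using seg_avg_adjoint[OF y Lp_borel_test_function[OF test_function_partial_deriv[OF \<psi>]] q p(1) p(2), of "- h"] p
      by simp
    then have 1: "(LBINT x. - seg_avg (- h) (\<lambda>x. Y x \<bullet> h) x * partial_deriv v \<psi> x)
        = - (LBINT x. (Y x \<bullet> h) * partial_deriv v \<Psi> x)"
      by (simp add: \<Psi>_def partial_deriv_seg_avg[OF sp])
    have int: "integrable lborel (\<lambda>x. (u x \<bullet> v) * \<phi> x)" if "Lp_borel q u" "\<phi> \<in> test_functions V" for u :: "'a \<Rightarrow> 'a" and v \<phi> V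
      using integrable_mult_test_function[OF Lp_borel_inner_right[OF that(1) q0] q that(2)] .
    have "(LBINT x. (seg_avg (- h) X x \<bullet> v) * \<psi> x) = (LBINT x. seg_avg (- h) X x \<bullet> (\<psi> x *\<^sub>R v))"
      by (simp add: mult.commute)
    also have "\<dots> = (LBINT x. X x \<bullet> seg_avg h (\<lambda>x. \<psi> x *\<^sub>R v) x)"
    proof -
      have "Lp_borel p (\<lambda>x. \<psi> x *\<^sub>R v)"
      proof (rule Lp_borel_bound[where g = "\<lambda>x. norm (\<psi> x) powr p * norm v powr p"])
        show "integrable lborel (\<lambda>x. norm (\<psi> x) powr p * norm v powr p)"
          using Lp_borel_test_function[OF \<psi>, of p] p by (auto simp: Lp_borel_def)
      qed (auto simp: powr_mult)
      then show ?thesis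
        using seg_avg_adjoint[OF X _ q p(1) p(2), of "\<lambda>x. \<psi> x *\<^sub>R v" "- h"] by simp
    qed
    also have "\<dots> = (LBINT x. (X x \<bullet> v) * \<Psi> x)"
      unfolding seg_avg_test_scaleR[OF \<psi>] \<Psi>_def by (simp add: mult.commute)
    finally have 2: "(LBINT x. (seg_avg (- h) X x \<bullet> v) * \<psi> x) = (LBINT x. (X x \<bullet> v) * \<Psi> x)" .
    have 3: "(LBINT x. (Y (x - h) \<bullet> v) * \<psi> x) = (LBINT x. (Y x \<bullet> v) * \<psi> (x + h))"
      using integral_translate[of "\<lambda>x. (Y (x - h) \<bullet> v) * \<psi> x" h] by simp
    have "(LBINT x. ((Y (x - h) - Y x + seg_avg (- h) X x) \<bullet> v) * \<psi> x)
       = (LBINT x. (Y (x - h) \<bullet> v) * \<psi> x - (Y x \<bullet> v) * \<psi> x + (seg_avg (- h) X x \<bullet> v) * \<psi> x)"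
      by (simp add: algebra_simps)
    also have "\<dots> = (LBINT x. (Y (x - h) \<bullet> v) * \<psi> x) - (LBINT x. (Y x \<bullet> v) * \<psi> x)
          + (LBINT x. (seg_avg (- h) X x \<bullet> v) * \<psi> x)"
      by (simp only: integral_linear int[OF Y \<psi>] int[OF Yt \<psi>] int[OF Lp_borel_seg_avg[OF X q] \<psi>])
    also have "\<dots> = (LBINT x. (Y x \<bullet> v) * \<psi> (x + h)) - (LBINT x. (Y x \<bullet> v) * \<psi> x) + (LBINT x. (X x \<bullet> v) * \<Psi> x)"
      by (simp only: 2 3)
    also have "\<dots> = (LBINT x. (Y x \<bullet> v) * \<psi> (x + h) - (Y x \<bullet> v) * \<psi> x + (X x \<bullet> v) * \<Psi> x)"
      by (simp only: integral_linear int[OF Y \<psi>] int[OF Y \<psi>t] int[OF X \<Psi>])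
    also have "\<dots> = (LBINT x. (G x \<bullet> v) * partial_deriv h \<theta> x - (G x \<bullet> h) * partial_deriv v \<theta> x
          + (Y x \<bullet> h) * partial_deriv v \<Psi> x)"
    proof (rule Bochner_Integration.integral_cong[OF refl])
      fix x
      have "\<psi> (x + h) = \<psi> x + partial_deriv h \<Psi> x"
        unfolding \<Psi>_def using partial_deriv_seg_avg_self[OF sp, of h x] by simp
      then show "(Y x \<bullet> v) * \<psi> (x + h) - (Y x \<bullet> v) * \<psi> x + (X x \<bullet> v) * \<Psi> x
        = (G x \<bullet> v) * partial_deriv h \<theta> x - (G x \<bullet> h) * partial_deriv v \<theta> x + (Y x \<bullet> h) * partial_deriv v \<Psi> x"
        by (simp add: D\<theta> X_def Y_def inner_diff_left grad_inner[OF sm] algebra_simps)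
    qed
    also have "\<dots> = (LBINT x. (G x \<bullet> v) * partial_deriv h \<theta> x) - (LBINT x. (G x \<bullet> h) * partial_deriv v \<theta> x)
          + (LBINT x. (Y x \<bullet> h) * partial_deriv v \<Psi> x)"
      by (simp only: integral_linear int[OF G test_function_partial_deriv[OF \<theta>]] int[OF Y test_function_partial_deriv[OF \<Psi>]])
    also have "(LBINT x. (G x \<bullet> v) * partial_deriv h \<theta> x) = (LBINT x. (G x \<bullet> h) * partial_deriv v \<theta> x)"
    proof -
      have "- (LBINT x. (G x \<bullet> v) * partial_deriv h \<theta> x) = (LBINT x. w x * partial_deriv v (partial_deriv h \<theta>) x)"
        using wg test_function_partial_deriv[OF \<theta>] by (simp add: borel_weak_grad_def)
      also have "\<dots> = (LBINT x. w x * partial_deriv h (partial_deriv v \<theta>) x)"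
        by (simp only: partial_deriv_commute[OF test_function_smooth[OF \<theta>], of v h])
      also have "\<dots> = - (LBINT x. (G x \<bullet> h) * partial_deriv v \<theta> x)"
        using wg test_function_partial_deriv[OF \<theta>] by (simp add: borel_weak_grad_def)
      finally show ?thesis by simp
    qed
    finally have 4: "(LBINT x. ((Y (x - h) - Y x + seg_avg (- h) X x) \<bullet> v) * \<psi> x)
        = (LBINT x. (Y x \<bullet> h) * partial_deriv v \<Psi> x)" by simp
    show "(LBINT x. - seg_avg (- h) (\<lambda>x. Y x \<bullet> h) x * partial_deriv v \<psi> x)
       = - (LBINT x. ((Y (x - h) - Y x + seg_avg (- h) X x) \<bullet> v) * \<psi> x)"
      unfolding 1 4 by simp
  qed
qed

text \<open>The divergence of the cut-off potential of \<open>\<sigma>(x + h) - \<sigma>(x)\<close> from the homotopy formula. The second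
  summand accounts for the divergence \<open>-f\<close> of \<open>\<sigma>\<close>, the bracket for the gradient of \<open>\<eta>\<close>.\<close>

definition local_shift ::
    "('a::euclidean_space \<Rightarrow> real) \<Rightarrow> 'a \<Rightarrow> ('a \<Rightarrow> real) \<Rightarrow> ('a \<Rightarrow> 'a) \<Rightarrow> 'a \<Rightarrow> 'a" where
  "local_shift \<eta> h f \<sigma> x = \<eta> x *\<^sub>R (\<sigma> (x + h) - \<sigma> x) + (\<eta> x * seg_avg h f x) *\<^sub>R h
     + (partial_deriv h \<eta> x *\<^sub>R seg_avg h \<sigma> x - (seg_avg h \<sigma> x \<bullet> grad \<eta> x) *\<^sub>R h)"

text \<open>Moving translations and averages from \<open>\<sigma>\<close> and \<open>f\<close> to \<open>G\<close> produces exactly the gradient and the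
  function of \<open>borel_weak_grad_localized_translation\<close>, on which the Neumann condition of \<open>\<sigma>\<close> is tested.\<close>

lemma local_shift_div_free:
  fixes \<sigma> :: "'a::euclidean_space \<Rightarrow> 'a" and h :: 'a
  assumes \<sigma>: "Lp_borel p \<sigma>" and f: "Lp_borel p f" and pq: "p > 1" "q > 1" "1 / p + 1 / q = 1"
    and neu: "borel_neumann q \<Omega> f \<sigma>" and \<eta>: "\<eta> \<in> test_functions \<Omega>"
    and wg: "borel_weak_grad q \<Omega> w G"
  shows "(LBINT x. local_shift \<eta> h f \<sigma> x \<bullet> G x) = 0"
    and "integrable lborel (\<lambda>x. local_shift \<eta> h f \<sigma> x \<bullet> G x)"
proof -
  define Y where "Y = (\<lambda>x. \<eta> x *\<^sub>R G x)"
  define X where "X = (\<lambda>x. partial_deriv h \<eta> x *\<^sub>R G x - (G x \<bullet> h) *\<^sub>R grad \<eta> x)"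
  have W: "borel_weak_grad q \<Omega> (\<lambda>x. - seg_avg (- h) (\<lambda>x. Y x \<bullet> h) x) (\<lambda>x. Y (x - h) - Y x + seg_avg (- h) X x)"
    unfolding Y_def X_def by (rule borel_weak_grad_localized_translation(1)[OF wg pq(2) \<eta>])
  have Y: "Lp_borel q Y" and X: "Lp_borel q X"
    using borel_weak_grad_localized_translation(2,3)[OF wg pq(2) \<eta>] by (simp_all add: Y_def X_def)
  have y: "Lp_borel q (\<lambda>x. Y x \<bullet> h)" using pq by (intro Lp_borel_inner_right Y) auto
  have [measurable]: "\<sigma> \<in> borel_measurable borel" "f \<in> borel_measurable borel" "Y \<in> borel_measurable borel" "X \<in> borel_measurable borel"
    using \<sigma> f X Y by (auto intro: Lp_borelD)
  have \<sigma>t: "Lp_borel p (\<lambda>x. \<sigma> (x + h))" by (rule Lp_borel_translate[OF \<sigma>])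
  have Yt: "Lp_borel q (\<lambda>x. Y (x - h))" using Lp_borel_translate[OF Y, of "- h"] by simp
  have S: "Lp_borel p (seg_avg h \<sigma>)" and F: "Lp_borel p (seg_avg h f)"
    using pq by (auto intro: Lp_borel_seg_avg \<sigma> f)
  have X': "Lp_borel q (seg_avg (- h) X)" and y': "Lp_borel q (seg_avg (- h) (\<lambda>x. Y x \<bullet> h))"
    using pq by (auto intro: Lp_borel_seg_avg X y)
  note int = Lp_borel_integrable_inner[OF _ _ pq]
  have eq: "local_shift \<eta> h f \<sigma> x \<bullet> G x
     = \<sigma> (x + h) \<bullet> Y x - \<sigma> x \<bullet> Y x + seg_avg h f x \<bullet> (Y x \<bullet> h) + seg_avg h \<sigma> x \<bullet> X x" for x
    by (simp add: local_shift_def X_def Y_def inner_add_left inner_diff_left inner_diff_right algebra_simps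
       inner_commute[of h "G x"])
  note ints = int[OF \<sigma> Y] int[OF \<sigma>t Y] int[OF F y] int[OF S X] int[OF \<sigma> Yt] int[OF \<sigma> X'] int[OF f y']
  show "integrable lborel (\<lambda>x. local_shift \<eta> h f \<sigma> x \<bullet> G x)"
    unfolding eq by (intro Bochner_Integration.integrable_add Bochner_Integration.integrable_diff ints)
  have "(LBINT x. local_shift \<eta> h f \<sigma> x \<bullet> G x)
     = (LBINT x. \<sigma> (x + h) \<bullet> Y x) - (LBINT x. \<sigma> x \<bullet> Y x) + (LBINT x. seg_avg h f x \<bullet> (Y x \<bullet> h))
       + (LBINT x. seg_avg h \<sigma> x \<bullet> X x)"
    unfolding eq
    by (simp only: integral_linear ints)
  also have "(LBINT x. \<sigma> (x + h) \<bullet> Y x) = (LBINT x. \<sigma> x \<bullet> Y (x - h))"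
    using integral_translate[of "\<lambda>x. \<sigma> x \<bullet> Y (x - h)" h] by simp
  also have "(LBINT x. seg_avg h f x \<bullet> (Y x \<bullet> h)) = (LBINT x. f x \<bullet> seg_avg (- h) (\<lambda>x. Y x \<bullet> h) x)"
    by (rule seg_avg_adjoint[OF f y pq])
  also have "(LBINT x. seg_avg h \<sigma> x \<bullet> X x) = (LBINT x. \<sigma> x \<bullet> seg_avg (- h) X x)"
    by (rule seg_avg_adjoint[OF \<sigma> X pq])
  also have "(LBINT x. \<sigma> x \<bullet> Y (x - h)) - (LBINT x. \<sigma> x \<bullet> Y x) + (LBINT x. f x \<bullet> seg_avg (- h) (\<lambda>x. Y x \<bullet> h) x)
      + (LBINT x. \<sigma> x \<bullet> seg_avg (- h) X x)
    = (LBINT x. \<sigma> x \<bullet> Y (x - h) - \<sigma> x \<bullet> Y x + \<sigma> x \<bullet> seg_avg (- h) X x) + (LBINT x. f x * seg_avg (- h) (\<lambda>x. Y x \<bullet> h) x)"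
    by (simp add: integral_linear ints)
  also have "(LBINT x. \<sigma> x \<bullet> Y (x - h) - \<sigma> x \<bullet> Y x + \<sigma> x \<bullet> seg_avg (- h) X x)
     = (LBINT x. \<sigma> x \<bullet> (Y (x - h) - Y x + seg_avg (- h) X x))"
    by (simp add: inner_add_right inner_diff_right)
  also have "\<dots> = (LBINT x. f x * - seg_avg (- h) (\<lambda>x. Y x \<bullet> h) x)"
    using neu W unfolding borel_neumann_def by blast
  finally show "(LBINT x. local_shift \<eta> h f \<sigma> x \<bullet> G x) = 0" by simp
qed

section \<open>Local bounds on differences\<close>

text \<open>The exponent \<open>t\<close> belongs to the \<open>p\<close>-th power of the \<open>L\<^sup>p\<close> norm: this is local Besov regularity of
  order \<open>t/p\<close>.\<close>

definition diff_bound :: "real \<Rightarrow> real \<Rightarrow> 'a::euclidean_space set \<Rightarrow> ('a \<Rightarrow> 'b::euclidean_space) \<Rightarrow> bool" where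
  "diff_bound p t \<Omega> u \<longleftrightarrow> (\<forall>K. compact K \<and> K \<subseteq> \<Omega> \<longrightarrow> (\<exists>C\<ge>0. \<exists>\<delta>>0. \<forall>h. norm h < \<delta> \<longrightarrow>
     int_powr p K (\<lambda>x. u (x + h) - u x) \<le> ennreal (C * norm h powr t)))"

lemma diff_boundD:
  assumes "diff_bound p t \<Omega> u" "compact K" "K \<subseteq> \<Omega>"
  shows "\<exists>C \<delta>. C \<ge> 0 \<and> \<delta> > 0 \<and> \<delta> \<le> 1 \<and> (\<forall>h. norm h < \<delta> \<longrightarrow>
    int_powr p K (\<lambda>x. u (x + h) - u x) \<le> ennreal (C * norm h powr t))"
proof -
  obtain C \<delta> where *: "C \<ge> 0" "\<delta> > 0"
    "\<And>h. norm h < \<delta> \<Longrightarrow> int_powr p K (\<lambda>x. u (x + h) - u x) \<le> ennreal (C * norm h powr t)"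
    using assms(1)[unfolded diff_bound_def, rule_format, OF conjI[OF assms(2,3)]] by blast
  show ?thesis using * by (intro exI[of _ C] exI[of _ "min \<delta> 1"]) auto
qed

lemma diff_boundI:
  assumes "\<And>K. compact K \<Longrightarrow> K \<subseteq> \<Omega> \<Longrightarrow> \<exists>C\<ge>0. \<exists>\<delta>>0. \<forall>h. norm h < \<delta> \<longrightarrow>
     int_powr p K (\<lambda>x. u (x + h) - u x) \<le> ennreal (C * norm h powr t)"
  shows "diff_bound p t \<Omega> u"
  using assms unfolding diff_bound_def by blast

lemma diff_bound_mono:
  assumes "diff_bound p t \<Omega> u" "t' \<le> t"
  shows "diff_bound p t' \<Omega> u"
proof (rule diff_boundI)
  fix K assume K: "compact K" "K \<subseteq> \<Omega>"
  obtain C \<delta> where *: "C \<ge> 0" "\<delta> > 0" "\<delta> \<le> 1"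
    "\<And>h. norm h < \<delta> \<Longrightarrow> int_powr p K (\<lambda>x. u (x + h) - u x) \<le> ennreal (C * norm h powr t)"
    using diff_boundD[OF assms(1) K] by blast
  have "int_powr p K (\<lambda>x. u (x + h) - u x) \<le> ennreal (C * norm h powr t')"
    if "norm h < \<delta>" for h
  proof -
    have "C * norm h powr t \<le> C * norm h powr t'"
      using * that assms(2) by (intro mult_left_mono powr_mono') auto
    then show ?thesis using *(4)[OF that] by (meson ennreal_leI order_trans)
  qed
  then show "\<exists>C\<ge>0. \<exists>\<delta>>0. \<forall>h. norm h < \<delta> \<longrightarrow>
     int_powr p K (\<lambda>x. u (x + h) - u x) \<le> ennreal (C * norm h powr t')"
    using * by blast
qed

lemma nn_integral_bound_two:
  fixes a b U V :: real and g u v :: "'a::euclidean_space \<Rightarrow> real"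
  assumes m [measurable]: "u \<in> borel_measurable borel" "v \<in> borel_measurable borel"
    and nn: "a \<ge> 0" "b \<ge> 0" "U \<ge> 0" "V \<ge> 0" "\<And>x. u x \<ge> 0" "\<And>x. v x \<ge> 0"
    and le: "\<And>x. g x \<le> a * u x + b * v x"
    and U: "(\<integral>\<^sup>+x. ennreal (u x) \<partial>lborel) \<le> ennreal U"
    and V: "(\<integral>\<^sup>+x. ennreal (v x) \<partial>lborel) \<le> ennreal V"
  shows "(\<integral>\<^sup>+x. ennreal (g x) \<partial>lborel) \<le> ennreal (a * U + b * V)"
proof -
  have "(\<integral>\<^sup>+x. ennreal (g x) \<partial>lborel) \<le> (\<integral>\<^sup>+x. ennreal a * ennreal (u x) + ennreal b * ennreal (v x) \<partial>lborel)"
    using le nn by (intro nn_integral_mono) (auto simp flip: ennreal_mult ennreal_plus intro!: ennreal_leI)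
  also have "\<dots> = ennreal a * (\<integral>\<^sup>+x. ennreal (u x) \<partial>lborel) + ennreal b * (\<integral>\<^sup>+x. ennreal (v x) \<partial>lborel)"
    by (subst nn_integral_add) (auto simp: nn_integral_cmult)
  also have "\<dots> \<le> ennreal a * ennreal U + ennreal b * ennreal V"
    by (intro add_mono mult_left_mono U V) auto
  also have "\<dots> = ennreal (a * U + b * V)"
    using nn by (simp add: ennreal_mult ennreal_plus)
  finally show ?thesis .
qed

lemma nn_integral_Lp_borel:
  assumes "Lp_borel p u"
  shows "(\<integral>\<^sup>+x. ennreal (norm (u x) powr p) \<partial>lborel) = ennreal (LBINT x. norm (u x) powr p)"
  using assms by (intro nn_integral_eq_integral) (auto simp: Lp_borel_def)

section \<open>Differences of Sobolev and Besov functions\<close>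

text \<open>Bumps converge to indicators of boxes, so \<open>g\<close> has integral \<open>0\<close> over every box with closure in \<open>V\<close>.
  Boxes are stable under intersection and generate the Borel sets; Dynkin's lemma extends this to all Borel
  subsets of such a box, and countably many of these boxes cover \<open>V\<close>.\<close>

lemma fundamental_lemma:
  fixes g :: "'a::euclidean_space \<Rightarrow> real"
  assumes g: "Lp_borel p g" and p: "p \<ge> 1" and V: "open V"
    and zero: "\<And>\<psi>. \<psi> \<in> test_functions V \<Longrightarrow> (LBINT x. g x * \<psi> x) = 0"
  shows "AE x in lborel. x \<in> V \<longrightarrow> g x = 0"
proof -
  have [measurable]: "g \<in> borel_measurable borel" using g by (rule Lp_borelD)
  have int: "integrable lborel (\<lambda>x. indicator (cbox a b) x * norm (g x))" for a b
  proof (rule Bochner_Integration.integrable_bound)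
    show "integrable lborel (\<lambda>x. indicator (cbox a b) x + norm (g x) powr p)"
      using g by (intro Bochner_Integration.integrable_add Lp_borel_integrable integrable_real_indicator
          emeasure_bounded_finite bounded_cbox) auto
    show "AE x in lborel. norm (indicator (cbox a b) x * norm (g x)) \<le> norm (indicator (cbox a b) x + norm (g x) powr p)"
      using p le_one_plus_powr[of "norm (g _)" p] by (intro AE_I2) (auto simp: indicator_def)
  qed measurable
  have box_sub: "box a b \<subseteq> cbox a b" for a b :: 'a by (rule box_subset_cbox)
  have int': "integrable lborel (\<lambda>x. indicator (box a b) x * g x)" for a b
    by (rule Bochner_Integration.integrable_bound[OF int[of a b]])
       (use box_sub[of a b] in \<open>auto intro!: AE_I2 simp: indicator_def\<close>)
  have box: "(LBINT x. indicator (box a b) x * g x) = 0" if ab: "cbox a b \<subseteq> V" for a b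
  proof (cases "box a b = {}")
    case False
    have [measurable]: "box_bump k a b \<in> borel_measurable borel" for k
      by (intro borel_measurable_continuous_onI smooth_continuous smooth_box_bump)
    have bz: "box_bump (real (Suc n)) a b x = 0" if "x \<notin> box a b" for n x
      using box_bump_pos[OF _ False, of "real (Suc n)" x] that box_bump_bounds(1)[of "real (Suc n)" a b x] by auto
    have "(\<lambda>n. LBINT x. g x * box_bump (real (Suc n)) a b x) \<longlonglongrightarrow> (LBINT x. g x * indicator (box a b) x)"
    proof (rule integral_dominated_convergence)
      show "integrable lborel (\<lambda>x. indicator (cbox a b) x * norm (g x))" by (rule int)
      show "AE x in lborel. (\<lambda>n. g x * box_bump (real (Suc n)) a b x) \<longlonglongrightarrow> g x * indicator (box a b) x"
        by (intro AE_I2 tendsto_mult tendsto_const box_bump_tendsto False)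
      show "AE x in lborel. norm (g x * box_bump (real (Suc n)) a b x) \<le> indicator (cbox a b) x * norm (g x)" for n
      proof (rule AE_I2)
        fix x
        show "norm (g x * box_bump (real (Suc n)) a b x) \<le> indicator (cbox a b) x * norm (g x)"
        proof (cases "x \<in> box a b")
          case True
          then have "x \<in> cbox a b" using box_sub by blast
          then show ?thesis
            using box_bump_bounds[of "real (Suc n)" a b x] by (simp add: abs_mult mult_left_le)
        next
          case False
          then show ?thesis using bz by simp
        qed
      qed
    qed measurable
    moreover have "(LBINT x. g x * box_bump (real (Suc n)) a b x) = 0" for n
    proof (rule zero, rule test_functionI)
      show "box_bump (real (Suc n)) a b x = 0" if "x \<notin> cbox a b" for x
        using bz[of x n] that box_sub by blast
    qed (use smooth_box_bump ab in auto)
    ultimately have "(\<lambda>n::nat. 0) \<longlonglongrightarrow> (LBINT x. g x * indicator (box a b) x)" by simp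
    then have "(LBINT x. g x * indicator (box a b) x) = 0" by (simp add: LIMSEQ_const_iff)
    then show ?thesis by (simp add: mult.commute)
  qed simp
  have local: "AE x in lborel. indicator (box c d) x * g x = 0" if cd: "cbox c d \<subseteq> V" for c d
  proof (rule sigma_finite_measure.density_zero[OF sigma_finite_lborel int'])
    let ?P = "\<lambda>A. set_lebesgue_integral lborel A (\<lambda>x. indicator (box c d) x * g x) = 0"
    fix A :: "'a set" assume "A \<in> sets lborel"
    then have A: "A \<in> sigma_sets UNIV (range (\<lambda>(a, b). box a b))"
      by (simp add: borel_eq_box)
    have meas: "B \<in> sets borel" if "B \<in> sigma_sets UNIV (range (\<lambda>(a, b). box a b))" for B :: "'a set"
      using that by (simp add: borel_eq_box)
    have si: "set_integrable lborel B (\<lambda>x. indicator (box c d) x * g x)" if "B \<in> sets borel" for B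
      unfolding set_integrable_def by (rule integrable_mult_indicator[OF _ int']) (use that in simp)
    show "?P A"
    proof (rule sigma_sets_induct_disjoint[OF _ _ A])
      show "Int_stable (range (\<lambda>(a, b). box a b :: 'a set))" by (auto simp: Int_stable_def box_Int_box)
    next
      fix B :: "'a set" assume "B \<in> range (\<lambda>(a, b). box a b)"
      then obtain a b where B: "B = box a b" by auto
      obtain e f where ef: "box a b \<inter> box c d = box e f" "cbox a b \<inter> cbox c d = cbox e f"
        using box_Int_box[of a b c d] Int_interval[of a b c d] by blast
      then have zero: "(LBINT x. indicator (box e f) x * g x) = 0" using cd by (intro box) auto
      have eq: "indicator B x *\<^sub>R (indicator (box c d) x * g x) = indicator (box e f) x * g x" for x
        unfolding B ef(1)[symmetric] by (simp add: indicator_inter_arith)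
      show "?P B" unfolding set_lebesgue_integral_def by (simp only: eq zero)
    next
      fix B assume B: "B \<in> sigma_sets UNIV (range (\<lambda>(a, b). box a b :: 'a set))" and PB: "?P B"
      have Bm: "B \<in> sets borel" by (rule meas[OF B])
      have "set_lebesgue_integral lborel (UNIV - B) (\<lambda>x. indicator (box c d) x * g x)
          = (LBINT x. indicator (box c d) x * g x - indicator B x *\<^sub>R (indicator (box c d) x * g x))"
        unfolding set_lebesgue_integral_def
        by (intro Bochner_Integration.integral_cong) (auto simp: indicator_def)
      also have "\<dots> = 0"
        using int'[of c d] si[OF Bm] PB box[OF cd]
        by (subst Bochner_Integration.integral_diff) (auto simp: set_integrable_def set_lebesgue_integral_def)
      finally show "?P (UNIV - B)" .
    next
      fix B :: "nat \<Rightarrow> 'a set"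
      assume B: "disjoint_family B" "range B \<subseteq> sigma_sets UNIV (range (\<lambda>(a, b). box a b))" "\<And>i. ?P (B i)"
      have m: "B i \<in> sets lborel" for i using meas B(2) by auto
      have "set_lebesgue_integral lborel (\<Union>i. B i) (\<lambda>x. indicator (box c d) x * g x)
         = (\<Sum>i. set_lebesgue_integral lborel (B i) (\<lambda>x. indicator (box c d) x * g x))"
      proof (rule lebesgue_integral_countable_add[OF m])
        show "B i \<inter> B j = {}" if "i \<noteq> j" for i j using B(1) that by (auto simp: disjoint_family_on_def)
        have "(\<Union>i. B i) \<in> sets lborel" using m by (intro sets.countable_UN) auto
        then show "set_integrable lborel (\<Union>i. B i) (\<lambda>x. indicator (box c d) x * g x)" by (intro si) simp
      qed
      then show "?P (\<Union>i. B i)" using B(3) by simp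
    qed (auto simp: set_lebesgue_integral_def)
  qed
  define \<F> where "\<F> = {box c d | c d. cbox c d \<subseteq> V}"
  obtain \<F>' where F: "\<F>' \<subseteq> \<F>" "countable \<F>'" "\<Union>\<F>' = \<Union>\<F>"
    using Lindelof[of \<F>] unfolding \<F>_def by auto
  have cover: "V \<subseteq> \<Union>\<F>'"
  proof
    fix x assume "x \<in> V"
    then obtain a b where "cbox a b \<subseteq> V" "x \<in> box a b" using open_contains_cbox[OF V] by metis
    then show "x \<in> \<Union>\<F>'" unfolding F(3) \<F>_def by blast
  qed
  have "AE x in lborel. \<forall>B\<in>\<F>'. indicator B x * g x = 0"
    using F(1) local by (subst AE_ball_countable[OF F(2)]) (auto simp: \<F>_def)
  then show ?thesis
  proof eventually_elim
    case (elim x)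
    show ?case
    proof
      assume "x \<in> V"
      then obtain B where "B \<in> \<F>'" "x \<in> B" using cover by blast
      then show "g x = 0" using elim by force
    qed
  qed
qed

text \<open>The difference \<open>f(x + h) - f(x)\<close> is almost everywhere the segment average of \<open>G \<bullet> h\<close>: against a test
  function both become the pairing of \<open>f\<close> with the derivative along \<open>h\<close> of a segment average.\<close>

lemma diff_bound_of_W1p_loc:
  fixes f :: "'a::euclidean_space \<Rightarrow> real"
  assumes \<Omega>: "open \<Omega>" and p: "p > 1" and f: "f \<in> W1p_loc p \<Omega>" and rep: "represents \<Omega> f f'" and f': "Lp_borel p f'"
  shows "diff_bound p p \<Omega> f'"
proof (rule diff_boundI)
  fix K assume K: "compact K" "K \<subseteq> \<Omega>"
  obtain e where e: "e > 0" "(\<Union>x\<in>K. cball x e) \<subseteq> \<Omega>"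
    using compact_subset_open_imp_cball_epsilon_subset[OF K(1) \<Omega> K(2)] by metis
  define U where "U = (\<Union>x\<in>K. ball x e)"
  define V where "V = (\<Union>x\<in>K. ball x (e / 2))"
  have oU: "open U" "open V" by (auto simp: U_def V_def)
  then have bU [measurable]: "U \<in> sets borel" by auto
  define D where "D = (\<Union>x\<in>K. \<Union>y\<in>cball 0 e. {x + y})"
  have D: "compact D" unfolding D_def by (rule compact_sums'[OF K(1) compact_cball])
  have "U \<subseteq> D"
  proof
    fix y assume "y \<in> U"
    then obtain x where "x \<in> K" "dist x y < e" by (auto simp: U_def)
    then show "y \<in> D" unfolding D_def
      by (intro UN_I[of x] UN_I[of "y - x"]) (auto simp: dist_norm norm_minus_commute)
  qed
  then have cl: "closure U \<subseteq> D" using D by (intro closure_minimal compact_imp_closed)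
  then have "compact (closure U)"
    using D compact_imp_bounded bounded_subset closure_subset[of U] by (metis compact_closure)
  moreover have "closure U \<subseteq> \<Omega>"
  proof
    fix y assume "y \<in> closure U"
    then obtain x z where "x \<in> K" "norm z \<le> e" "y = x + z" using cl by (auto simp: D_def)
    then have "y \<in> (\<Union>x\<in>K. cball x e)" by (intro UN_I[of x]) (auto simp: dist_norm)
    then show "y \<in> \<Omega>" using e(2) by blast
  qed
  ultimately have "compact (closure U)" "closure U \<subseteq> \<Omega>" by auto
  then have "f \<in> W1p p U" using f oU by (auto simp: W1p_loc_def)
  then obtain G where fG: "f \<in> Lp_on p U" "G \<in> Lp_on p U" "weak_gradient U f G" by (auto simp: W1p_def)
  have [measurable]: "f' \<in> borel_measurable borel" using f' by (rule Lp_borelD)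
  have "U \<subseteq> \<Omega>" using \<open>closure U \<subseteq> \<Omega>\<close> closure_subset by blast
  then have ru: "represents U f (\<lambda>x. indicator U x *\<^sub>R f' x)"
    using rep by (auto simp: represents_def elim!: eventually_mono)
  obtain G' where rG: "represents U G G'"
    using representative_exists[OF bU, of G] fG(2) by (auto simp: Lp_on_def)
  define u where "u = (\<lambda>x. indicator U x *\<^sub>R f' x)"
  have wg: "borel_weak_grad p U u G'"
    unfolding u_def by (rule borel_weak_grad_represents[OF bU p ru fG(1) rG fG(2,3)])
  have u: "Lp_borel p u" and G': "Lp_borel p G'" using wg by (auto simp: borel_weak_grad_def)
  have [measurable]: "u \<in> borel_measurable borel" "G' \<in> borel_measurable borel" using u G' by (auto intro: Lp_borelD)
  define M where "M = (LBINT x. norm (G' x) powr p)"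
  have M: "M \<ge> 0" unfolding M_def by simp
  have "int_powr p K (\<lambda>x. f' (x + h) - f' x) \<le> ennreal (M * norm h powr p)"
    if h: "norm h < e / 2" for h
  proof -
    define y where "y = (\<lambda>x. G' x \<bullet> h)"
    have y: "Lp_borel p y" unfolding y_def using p by (intro Lp_borel_inner_right G') auto
    have [measurable]: "y \<in> borel_measurable borel" using y by (rule Lp_borelD)
    have "AE x in lborel. x \<in> V \<longrightarrow> u (x + h) - u x - seg_avg h y x = 0"
    proof (rule fundamental_lemma[OF _ less_imp_le[OF p] oU(2)])
      show "Lp_borel p (\<lambda>x. u (x + h) - u x - seg_avg h y x)"
        using p by (intro Lp_borel_diff Lp_borel_translate Lp_borel_seg_avg u y) auto
      fix \<psi> assume \<psi>: "\<psi> \<in> test_functions V"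
      have [measurable]: "\<psi> \<in> borel_measurable borel" using \<psi> by (rule test_function_measurable)
      define \<Psi> where "\<Psi> = seg_avg (- h) \<psi>"
      have \<Psi>: "\<Psi> \<in> test_functions U" unfolding \<Psi>_def
      proof (rule test_function_seg_avg[OF \<psi>])
        fix x and s :: real assume "x \<in> V" and s: "s \<in> {0..1}"
        then obtain z where z: "z \<in> K" "dist z x < e / 2" by (auto simp: V_def)
        have "norm (s *\<^sub>R h) \<le> norm h" using s by (simp add: mult_left_le_one_le)
        then have "dist x (x - s *\<^sub>R (- h)) < e / 2" using h by (simp add: dist_norm)
        then have "dist z (x - s *\<^sub>R (- h)) < e" using z dist_triangle[of z "x - s *\<^sub>R (- h)" x] by linarith
        then show "x - s *\<^sub>R (- h) \<in> U" using z by (auto simp: U_def)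
      qed
      define q where "q = p / (p - 1)"
      have q: "q > 1" "1 / p + 1 / q = 1" using p by (auto simp: q_def field_simps)
      have L\<psi>: "Lp_borel q \<psi>" using q by (intro Lp_borel_test_function[OF \<psi>]) auto
      have L\<psi>t: "Lp_borel q (\<lambda>x. \<psi> (x - h))" using Lp_borel_translate[OF L\<psi>, of "- h"] by simp
      have int: "integrable lborel (\<lambda>x. a x * b x)" if "Lp_borel p a" "Lp_borel q b" for a b :: "'a \<Rightarrow> real"
        using Lp_borel_integrable_inner[OF that p q] by simp
      have "(LBINT x. (u (x + h) - u x - seg_avg h y x) * \<psi> x)
         = (LBINT x. u (x + h) * \<psi> x) - (LBINT x. u x * \<psi> x) - (LBINT x. seg_avg h y x * \<psi> x)"
        by (simp only: left_diff_distrib Bochner_Integration.integral_diff Bochner_Integration.integrable_diff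
          int[OF Lp_borel_translate[OF u] L\<psi>] int[OF u L\<psi>] int[OF Lp_borel_seg_avg[OF y p] L\<psi>])
      also have "(LBINT x. u (x + h) * \<psi> x) = (LBINT x. u x * \<psi> (x - h))"
        using integral_translate[of "\<lambda>x. u x * \<psi> (x - h)" h] by simp
      also have "(LBINT x. seg_avg h y x * \<psi> x) = (LBINT x. y x * \<Psi> x)"
        unfolding \<Psi>_def using seg_avg_adjoint[OF y L\<psi> p q(1) q(2), of h] by simp
      also have "(LBINT x. u x * \<psi> (x - h)) - (LBINT x. u x * \<psi> x) = (LBINT x. u x * (\<psi> (x - h) - \<psi> x))"
        by (simp add: right_diff_distrib int[OF u L\<psi>] int[OF u L\<psi>t])
      also have "\<dots> = (LBINT x. u x * partial_deriv (- h) \<Psi> x)"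
        unfolding \<Psi>_def using partial_deriv_seg_avg_self[OF test_function_smooth[OF \<psi>], of "- h"] by simp
      also have "\<dots> = (LBINT x. y x * \<Psi> x)"
        using wg \<Psi> by (simp add: borel_weak_grad_def y_def)
      finally show "(LBINT x. (u (x + h) - u x - seg_avg h y x) * \<psi> x) = 0" by simp
    qed
    then have "int_powr p K (\<lambda>x. f' (x + h) - f' x)
        \<le> int_powr p UNIV (\<lambda>x. seg_avg h y x)"
    proof (intro nn_integral_mono_AE, eventually_elim)
      case (elim x)
      show ?case
      proof (cases "x \<in> K")
        case True
        have "x \<in> V" "x \<in> U" "x + h \<in> U"
          using True e h by (auto simp: V_def U_def dist_norm intro!: bexI[of _ x])
        then show ?thesis using elim True by (simp add: u_def)
      qed simp
    qed
    also have "\<dots> \<le> ennreal (M * norm h powr p)"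
    proof (rule seg_avg_powr_le)
      fix s :: real
      have "int_powr p UNIV (\<lambda>x. y (x + s *\<^sub>R h)) = (\<integral>\<^sup>+x. ennreal (norm (y x) powr p) \<partial>lborel)"
        using nn_integral_translate[of "\<lambda>x. ennreal (norm (y x) powr p)" "s *\<^sub>R h"] by simp
      also have "\<dots> \<le> (\<integral>\<^sup>+x. ennreal (norm h powr p) * ennreal (norm (G' x) powr p) \<partial>lborel)"
      proof (rule nn_integral_mono)
        fix x
        have "norm (y x) powr p \<le> (norm (G' x) * norm h) powr p"
          unfolding y_def using p by (intro powr_mono2 Cauchy_Schwarz_ineq2[folded real_norm_def]) auto
        then show "ennreal (norm (y x) powr p) \<le> ennreal (norm h powr p) * ennreal (norm (G' x) powr p)"
          by (simp add: powr_mult mult.commute flip: ennreal_mult)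
      qed
      also have "\<dots> = ennreal (norm h powr p) * ennreal M"
        unfolding M_def nn_integral_Lp_borel[OF G', symmetric] by (rule nn_integral_cmult) measurable
      also have "\<dots> = ennreal (M * norm h powr p)" using M by (simp add: ennreal_mult mult.commute)
      finally show "int_powr p UNIV (\<lambda>x. y (x + s *\<^sub>R h)) \<le> ennreal (M * norm h powr p)" .
    qed (use p in auto)
    finally show ?thesis .
  qed
  then show "\<exists>C\<ge>0. \<exists>\<delta>>0. \<forall>h. norm h < \<delta> \<longrightarrow>
     int_powr p K (\<lambda>x. f' (x + h) - f' x) \<le> ennreal (C * norm h powr p)"
    using M e(1) by (intro exI[of _ M] conjI exI[of _ "e / 2"]) auto
qed

lemma measurable_lebesgue_cong_AE:
  fixes u v :: "'a::euclidean_space \<Rightarrow> 'b::topological_space"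
  assumes eq: "AE x in lebesgue. u x = v x" and v: "v \<in> borel_measurable lebesgue"
  shows "u \<in> borel_measurable lebesgue"
proof (rule measurableI)
  fix A :: "'b set" assume A: "A \<in> sets borel"
  show "u -` A \<inter> space lebesgue \<in> sets lebesgue"
  proof (rule completion.in_sets_AE)
    show "v -` A \<inter> space lebesgue \<in> sets lebesgue" using v A by (rule measurable_sets)
    show "AE x in lebesgue. (x \<in> v -` A \<inter> space lebesgue) = (x \<in> u -` A \<inter> space lebesgue)"
      using eq by eventually_elim auto
  qed simp
qed simp

text \<open>Up to \<open>(\<eta>(x + h) - \<eta>(x)) f(x + h)\<close>, which is of order \<open>|h|\<close> and hence harmless for \<open>\<alpha> < 1\<close>, the
  difference of \<open>\<eta> f\<close> is \<open>\<eta>\<close> times the difference of \<open>f\<close>.\<close>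

lemma diff_bound_of_Besov_loc:
  fixes f :: "'a::euclidean_space \<Rightarrow> real"
  assumes \<Omega>: "open \<Omega>" and p: "p > 1" and \<alpha>: "0 < \<alpha>" "\<alpha> < 1"
    and f: "f \<in> Besov_loc \<alpha> p \<Omega>" and rep: "represents \<Omega> f f'" and f': "Lp_borel p f'"
  shows "diff_bound p (\<alpha> * p) \<Omega> f'"
proof (rule diff_boundI)
  fix K assume K: "compact K" "K \<subseteq> \<Omega>"
  obtain \<eta> c where \<eta>: "\<eta> \<in> test_functions \<Omega>" and c: "c > 0" "\<And>x. 0 \<le> \<eta> x" "\<And>x. x \<in> K \<Longrightarrow> c \<le> \<eta> x"
    using cutoff_exists[OF K(1) \<Omega> K(2)] by metis
  obtain L where L: "L > 0" "\<And>x h. \<bar>\<eta> (x + h) - \<eta> x\<bar> \<le> L * norm h" using test_function_lipschitz[OF \<eta>] by metis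
  have [measurable]: "\<eta> \<in> borel_measurable borel" "f' \<in> borel_measurable borel"
    using \<eta> f' by (auto intro: test_function_measurable Lp_borelD)
  define v where "v = (\<lambda>x. \<eta> x * f x)"
  define v' where "v' = (\<lambda>x. \<eta> x * f' x)"
  have v': "Lp_borel p v'" using Lp_borel_test_scale[OF \<eta> f'] p by (simp add: v'_def)
  have [measurable]: "v' \<in> borel_measurable borel" using v' by (rule Lp_borelD)
  have van: "x \<notin> \<Omega> \<Longrightarrow> \<eta> x = 0" for x using test_functionE[OF \<eta>] by (metis subsetD)
  have "AE x in lborel. x \<in> \<Omega> \<longrightarrow> f x = f' x" using rep by (simp add: represents_def)
  then have veq: "AE x in lborel. v x = v' x"
    by eventually_elim (use van in \<open>auto simp: v_def v'_def\<close>)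
  have "v \<in> Besov \<alpha> p" using f \<eta> by (auto simp: Besov_loc_def v_def)
  then obtain B0 where B0: "\<And>h. h \<noteq> 0 \<Longrightarrow>
      (\<integral>x. \<bar>v (x + h) - v x\<bar> powr p / norm h powr (\<alpha> * p) \<partial>lebesgue) powr (1 / p) \<le> B0"
    by (auto simp: Besov_def bdd_above_def)
  define B where "B = max B0 0"
  have bes: "(\<integral>\<^sup>+x. ennreal (norm (v' (x + h) - v' x) powr p) \<partial>lborel) \<le> ennreal (B powr p * norm h powr (\<alpha> * p))" for h
  proof (cases "h = 0")
    case False
    have eq: "AE x in lborel. \<bar>v (x + h) - v x\<bar> powr p / norm h powr (\<alpha> * p) = \<bar>v' (x + h) - v' x\<bar> powr p / norm h powr (\<alpha> * p)"
      using veq AE_translate[OF veq, of h] by eventually_elim simp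
    have m: "(\<lambda>x. \<bar>v' (x + h) - v' x\<bar> powr p / norm h powr (\<alpha> * p)) \<in> borel_measurable lborel" by measurable
    have eq': "(\<integral>x. \<bar>v (x + h) - v x\<bar> powr p / norm h powr (\<alpha> * p) \<partial>lebesgue)
       = (LBINT x. \<bar>v' (x + h) - v' x\<bar> powr p / norm h powr (\<alpha> * p))"
      by (rule trans[OF integral_cong_AE[OF measurable_lebesgue_cong_AE[OF AE_completion[OF eq] measurable_completion[OF m]]
          measurable_completion[OF m] AE_completion[OF eq]] integral_completion[OF m]])
    define J where "J = (LBINT x. \<bar>v' (x + h) - v' x\<bar> powr p)"
    have J: "J \<ge> 0" unfolding J_def by simp
    have hp: "norm h powr (\<alpha> * p) > 0" using False by simp
    have "(J / norm h powr (\<alpha> * p)) powr (1 / p) \<le> B"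
      using B0[OF False] unfolding eq' by (simp add: J_def B_def)
    then have "((J / norm h powr (\<alpha> * p)) powr (1 / p)) powr p \<le> B powr p"
      using p by (intro powr_mono2) auto
    then have "J / norm h powr (\<alpha> * p) \<le> B powr p" using J p by (simp add: powr_powr)
    then have "J \<le> B powr p * norm h powr (\<alpha> * p)" using hp by (simp add: divide_le_eq)
    moreover have "(\<integral>\<^sup>+x. ennreal (norm (v' (x + h) - v' x) powr p) \<partial>lborel) = ennreal J"
      using p nn_integral_Lp_borel[OF Lp_borel_diff[OF Lp_borel_translate[OF v'] v'], of h] by (simp add: J_def)
    ultimately show ?thesis by (simp add: ennreal_leI)
  qed simp
  define M where "M = (LBINT x. norm (f' x) powr p)"
  have M: "M \<ge> 0" unfolding M_def by simp
  define C where "C = (2 / c) powr p * (B powr p + L powr p * M)"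
  have C: "C \<ge> 0" unfolding C_def using M by auto
  have "int_powr p K (\<lambda>x. f' (x + h) - f' x) \<le> ennreal (C * norm h powr (\<alpha> * p))"
    if h: "norm h < 1" for h
  proof -
    have "int_powr p K (\<lambda>x. f' (x + h) - f' x)
      \<le> ennreal ((2 / c) powr p * (B powr p * norm h powr (\<alpha> * p)) + ((2 / c) powr p * (L * norm h) powr p) * M)"
    proof (rule nn_integral_bound_two)
      show "(\<integral>\<^sup>+x. ennreal (norm (v' (x + h) - v' x) powr p) \<partial>lborel) \<le> ennreal (B powr p * norm h powr (\<alpha> * p))" by (rule bes)
      show "(\<integral>\<^sup>+x. ennreal (norm (f' (x + h)) powr p) \<partial>lborel) \<le> ennreal M"
        using nn_integral_translate[of "\<lambda>x. ennreal (norm (f' x) powr p)" h] nn_integral_Lp_borel[OF f'] by (simp add: M_def)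
      fix x
      show "indicator K x * norm (f' (x + h) - f' x) powr p
        \<le> (2 / c) powr p * norm (v' (x + h) - v' x) powr p + (2 / c) powr p * (L * norm h) powr p * norm (f' (x + h)) powr p"
      proof (cases "x \<in> K")
        case True
        have "c * norm (f' (x + h) - f' x) \<le> \<eta> x * norm (f' (x + h) - f' x)"
          using c(3)[OF True] by (intro mult_right_mono) auto
        also have "\<dots> = norm (\<eta> x * (f' (x + h) - f' x))"
          using c(2)[of x] by (simp add: abs_mult)
        also have "\<eta> x * (f' (x + h) - f' x) = (v' (x + h) - v' x) - (\<eta> (x + h) - \<eta> x) * f' (x + h)"
          by (simp add: v'_def algebra_simps)
        finally have "(c * norm (f' (x + h) - f' x)) powr p \<le> norm ((v' (x + h) - v' x) - (\<eta> (x + h) - \<eta> x) * f' (x + h)) powr p"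
          using c p by (intro powr_mono2) auto
        also have "\<dots> \<le> 2 powr p * (norm (v' (x + h) - v' x) powr p + norm ((\<eta> (x + h) - \<eta> x) * f' (x + h)) powr p)"
          using p by (intro norm_diff_powr_le) auto
        also have "\<dots> \<le> 2 powr p * (norm (v' (x + h) - v' x) powr p + ((L * norm h) * norm (f' (x + h))) powr p)"
          using L(2)[of x h] p by (intro mult_left_mono add_left_mono powr_mono2) (auto simp: abs_mult intro!: mult_right_mono)
        finally have "c powr p * norm (f' (x + h) - f' x) powr p
            \<le> 2 powr p * (norm (v' (x + h) - v' x) powr p + (L * norm h) powr p * norm (f' (x + h)) powr p)"
          using c L by (simp add: powr_mult)
        then show ?thesis
          using True c(1) by (simp add: powr_divide field_simps)
      qed (auto intro!: add_nonneg_nonneg)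
    qed (use c L M in auto)
    also have "\<dots> \<le> ennreal (C * norm h powr (\<alpha> * p))"
    proof (rule ennreal_leI)
      have "norm h powr p \<le> norm h powr (\<alpha> * p)"
        using h \<alpha> p by (intro powr_mono') auto
      then have "L powr p * norm h powr p * M \<le> L powr p * norm h powr (\<alpha> * p) * M"
        using M by (intro mult_right_mono mult_left_mono) auto
      then have "(2 / c) powr p * (B powr p * norm h powr (\<alpha> * p) + L powr p * norm h powr p * M)
         \<le> (2 / c) powr p * (B powr p * norm h powr (\<alpha> * p) + L powr p * norm h powr (\<alpha> * p) * M)"
        by (intro mult_left_mono add_left_mono) auto
      then show "(2 / c) powr p * (B powr p * norm h powr (\<alpha> * p)) + (2 / c) powr p * (L * norm h) powr p * M \<le> C * norm h powr (\<alpha> * p)"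
        using L by (simp add: C_def powr_mult algebra_simps)
    qed
    finally show ?thesis .
  qed
  then show "\<exists>C\<ge>0. \<exists>\<delta>>0. \<forall>h. norm h < \<delta> \<longrightarrow>
     int_powr p K (\<lambda>x. f' (x + h) - f' x) \<le> ennreal (C * norm h powr (\<alpha> * p))"
    using C by (intro exI[of _ C] conjI exI[of _ 1]) auto
qed

section \<open>The energy density\<close>

definition flux_density :: "real \<Rightarrow> 'a::real_normed_vector \<Rightarrow> real" where
  "flux_density p a = (1 / p) * norm a powr p + norm a"

lemma flux_density_nonneg: "p > 0 \<Longrightarrow> flux_density p a \<ge> 0"
  by (simp add: flux_density_def)

lemma flux_density_0 [simp]: "flux_density p 0 = 0"
  by (simp add: flux_density_def)

lemma flux_density_convex:
  assumes "p > 1" "0 \<le> \<theta>" "\<theta> \<le> 1"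
  shows "flux_density p ((1 - \<theta>) *\<^sub>R a + \<theta> *\<^sub>R b) \<le> (1 - \<theta>) * flux_density p a + \<theta> * flux_density p b"
proof -
  have "norm ((1 - \<theta>) *\<^sub>R a + \<theta> *\<^sub>R b) \<le> (1 - \<theta>) * norm a + \<theta> * norm b"
    using assms by (intro order_trans[OF norm_triangle_ineq]) auto
  moreover have "(1 / p) * norm ((1 - \<theta>) *\<^sub>R a + \<theta> *\<^sub>R b) powr p \<le> (1 / p) * ((1 - \<theta>) * norm a powr p + \<theta> * norm b powr p)"
    using assms by (intro mult_left_mono norm_powr_convex) auto
  moreover have "(1 - \<theta>) * flux_density p a + \<theta> * flux_density p b
      = (1 / p) * ((1 - \<theta>) * norm a powr p + \<theta> * norm b powr p) + ((1 - \<theta>) * norm a + \<theta> * norm b)"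
    unfolding flux_density_def by (simp only: distrib_left mult.left_commute[of "1 / p"] add.assoc add.left_commute)
  ultimately show ?thesis unfolding flux_density_def[of p "(1 - \<theta>) *\<^sub>R a + \<theta> *\<^sub>R b"] by linarith
qed

lemma flux_density_le:
  assumes "p > 1"
  shows "flux_density p a \<le> 1 + 2 * norm a powr p"
proof -
  have "(1 / p) * norm a powr p \<le> 1 * norm a powr p"
    using assms by (intro mult_right_mono) auto
  then show ?thesis using le_one_plus_powr[of "norm a" p] assms by (simp add: flux_density_def)
qed

text \<open>A perturbation \<open>R\<close> of size \<open>\<rho>\<close> costs at most \<open>\<rho>\<close> times the density at a perturbation of size one:
  \<open>m + R\<close> is a convex combination of \<open>m\<close> and \<open>m + R/\<rho>\<close>.\<close>

lemma flux_density_perturb: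
  assumes "p > 1" "0 < \<rho>" "\<rho> \<le> 1"
  shows "flux_density p (m + R) \<le> flux_density p m + \<rho> * flux_density p (m + (1 / \<rho>) *\<^sub>R R)"
proof -
  have "m + R = (1 - \<rho>) *\<^sub>R m + \<rho> *\<^sub>R (m + (1 / \<rho>) *\<^sub>R R)"
    using assms by (simp add: algebra_simps)
  then have "flux_density p (m + R) \<le> (1 - \<rho>) * flux_density p m + \<rho> * flux_density p (m + (1 / \<rho>) *\<^sub>R R)"
    using flux_density_convex[of p \<rho> m "m + (1 / \<rho>) *\<^sub>R R"] assms by simp
  moreover have "(1 - \<rho>) * flux_density p m \<le> flux_density p m"
    using assms flux_density_nonneg[of p m] by (simp add: mult_left_le_one_le)
  ultimately show ?thesis by linarith
qed

lemma powr_superadditive: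
  fixes x y r :: real
  assumes "x \<ge> 0" "y \<ge> 0" "r \<ge> 1"
  shows "x powr r + y powr r \<le> (x + y) powr r"
proof (cases "x + y = 0")
  case False
  define s where "s = x + y"
  have s: "s > 0" using False assms by (simp add: s_def)
  have part: "z powr r \<le> (z / s) * s powr r" if "0 \<le> z" "z \<le> s" for z
  proof -
    have "(z / s) powr r \<le> (z / s) powr 1" using that s assms by (intro powr_mono') auto
    then have "(z / s) powr r * s powr r \<le> (z / s) * s powr r"
      using that s by (intro mult_right_mono) auto
    moreover have "(z / s) powr r * s powr r = z powr r"
      using that s by (simp add: powr_mult[symmetric])
    ultimately show ?thesis by linarith
  qed
  have "x powr r + y powr r \<le> (x / s) * s powr r + (y / s) * s powr r"
    using assms by (intro add_mono part) (auto simp: s_def)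
  also have "\<dots> = ((x + y) / s) * s powr r" by (simp add: add_divide_distrib algebra_simps)
  also have "\<dots> = s powr r" using s by (simp add: s_def)
  finally show ?thesis by (simp add: s_def)
qed (use assms in \<open>simp add: add_nonneg_eq_0_iff\<close>)

text \<open>The parallelogram identity, raised to the power \<open>p/2\<close>: superadditivity of the power bounds the left side and
  convexity bounds the right side.\<close>

lemma clarkson:
  fixes a b :: "'a::real_inner" and p :: real
  assumes "p > 2"
  shows "norm ((1 / 2) *\<^sub>R (a + b)) powr p + norm ((1 / 2) *\<^sub>R (a - b)) powr p \<le> (norm a powr p + norm b powr p) / 2"
proof -
  have sq: "norm c powr p = (norm c)\<^sup>2 powr (p / 2)" for c :: 'a
  proof -
    have "(norm c)\<^sup>2 = norm c powr 2" by simp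
    then show ?thesis by (simp only: powr_powr) simp
  qed
  have "(norm ((1 / 2) *\<^sub>R (a + b)))\<^sup>2 + (norm ((1 / 2) *\<^sub>R (a - b)))\<^sup>2 = (1 - 1/2) * (norm a)\<^sup>2 + (1/2) * (norm b)\<^sup>2"
    by (simp add: power2_norm_eq_inner inner_add_left inner_add_right inner_diff_left inner_diff_right field_simps)
  then have "norm ((1 / 2) *\<^sub>R (a + b)) powr p + norm ((1 / 2) *\<^sub>R (a - b)) powr p
      \<le> ((1 - 1/2) * (norm a)\<^sup>2 + (1/2) * (norm b)\<^sup>2) powr (p / 2)"
    unfolding sq using powr_superadditive[of "(norm ((1 / 2) *\<^sub>R (a + b)))\<^sup>2" "(norm ((1 / 2) *\<^sub>R (a - b)))\<^sup>2" "p / 2"] assms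
    by simp
  also have "\<dots> \<le> (1 - 1/2) * (norm a)\<^sup>2 powr (p / 2) + (1/2) * (norm b)\<^sup>2 powr (p / 2)"
    using assms by (intro powr_convex_combination) auto
  finally show ?thesis by (simp add: sq)
qed

lemma flux_density_midpoint:
  fixes a b :: "'a::real_inner"
  assumes "p > 2"
  shows "flux_density p ((1 / 2) *\<^sub>R (a + b)) + (1 / p) * norm ((1 / 2) *\<^sub>R (a - b)) powr p
     \<le> (flux_density p a + flux_density p b) / 2"
proof -
  have "norm ((1 / 2) *\<^sub>R (a + b)) \<le> (norm a + norm b) / 2"
    using norm_triangle_ineq[of a b] by simp
  moreover have "(1 / p) * (norm ((1 / 2) *\<^sub>R (a + b)) powr p + norm ((1 / 2) *\<^sub>R (a - b)) powr p)
     \<le> (1 / p) * ((norm a powr p + norm b powr p) / 2)"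
    using assms by (intro mult_left_mono clarkson) auto
  ultimately show ?thesis
    by (simp add: flux_density_def algebra_simps add_divide_distrib)
qed

text \<open>The argument is \<open>(1 - 2\<eta>) a + \<eta> (a + b)/2 + \<eta> (a + c)/2\<close>; the gain comes from the first of the two
  midpoints.\<close>

lemma flux_density_second_difference:
  fixes a b c :: "'a::real_inner"
  assumes p: "p > 2" and \<eta>: "0 \<le> \<eta>" "\<eta> \<le> 1 / 2"
  shows "flux_density p (a + (\<eta> / 2) *\<^sub>R ((b - a) + (c - a))) + \<eta> / p * norm ((1 / 2) *\<^sub>R (a - b)) powr p
    \<le> (1 - \<eta>) * flux_density p a + \<eta> / 2 * (flux_density p b + flux_density p c)"
proof -
  let ?H = "flux_density p"
  define m1 where "m1 = (1 / 2) *\<^sub>R (a + b)"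
  define m2 where "m2 = (1 / 2) *\<^sub>R (a + c)"
  have "a + (\<eta> / 2) *\<^sub>R ((b - a) + (c - a)) = (1 - 2 * \<eta>) *\<^sub>R a + (2 * \<eta>) *\<^sub>R ((1 - 1 / 2) *\<^sub>R m1 + (1 / 2) *\<^sub>R m2)"
    by (simp add: m1_def m2_def algebra_simps flip: scaleR_add_left)
  then have "?H (a + (\<eta> / 2) *\<^sub>R ((b - a) + (c - a))) \<le> (1 - 2 * \<eta>) * ?H a + (2 * \<eta>) * ?H ((1 - 1 / 2) *\<^sub>R m1 + (1 / 2) *\<^sub>R m2)"
    using flux_density_convex[of p "2 * \<eta>" a] p \<eta> by simp
  also have "\<dots> \<le> (1 - 2 * \<eta>) * ?H a + (2 * \<eta>) * ((1 - 1 / 2) * ?H m1 + (1 / 2) * ?H m2)"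
    using p \<eta> by (intro add_left_mono mult_left_mono flux_density_convex) auto
  finally have 1: "?H (a + (\<eta> / 2) *\<^sub>R ((b - a) + (c - a))) \<le> (1 - 2 * \<eta>) * ?H a + \<eta> * ?H m1 + \<eta> * ?H m2"
    by (simp add: algebra_simps)
  have "\<eta> * (?H m1 + (1 / p) * norm ((1 / 2) *\<^sub>R (a - b)) powr p) \<le> \<eta> * ((?H a + ?H b) / 2)"
    using \<eta> flux_density_midpoint[OF p, of a b] by (intro mult_left_mono) (auto simp: m1_def)
  moreover have "?H m2 \<le> (?H a + ?H c) / 2"
    using flux_density_midpoint[OF p, of a c] p by (auto simp: m2_def intro: order_trans[rotated])
  then have "\<eta> * ?H m2 \<le> \<eta> * ((?H a + ?H c) / 2)" using \<eta> by (intro mult_left_mono)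
  ultimately show ?thesis using 1 by (simp add: algebra_simps add_divide_distrib)
qed

section \<open>The minimizer has Besov differences\<close>

lemma Lp_borel_scaleR_right:
  fixes u :: "'a::euclidean_space \<Rightarrow> real" and v :: "'b::euclidean_space"
  assumes "Lp_borel p u"
  shows "Lp_borel p (\<lambda>x. u x *\<^sub>R v)"
proof (rule Lp_borel_bound[where g = "\<lambda>x. norm v powr p * norm (u x) powr p"])
  show "norm (u x *\<^sub>R v) powr p \<le> norm v powr p * norm (u x) powr p" for x
    by (simp add: powr_mult)
qed (use assms in \<open>auto simp: Lp_borel_def\<close>)

lemma Lp_borel_inner_grad:
  fixes u :: "'a::euclidean_space \<Rightarrow> 'a"
  assumes "\<eta> \<in> test_functions \<Omega>" "Lp_borel p u" "p > 0"
  shows "Lp_borel p (\<lambda>x. u x \<bullet> grad \<eta> x)"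
proof -
  obtain B where B: "\<And>x. norm (grad \<eta> x) \<le> B" using test_function_grad_bounded[OF assms(1)] by metis
  have [measurable]: "u \<in> borel_measurable borel" "grad \<eta> \<in> borel_measurable borel"
    using assms grad_measurable by (auto intro: Lp_borelD)
  show ?thesis
  proof (rule Lp_borel_bound[where g = "\<lambda>x. B powr p * norm (u x) powr p"])
    fix x
    have "norm (u x \<bullet> grad \<eta> x) \<le> norm (u x) * norm (grad \<eta> x)"
      by (rule Cauchy_Schwarz_ineq2[folded real_norm_def])
    also have "\<dots> \<le> norm (u x) * B" using B by (intro mult_left_mono) auto
    finally have "norm (u x \<bullet> grad \<eta> x) powr p \<le> (norm (u x) * B) powr p"
      using assms by (intro powr_mono2) auto
    moreover have "B \<ge> 0" using B[of 0] norm_ge_zero[of "grad \<eta> 0"] by linarith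
    ultimately show "norm (u x \<bullet> grad \<eta> x) powr p \<le> B powr p * norm (u x) powr p"
      by (simp add: powr_mult mult.commute)
  qed (use assms in \<open>auto simp: Lp_borel_def\<close>)
qed

lemma Lp_borel_local_shift:
  assumes \<sigma>: "Lp_borel p \<sigma>" and f: "Lp_borel p f" and p: "p > 1" and \<eta>: "\<eta> \<in> test_functions \<Omega>"
  shows "Lp_borel p (local_shift \<eta> h f \<sigma>)"
proof -
  have p0: "p > 0" using p by simp
  have F: "Lp_borel p (seg_avg h f)" and S: "Lp_borel p (seg_avg h \<sigma>)"
    using Lp_borel_seg_avg[OF f p] Lp_borel_seg_avg[OF \<sigma> p] .
  have "Lp_borel p (\<lambda>x. \<eta> x * seg_avg h f x)" using Lp_borel_test_scale[OF \<eta> F p0] by simp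
  then show ?thesis unfolding local_shift_def[abs_def]
    by (intro Lp_borel_add Lp_borel_diff Lp_borel_scaleR_right Lp_borel_test_scale[OF \<eta>]
        Lp_borel_test_scale[OF test_function_partial_deriv[OF \<eta>]] Lp_borel_inner_grad[OF \<eta>] Lp_borel_translate \<sigma> S p0)
qed

lemma integrable_flux_density:
  fixes u :: "'a::euclidean_space \<Rightarrow> 'b::euclidean_space"
  assumes u: "Lp_borel p u" and \<Omega>: "\<Omega> \<in> sets borel" "bounded \<Omega>" and van: "\<And>x. x \<notin> \<Omega> \<Longrightarrow> u x = 0" and p: "p > 1"
  shows "integrable lborel (\<lambda>x. flux_density p (u x))"
proof (rule Bochner_Integration.integrable_bound)
  have [measurable]: "u \<in> borel_measurable borel" using u by (rule Lp_borelD)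
  show "(\<lambda>x. flux_density p (u x)) \<in> borel_measurable lborel" unfolding flux_density_def by measurable
  show "integrable lborel (\<lambda>x. indicator \<Omega> x + 2 * norm (u x) powr p)"
    using \<Omega> u by (intro Bochner_Integration.integrable_add integrable_real_indicator
        emeasure_bounded_finite integrable_mult_right Lp_borel_integrable) auto
  show "AE x in lborel. norm (flux_density p (u x)) \<le> norm (indicator \<Omega> x + 2 * norm (u x) powr p)"
  proof (rule AE_I2)
    fix x
    show "norm (flux_density p (u x)) \<le> norm (indicator \<Omega> x + 2 * norm (u x) powr p)"
      using flux_density_le[OF p, of "u x"] flux_density_nonneg[of p "u x"] van[of x] p
      by (cases "x \<in> \<Omega>") auto
  qed
qed

lemma seg_avg_diff_bound:
  assumes u: "Lp_borel p u" and L: "L \<in> sets borel" and p: "p > 1" and C: "C \<ge> 0" "t \<ge> 0"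
    and bound: "\<And>h. norm h < \<delta> \<Longrightarrow>
      int_powr p L (\<lambda>x. u (x + h) - u x) \<le> ennreal (C * norm h powr t)"
    and h: "norm h < \<delta>"
  shows "int_powr p L (\<lambda>x. seg_avg h u x - u x) \<le> ennreal (C * norm h powr t)"
proof (rule seg_avg_minus_self_powr_le[OF u L p])
  fix s :: real assume s: "s \<in> {0..1}"
  have le: "norm (s *\<^sub>R h) \<le> norm h" using s by (simp add: mult_left_le_one_le)
  have "int_powr p L (\<lambda>x. u (x + s *\<^sub>R h) - u x) \<le> ennreal (C * norm (s *\<^sub>R h) powr t)"
    using le h by (intro bound) auto
  also have "\<dots> \<le> ennreal (C * norm h powr t)"
    using le C by (intro ennreal_leI mult_left_mono powr_mono2) auto
  finally show "int_powr p L (\<lambda>x. u (x + s *\<^sub>R h) - u x) \<le> ennreal (C * norm h powr t)" .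
qed

text \<open>What remains of the two corrections in the mean of the local shifts by \<open>h\<close> and \<open>-h\<close>
  (\<open>local_shift_symmetrized\<close>).\<close>

definition shift_remainder ::
    "('a::euclidean_space \<Rightarrow> real) \<Rightarrow> 'a \<Rightarrow> ('a \<Rightarrow> real) \<Rightarrow> ('a \<Rightarrow> 'a) \<Rightarrow> 'a \<Rightarrow> 'a" where
  "shift_remainder \<eta> h f \<sigma> x = (1 / 2) *\<^sub>R
     ((\<eta> x * (seg_avg h f x - seg_avg (- h) f x)) *\<^sub>R h
      + (partial_deriv h \<eta> x *\<^sub>R (seg_avg h \<sigma> x - seg_avg (- h) \<sigma> x)
         - ((seg_avg h \<sigma> x - seg_avg (- h) \<sigma> x) \<bullet> grad \<eta> x) *\<^sub>R h))"

lemma local_shift_symmetrized: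
  assumes "smooth \<eta>"
  shows "(1 / 2) *\<^sub>R (local_shift \<eta> h f \<sigma> x + local_shift \<eta> (- h) f \<sigma> x)
    = (\<eta> x / 2) *\<^sub>R ((\<sigma> (x + h) - \<sigma> x) + (\<sigma> (x - h) - \<sigma> x)) + shift_remainder \<eta> h f \<sigma> x"
proof -
  have "partial_deriv (- h) \<eta> x = - partial_deriv h \<eta> x"
    using grad_inner[OF assms, of x h] grad_inner[OF assms, of x "- h"] by simp
  then show ?thesis
    by (simp add: local_shift_def shift_remainder_def algebra_simps inner_diff_left flip: scaleR_add_left)
qed

lemma shift_remainder_powr_le:
  fixes \<sigma> :: "'a::euclidean_space \<Rightarrow> 'a"
  assumes \<eta>: "smooth \<eta>" "0 \<le> \<eta> x" "\<eta> x \<le> 1" and B: "norm (grad \<eta> x) \<le> B" and p: "p > 0"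
  shows "norm (shift_remainder \<eta> h f \<sigma> x) powr p \<le> (4 * norm h) powr p *
     ((norm (seg_avg h f x - f x) powr p + norm (seg_avg (- h) f x - f x) powr p)
     + B powr p * (norm (seg_avg h \<sigma> x - \<sigma> x) powr p + norm (seg_avg (- h) \<sigma> x - \<sigma> x) powr p))"
proof -
  define a where "a = norm (seg_avg h f x - seg_avg (- h) f x)"
  define b where "b = norm (seg_avg h \<sigma> x - seg_avg (- h) \<sigma> x)"
  have B0: "B \<ge> 0" using B norm_ge_zero[of "grad \<eta> x"] by linarith
  have 1: "norm ((\<eta> x * (seg_avg h f x - seg_avg (- h) f x)) *\<^sub>R h) \<le> a * norm h"
    using \<eta> unfolding a_def by (auto simp: abs_mult intro!: mult_right_mono mult_left_le_one_le)
  have "\<bar>partial_deriv h \<eta> x\<bar> \<le> B * norm h"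
    using Cauchy_Schwarz_ineq2[of "grad \<eta> x" h] B mult_right_mono[OF B, of "norm h"]
    by (simp add: grad_inner[OF \<eta>(1)])
  then have 2: "norm (partial_deriv h \<eta> x *\<^sub>R (seg_avg h \<sigma> x - seg_avg (- h) \<sigma> x)) \<le> B * b * norm h"
    unfolding b_def using mult_right_mono[of "\<bar>partial_deriv h \<eta> x\<bar>" "B * norm h" "norm (seg_avg h \<sigma> x - seg_avg (- h) \<sigma> x)"]
    by (simp add: mult.commute mult.left_commute)
  have "\<bar>(seg_avg h \<sigma> x - seg_avg (- h) \<sigma> x) \<bullet> grad \<eta> x\<bar> \<le> b * B"
    unfolding b_def using Cauchy_Schwarz_ineq2[of "seg_avg h \<sigma> x - seg_avg (- h) \<sigma> x" "grad \<eta> x"] mult_left_mono[OF B norm_ge_zero, of "seg_avg h \<sigma> x - seg_avg (- h) \<sigma> x"]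
    by linarith
  then have 3: "norm (((seg_avg h \<sigma> x - seg_avg (- h) \<sigma> x) \<bullet> grad \<eta> x) *\<^sub>R h) \<le> B * b * norm h"
    using mult_right_mono[of "\<bar>(seg_avg h \<sigma> x - seg_avg (- h) \<sigma> x) \<bullet> grad \<eta> x\<bar>" "b * B" "norm h"] by (simp add: mult.commute)
  have "norm (shift_remainder \<eta> h f \<sigma> x) \<le> (1 / 2) * (a * norm h + (B * b * norm h + B * b * norm h))"
    unfolding shift_remainder_def norm_scaleR
    by (intro mult_mono order_trans[OF norm_triangle_ineq] order_trans[OF norm_triangle_ineq4] add_mono 1 2 3) auto
  also have "\<dots> \<le> norm h * (a + B * b)"
    using norm_ge_zero[of "seg_avg h f x - seg_avg (- h) f x"] by (simp add: algebra_simps a_def)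
  finally have "norm (shift_remainder \<eta> h f \<sigma> x) powr p \<le> (norm h * (a + B * b)) powr p"
    using p by (intro powr_mono2) auto
  also have "\<dots> = norm h powr p * norm (a + B * b) powr p"
    using B0 by (simp add: powr_mult a_def b_def)
  also have "\<dots> \<le> norm h powr p * (2 powr p * (norm a powr p + norm (B * b) powr p))"
    using p by (intro mult_left_mono norm_add_powr_le) auto
  also have "\<dots> = (2 * norm h) powr p * (a powr p + B powr p * b powr p)"
    using B0 by (simp add: powr_mult a_def b_def)
  also have "\<dots> \<le> (2 * norm h) powr p * (2 powr p * (norm (seg_avg h f x - f x) powr p + norm (seg_avg (- h) f x - f x) powr p)
     + B powr p * (2 powr p * (norm (seg_avg h \<sigma> x - \<sigma> x) powr p + norm (seg_avg (- h) \<sigma> x - \<sigma> x) powr p)))"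
  proof (intro mult_left_mono add_mono)
    show "a powr p \<le> 2 powr p * (norm (seg_avg h f x - f x) powr p + norm (seg_avg (- h) f x - f x) powr p)"
      unfolding a_def using norm_diff_powr_le[OF p, of "seg_avg h f x - f x" "seg_avg (- h) f x - f x"] by simp
    show "b powr p \<le> 2 powr p * (norm (seg_avg h \<sigma> x - \<sigma> x) powr p + norm (seg_avg (- h) \<sigma> x - \<sigma> x) powr p)"
      unfolding b_def using norm_diff_powr_le[OF p, of "seg_avg h \<sigma> x - \<sigma> x" "seg_avg (- h) \<sigma> x - \<sigma> x"] by simp
  qed auto
  also have "\<dots> = (2 * (2 * norm h)) powr p * ((norm (seg_avg h f x - f x) powr p + norm (seg_avg (- h) f x - f x) powr p)
     + B powr p * (norm (seg_avg h \<sigma> x - \<sigma> x) powr p + norm (seg_avg (- h) \<sigma> x - \<sigma> x) powr p))"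
    unfolding powr_mult[of 2 "2 * norm h"] by (simp add: algebra_simps)
  finally show ?thesis by simp
qed

text \<open>Each average differs from the value at \<open>x\<close> as little as the translates do, so the explicit factor \<open>h\<close>
  raises the orders \<open>\<alpha>\<close> and \<open>t/p\<close> of the differences of \<open>f\<close> and \<open>\<sigma>\<close> by one.\<close>

lemma shift_remainder_integral_le:
  fixes \<sigma> :: "'a::euclidean_space \<Rightarrow> 'a"
  assumes \<sigma>: "Lp_borel p \<sigma>" and f: "Lp_borel p f" and p: "p > 1" and L: "L \<in> sets borel"
    and \<eta>: "smooth \<eta>" "\<And>x. 0 \<le> \<eta> x" "\<And>x. \<eta> x \<le> 1" and B: "B \<ge> 0" "\<And>x. norm (grad \<eta> x) \<le> B"
    and t: "t \<ge> 0" and \<alpha>: "\<alpha> \<ge> 0" and C: "C1 \<ge> 0" "C2 \<ge> 0"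
    and df: "\<And>h. norm h < \<delta> \<Longrightarrow>
      int_powr p L (\<lambda>x. f (x + h) - f x) \<le> ennreal (C1 * norm h powr (\<alpha> * p))"
    and d\<sigma>: "\<And>h. norm h < \<delta> \<Longrightarrow>
      int_powr p L (\<lambda>x. \<sigma> (x + h) - \<sigma> x) \<le> ennreal (C2 * norm h powr t)"
    and h: "norm h < \<delta>" "norm h \<le> 1"
  shows "int_powr p L (\<lambda>x. shift_remainder \<eta> h f \<sigma> x)
     \<le> ennreal (2 * 4 powr p * (C1 + B powr p * C2) * (norm h powr min (1 + \<alpha>) (1 + t / p)) powr p)"
proof -
  have [measurable]: "\<sigma> \<in> borel_measurable borel" "f \<in> borel_measurable borel" "L \<in> sets borel"
    using \<sigma> f L by (auto intro: Lp_borelD)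
  have neg: "norm (- h) < \<delta>" using h by simp
  let ?f = "\<lambda>h x. indicator L x * norm (seg_avg h f x - f x) powr p"
  let ?s = "\<lambda>h x. indicator L x * norm (seg_avg h \<sigma> x - \<sigma> x) powr p"
  have F: "(\<integral>\<^sup>+x. ennreal (?f h x + ?f (- h) x) \<partial>lborel) \<le> ennreal (1 * (C1 * norm h powr (\<alpha> * p)) + 1 * (C1 * norm h powr (\<alpha> * p)))"
    using seg_avg_diff_bound[OF f L p C(1) _ df h(1)] seg_avg_diff_bound[OF f L p C(1) _ df neg] \<alpha> p C
    by (intro nn_integral_bound_two[where u = "?f h" and v = "?f (- h)"]) auto
  have S: "(\<integral>\<^sup>+x. ennreal (?s h x + ?s (- h) x) \<partial>lborel) \<le> ennreal (1 * (C2 * norm h powr t) + 1 * (C2 * norm h powr t))"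
    using seg_avg_diff_bound[OF \<sigma> L p C(2) t d\<sigma> h(1)] seg_avg_diff_bound[OF \<sigma> L p C(2) t d\<sigma> neg] C
    by (intro nn_integral_bound_two[where u = "?s h" and v = "?s (- h)"]) auto
  have "int_powr p L (\<lambda>x. shift_remainder \<eta> h f \<sigma> x)
     \<le> ennreal ((4 * norm h) powr p * (1 * (C1 * norm h powr (\<alpha> * p)) + 1 * (C1 * norm h powr (\<alpha> * p)))
        + ((4 * norm h) powr p * B powr p) * (1 * (C2 * norm h powr t) + 1 * (C2 * norm h powr t)))"
  proof (rule nn_integral_bound_two[OF _ _ _ _ _ _ _ _ _ F S])
    fix x
    show "indicator L x * norm (shift_remainder \<eta> h f \<sigma> x) powr p
       \<le> (4 * norm h) powr p * (?f h x + ?f (- h) x) + (4 * norm h) powr p * B powr p * (?s h x + ?s (- h) x)"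
      using shift_remainder_powr_le[OF \<eta>(1) \<eta>(2,3)[of x] B(2)[of x], of p h f \<sigma>] p
      by (cases "x \<in> L") (auto simp: algebra_simps)
  qed (use C in auto)
  also have "\<dots> \<le> ennreal (2 * 4 powr p * (C1 + B powr p * C2) * (norm h powr min (1 + \<alpha>) (1 + t / p)) powr p)"
  proof (rule ennreal_leI)
    let ?\<theta> = "min (1 + \<alpha>) (1 + t / p)"
    have "norm h powr p * norm h powr (\<alpha> * p) \<le> (norm h powr ?\<theta>) powr p"
    proof -
      have "?\<theta> * p \<le> (1 + \<alpha>) * p" using p by (intro mult_right_mono) auto
      then have "norm h powr (p + \<alpha> * p) \<le> norm h powr (?\<theta> * p)"
        using h p by (intro powr_mono') (auto simp: algebra_simps)
      then show ?thesis by (simp add: powr_add powr_powr)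
    qed
    then have 1: "C1 * (norm h powr p * norm h powr (\<alpha> * p)) \<le> C1 * (norm h powr ?\<theta>) powr p"
      using C by (intro mult_left_mono)
    have "norm h powr p * norm h powr t \<le> (norm h powr ?\<theta>) powr p"
    proof -
      have "?\<theta> * p \<le> (1 + t / p) * p" using p by (intro mult_right_mono) auto
      also have "\<dots> = p + t" using p by (simp add: algebra_simps)
      finally have "norm h powr (p + t) \<le> norm h powr (?\<theta> * p)"
        using h p by (intro powr_mono') (auto simp: algebra_simps)
      then show ?thesis by (simp add: powr_add powr_powr)
    qed
    then have 2: "B powr p * C2 * (norm h powr p * norm h powr t) \<le> B powr p * C2 * (norm h powr ?\<theta>) powr p"
      using C by (intro mult_left_mono) auto
    have "2 * 4 powr p * (C1 * (norm h powr p * norm h powr (\<alpha> * p)) + B powr p * C2 * (norm h powr p * norm h powr t))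
       \<le> 2 * 4 powr p * (C1 * (norm h powr ?\<theta>) powr p + B powr p * C2 * (norm h powr ?\<theta>) powr p)"
      by (intro mult_left_mono add_mono 1 2) auto
    then show "(4 * norm h) powr p * (1 * (C1 * norm h powr (\<alpha> * p)) + 1 * (C1 * norm h powr (\<alpha> * p)))
        + ((4 * norm h) powr p * B powr p) * (1 * (C2 * norm h powr t) + 1 * (C2 * norm h powr t))
       \<le> 2 * 4 powr p * (C1 + B powr p * C2) * (norm h powr ?\<theta>) powr p"
      by (simp add: powr_mult algebra_simps)
  qed
  finally show ?thesis .
qed

text \<open>The minimization problem in terms of Borel functions that vanish off \<open>\<Omega>\<close>.\<close>

locale flux_minimizer =
  fixes \<Omega> :: "'a::euclidean_space set" and p q :: real and f :: "'a \<Rightarrow> real" and \<sigma> :: "'a \<Rightarrow> 'a"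
  assumes \<Omega>: "open \<Omega>" "bounded \<Omega>"
    and p: "p > 2" and q: "q > 1" "1 / p + 1 / q = 1"
    and \<sigma>: "Lp_borel p \<sigma>" "\<And>x. x \<notin> \<Omega> \<Longrightarrow> \<sigma> x = 0" and f: "Lp_borel p f"
    and neu: "borel_neumann q \<Omega> f \<sigma>"
    and min: "\<And>\<tau>. Lp_borel p \<tau> \<Longrightarrow> (\<And>x. x \<notin> \<Omega> \<Longrightarrow> \<tau> x = 0) \<Longrightarrow> borel_neumann q \<Omega> f \<tau> \<Longrightarrow>
        (LBINT x. flux_density p (\<sigma> x)) \<le> (LBINT x. flux_density p (\<tau> x))"
begin

text \<open>The competitor is \<open>\<sigma>\<close> plus the mean of the local shifts by \<open>h\<close> and \<open>-h\<close>, that is \<open>m + R\<close>, where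
  \<open>m\<close> contains the localized second difference of \<open>\<sigma>\<close> and \<open>R\<close> is the remainder. The convexity gain at
  \<open>m\<close> is paid for by two terms: the energy exchanged between translates, which is quadratic in \<open>h\<close> after a
  change of variables, and the cost of \<open>R\<close>, which is proportional to its size \<open>\<rho>\<close>.\<close>

lemma minimizer_difference_estimate:
  assumes \<eta>: "\<eta> \<in> test_functions \<Omega>" "\<And>x. 0 \<le> \<eta> x" "\<And>x. \<eta> x \<le> 1 / 2"
    and L: "compact L" "L \<subseteq> \<Omega>" "\<And>x. x \<notin> L \<Longrightarrow> \<eta> x = 0"
    and B2: "\<And>x h. \<bar>\<eta> (x + h) + \<eta> (x - h) - 2 * \<eta> x\<bar> \<le> B2 * (norm h)\<^sup>2"
    and \<rho>: "0 < \<rho>" "\<rho> \<le> 1" and CR: "CR \<ge> 0"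
    and R: "int_powr p L (\<lambda>x. shift_remainder \<eta> h f \<sigma> x) \<le> ennreal (CR * \<rho> powr p)"
  defines "E \<equiv> (LBINT x. flux_density p (\<sigma> x))"
    and "M \<equiv> (LBINT x. norm (\<sigma> x) powr p)"
  shows "(LBINT x. \<eta> x * norm (\<sigma> (x + h) - \<sigma> x) powr p)
     \<le> p * 2 powr p * (B2 * (norm h)\<^sup>2 * E + \<rho> * (measure lborel L + 2 * 2 powr p * (3 * M + CR)))"
    and "integrable lborel (\<lambda>x. \<eta> x * norm (\<sigma> (x + h) - \<sigma> x) powr p)"
proof -
  let ?H = "flux_density p"
  have p1: "p > 1" "p > 0" using p by auto
  have sm: "smooth \<eta>" by (rule test_function_smooth[OF \<eta>(1)])
  have [measurable]: "\<sigma> \<in> borel_measurable borel" "f \<in> borel_measurable borel" "\<eta> \<in> borel_measurable borel"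
    using \<sigma> f \<eta> by (auto intro: Lp_borelD test_function_measurable)
  have [measurable]: "L \<in> sets borel" using L(1) by (rule borel_compact)
  have Hm [measurable]: "(\<lambda>x. ?H (u x)) \<in> borel_measurable borel" if "u \<in> borel_measurable borel" for u :: "'a \<Rightarrow> 'a"
    using that unfolding flux_density_def by measurable
  have b\<Omega>: "\<Omega> \<in> sets borel" using \<Omega>(1) by auto
  have D\<eta>: "partial_deriv v \<eta> x = 0" "grad \<eta> x = 0" if "x \<notin> L" for v x
    using partial_deriv_outside_support[OF compact_imp_closed[OF L(1)] L(3) that] by (auto simp: grad_def)
  define R where "R = shift_remainder \<eta> h f \<sigma>"
  define m where "m = (\<lambda>x. \<sigma> x + (\<eta> x / 2) *\<^sub>R ((\<sigma> (x + h) - \<sigma> x) + (\<sigma> (x - h) - \<sigma> x)))"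
  define \<tau> where "\<tau> = (\<lambda>x. \<sigma> x + (1 / 2) *\<^sub>R (local_shift \<eta> h f \<sigma> x + local_shift \<eta> (- h) f \<sigma> x))"
  have \<tau>_eq: "\<tau> x = m x + R x" for x
    unfolding \<tau>_def m_def R_def local_shift_symmetrized[OF sm] by simp
  have Roff: "R x = 0" if "x \<notin> L" for x
    using that L(3) D\<eta> by (simp add: R_def shift_remainder_def)
  have moff: "m x = \<sigma> x" if "x \<notin> L" for x
    using that L(3) by (simp add: m_def)
  have sh: "Lp_borel p (local_shift \<eta> h f \<sigma>)" "Lp_borel p (local_shift \<eta> (- h) f \<sigma>)"
    by (intro Lp_borel_local_shift[OF \<sigma>(1) f p1(1) \<eta>(1)])+
  have \<tau>: "Lp_borel p \<tau>" unfolding \<tau>_def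
    using p1 by (intro Lp_borel_add Lp_borel_cmult \<sigma> sh) auto
  have \<tau>off: "\<tau> x = 0" if "x \<notin> \<Omega>" for x
  proof -
    have "x \<notin> L" using that L(2) by blast
    then show ?thesis using Roff moff \<sigma>(2)[OF that] by (simp add: \<tau>_eq)
  qed
  have "borel_neumann q \<Omega> f \<tau>"
    unfolding borel_neumann_def
  proof (intro allI impI)
    fix w G assume wg: "borel_weak_grad q \<Omega> w G"
    then have G: "Lp_borel q G" by (simp add: borel_weak_grad_def)
    note z = local_shift_div_free[OF \<sigma>(1) f p1(1) q neu \<eta>(1) wg]
    have "(LBINT x. \<tau> x \<bullet> G x) = (LBINT x. \<sigma> x \<bullet> G x + (1 / 2) * (local_shift \<eta> h f \<sigma> x \<bullet> G x + local_shift \<eta> (- h) f \<sigma> x \<bullet> G x))"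
      by (simp add: \<tau>_def inner_add_left)
    also have "\<dots> = (LBINT x. \<sigma> x \<bullet> G x)
       + (1 / 2) * ((LBINT x. local_shift \<eta> h f \<sigma> x \<bullet> G x) + (LBINT x. local_shift \<eta> (- h) f \<sigma> x \<bullet> G x))"
      by (simp only: integral_linear z(2) Lp_borel_integrable_inner[OF \<sigma>(1) G p1(1) q])
    also have "\<dots> = (LBINT x. f x * w x)"
      using neu wg z(1) by (simp add: borel_neumann_def)
    finally show "(LBINT x. \<tau> x \<bullet> G x) = (LBINT x. f x * w x)" .
  qed
  then have le: "E \<le> (LBINT x. ?H (\<tau> x))" unfolding E_def by (intro min \<tau> \<tau>off)

  \<comment> \<open>Cost of the remainder, convexity gain and exchanged energy.\<close>
  define P where "P = (\<lambda>x. \<rho> * (indicator L x * ?H (m x + (1 / \<rho>) *\<^sub>R R x)))"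
  define D where "D = (\<lambda>x. \<eta> x / p * norm ((1 / 2) *\<^sub>R (\<sigma> x - \<sigma> (x + h))) powr p)"
  define Q where "Q = (\<lambda>x. \<eta> x / 2 * (?H (\<sigma> (x + h)) + ?H (\<sigma> (x - h))) - \<eta> x * ?H (\<sigma> x))"
  have pw: "?H (\<tau> x) + D x \<le> ?H (\<sigma> x) + Q x + P x" for x
  proof (cases "x \<in> L")
    case True
    have "?H (\<tau> x) \<le> ?H (m x) + P x"
      using flux_density_perturb[OF p1(1) \<rho>, of "m x" "R x"] True by (simp add: \<tau>_eq P_def)
    moreover have "?H (m x) + D x \<le> (1 - \<eta> x) * ?H (\<sigma> x) + \<eta> x / 2 * (?H (\<sigma> (x + h)) + ?H (\<sigma> (x - h)))"
      unfolding m_def D_def by (rule flux_density_second_difference[OF p \<eta>(2,3)])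
    ultimately show ?thesis by (simp add: Q_def left_diff_distrib)
  next
    case False
    then show ?thesis using Roff moff L(3) by (simp add: \<tau>_eq D_def Q_def P_def)
  qed
  have iH: "integrable lborel (\<lambda>x. ?H (\<sigma> x))" by (rule integrable_flux_density[OF \<sigma>(1) b\<Omega> \<Omega>(2) \<sigma>(2) p1(1)])
  have iHt: "integrable lborel (\<lambda>x. ?H (\<tau> x))" by (rule integrable_flux_density[OF \<tau> b\<Omega> \<Omega>(2) \<tau>off p1(1)])
  have iHs: "integrable lborel (\<lambda>x. ?H (\<sigma> (x + k)))" for k
    using integrable_translate[OF _ iH, of k] by simp
  have \<eta>b: "norm (\<eta> x) \<le> 1" for x using \<eta>(2,3)[of x] by simp
  have i\<eta>: "integrable lborel (\<lambda>x. \<eta> x * g x)" if "integrable lborel g" for g :: "'a \<Rightarrow> real"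
  proof (rule Bochner_Integration.integrable_bound[OF that])
    show "AE x in lborel. norm (\<eta> x * g x) \<le> norm (g x)"
      using \<eta>b by (intro AE_I2) (auto simp: abs_mult intro!: mult_left_le_one_le)
  qed (use that in measurable)
  have iQ: "integrable lborel Q"
  proof -
    have "Q = (\<lambda>x. (1 / 2) * (\<eta> x * ?H (\<sigma> (x + h))) + (1 / 2) * (\<eta> x * ?H (\<sigma> (x + (- h)))) - \<eta> x * ?H (\<sigma> x))"
      by (auto simp: Q_def algebra_simps)
    then show ?thesis
      using i\<eta>[OF iHs[of h]] i\<eta>[OF iHs[of "- h"]] i\<eta>[OF iH] by simp
  qed
  have iD': "integrable lborel (\<lambda>x. norm (\<sigma> (x + h) - \<sigma> x) powr p)"
    using p1 by (intro Lp_borel_integrable Lp_borel_diff Lp_borel_translate \<sigma>) auto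
  show iD0: "integrable lborel (\<lambda>x. \<eta> x * norm (\<sigma> (x + h) - \<sigma> x) powr p)" by (rule i\<eta>[OF iD'])
  have Deq: "D x = (1 / (p * 2 powr p)) * (\<eta> x * norm (\<sigma> (x + h) - \<sigma> x) powr p)" for x
  proof -
    have "norm ((1 / 2) *\<^sub>R (\<sigma> x - \<sigma> (x + h))) = norm (\<sigma> (x + h) - \<sigma> x) / 2"
      by (simp only: norm_scaleR norm_minus_commute[of "\<sigma> x"])
    then show ?thesis unfolding D_def by (simp only: powr_divide) simp
  qed
  have iD: "integrable lborel D" unfolding Deq[abs_def] by (rule integrable_mult_right[OF iD0])

  have mL: "Lp_borel p m"
  proof -
    have s: "Lp_borel p (\<lambda>x. (\<sigma> (x + h) - \<sigma> x) + (\<sigma> (x - h) - \<sigma> x))"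
      using p1 Lp_borel_translate[OF \<sigma>(1), of "- h"] by (intro Lp_borel_add Lp_borel_diff Lp_borel_translate \<sigma>) auto
    have half: "\<bar>\<eta> x / 2\<bar> \<le> 1" for x using \<eta>(2,3)[of x] by simp
    show ?thesis unfolding m_def
      by (intro Lp_borel_add Lp_borel_scale[OF s _ half] \<sigma> p1) measurable
  qed
  have RL: "Lp_borel p R"
  proof -
    have "R = (\<lambda>x. \<tau> x - m x)" using \<tau>_eq by auto
    then show ?thesis using Lp_borel_diff[OF \<tau> mL p1(2)] by simp
  qed
  have [measurable]: "m \<in> borel_measurable borel" "R \<in> borel_measurable borel" "\<tau> \<in> borel_measurable borel"
    using mL RL \<tau> by (auto intro: Lp_borelD)
  have mp: "norm (m x) powr p \<le> norm (\<sigma> x) powr p + norm (\<sigma> (x + h)) powr p + norm (\<sigma> (x - h)) powr p" for x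
  proof -
    have "m x = (1 - \<eta> x) *\<^sub>R \<sigma> x + \<eta> x *\<^sub>R ((1 - 1 / 2) *\<^sub>R \<sigma> (x + h) + (1 / 2) *\<^sub>R \<sigma> (x - h))"
      by (simp add: m_def algebra_simps flip: scaleR_add_left)
    then have "norm (m x) powr p \<le> (1 - \<eta> x) * norm (\<sigma> x) powr p + \<eta> x * norm ((1 - 1 / 2) *\<^sub>R \<sigma> (x + h) + (1 / 2) *\<^sub>R \<sigma> (x - h)) powr p"
      using norm_powr_convex[OF p1(1), of "\<eta> x"] \<eta>(2)[of x] \<eta>b[of x] by simp
    also have "\<dots> \<le> 1 * norm (\<sigma> x) powr p + 1 * ((1 - 1 / 2) * norm (\<sigma> (x + h)) powr p + (1 / 2) * norm (\<sigma> (x - h)) powr p)"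
      using \<eta>(2)[of x] \<eta>b[of x] p1 by (intro add_mono mult_mono norm_powr_convex) auto
    finally show ?thesis by (simp add: field_simps) (smt (verit) powr_ge_zero)
  qed
  have M0: "M \<ge> 0" unfolding M_def by simp
  have iM: "integrable lborel (\<lambda>x. norm (\<sigma> (x + k)) powr p)" "(LBINT x. norm (\<sigma> (x + k)) powr p) = M" for k
    using Lp_borel_integrable[OF Lp_borel_translate[OF \<sigma>(1)]] integral_translate[of "\<lambda>x. norm (\<sigma> x) powr p" k]
    by (auto simp: M_def)
  have Mm: "(LBINT x. norm (m x) powr p) \<le> 3 * M"
  proof -
    have "(LBINT x. norm (m x) powr p) \<le> (LBINT x. norm (\<sigma> (x + 0)) powr p + norm (\<sigma> (x + h)) powr p + norm (\<sigma> (x + (- h))) powr p)"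
      using mp by (intro integral_mono Bochner_Integration.integrable_add iM(1) Lp_borel_integrable[OF mL]) auto
    also have "\<dots> = 3 * M" by (simp only: integral_linear iM)
    finally show ?thesis .
  qed
  have iR: "integrable lborel (\<lambda>x. norm (R x) powr p)" by (rule Lp_borel_integrable[OF RL])
  have CRb: "(LBINT x. norm (R x) powr p) \<le> CR * \<rho> powr p"
  proof -
    have "ennreal (LBINT x. norm (R x) powr p) = int_powr p L R"
      unfolding nn_integral_Lp_borel[OF RL, symmetric] using Roff p1
      by (intro nn_integral_cong) (auto simp: indicator_def)
    also have "\<dots> \<le> ennreal (CR * \<rho> powr p)" using R unfolding R_def .
    finally show ?thesis using CR by (subst (asm) ennreal_le_iff) auto
  qed
  have Lfin: "emeasure lborel L < \<infinity>" using L(1) by (intro emeasure_bounded_finite compact_imp_bounded)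
  define P' where "P' = (\<lambda>x. \<rho> * (indicator L x + 2 * (2 powr p * (norm (m x) powr p + \<rho> powr (- p) * norm (R x) powr p))))"
  have PP: "P x \<le> P' x" for x
  proof (cases "x \<in> L")
    case True
    have "?H (m x + (1 / \<rho>) *\<^sub>R R x) \<le> 1 + 2 * norm (m x + (1 / \<rho>) *\<^sub>R R x) powr p"
      by (rule flux_density_le[OF p1(1)])
    also have "\<dots> \<le> 1 + 2 * (2 powr p * (norm (m x) powr p + norm ((1 / \<rho>) *\<^sub>R R x) powr p))"
      using p1 by (intro add_left_mono mult_left_mono norm_add_powr_le) auto
    also have "norm ((1 / \<rho>) *\<^sub>R R x) powr p = \<rho> powr (- p) * norm (R x) powr p"
      using \<rho> by (simp add: powr_mult powr_divide powr_minus_divide)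
    finally show ?thesis using True \<rho> by (simp add: P_def P'_def)
  next
    case False
    then show ?thesis using \<rho> by (simp add: P_def P'_def)
  qed
  have iL: "integrable lborel (indicator L :: 'a \<Rightarrow> real)" using Lfin by simp
  have iP': "integrable lborel P'" unfolding P'_def
    using iL iR Lp_borel_integrable[OF mL] by simp
  have P0: "P x \<ge> 0" for x using \<rho> p1 by (simp add: P_def flux_density_nonneg)
  have iP: "integrable lborel P"
  proof (rule Bochner_Integration.integrable_bound[OF iP'])
    show "P \<in> borel_measurable lborel" unfolding P_def by measurable
    show "AE x in lborel. norm (P x) \<le> norm (P' x)"
      using PP P0 by (intro AE_I2) (smt (verit) real_norm_def)
  qed
  have intP: "(LBINT x. P x) \<le> \<rho> * (measure lborel L + 2 * 2 powr p * (3 * M + CR))"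
  proof -
    have "(LBINT x. P x) \<le> (LBINT x. P' x)" by (intro integral_mono iP iP' PP)
    also have "\<dots> = \<rho> * (measure lborel L + 2 * (2 powr p * ((LBINT x. norm (m x) powr p) + \<rho> powr (- p) * (LBINT x. norm (R x) powr p))))"
      unfolding P'_def using iL iR Lp_borel_integrable[OF mL] Lfin by simp
    also have "\<dots> \<le> \<rho> * (measure lborel L + 2 * (2 powr p * (3 * M + \<rho> powr (- p) * (CR * \<rho> powr p))))"
      using \<rho> Mm CRb by (intro mult_left_mono add_left_mono add_mono) auto
    also have "\<rho> powr (- p) * (CR * \<rho> powr p) = CR" using \<rho> by (simp add: powr_minus field_simps)
    finally show ?thesis by (simp add: algebra_simps)
  qed
  \<comment> \<open>The translations are moved from the density to the cutoff, where they form a second difference.\<close>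
  have "(LBINT x. Q x) = (LBINT x. (1 / 2) * ((\<eta> (x + (- h)) * ?H (\<sigma> x)) + \<eta> (x + h) * ?H (\<sigma> x)) - \<eta> x * ?H (\<sigma> x))"
  proof -
    have tr: "(LBINT x. \<eta> x * ?H (\<sigma> (x + k))) = (LBINT x. \<eta> (x + (- k)) * ?H (\<sigma> x))" for k
      using integral_translate[of "\<lambda>x. \<eta> (x + (- k)) * ?H (\<sigma> x)" k] by simp
    have it: "integrable lborel (\<lambda>x. \<eta> (x + (- k)) * ?H (\<sigma> x))" for k
      using integrable_translate[OF _ i\<eta>[OF iHs[of k]], of "- k"] by simp
    have "(LBINT x. Q x) = (LBINT x. (1 / 2) * (\<eta> x * ?H (\<sigma> (x + h)) + \<eta> x * ?H (\<sigma> (x + (- h)))) - \<eta> x * ?H (\<sigma> x))"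
      by (simp add: Q_def algebra_simps)
    also have "\<dots> = (1 / 2) * ((LBINT x. \<eta> x * ?H (\<sigma> (x + h))) + (LBINT x. \<eta> x * ?H (\<sigma> (x + (- h))))) - (LBINT x. \<eta> x * ?H (\<sigma> x))"
      by (simp only: integral_linear i\<eta>[OF iHs] i\<eta>[OF iH])
    also have "\<dots> = (1 / 2) * ((LBINT x. \<eta> (x + (- h)) * ?H (\<sigma> x)) + (LBINT x. \<eta> (x + (- (- h))) * ?H (\<sigma> x))) - (LBINT x. \<eta> x * ?H (\<sigma> x))"
      by (simp only: tr)
    also have "\<dots> = (LBINT x. (1 / 2) * ((\<eta> (x + (- h)) * ?H (\<sigma> x)) + \<eta> (x + (- (- h))) * ?H (\<sigma> x)) - \<eta> x * ?H (\<sigma> x))"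
      by (simp only: integral_linear it i\<eta>[OF iH])
    finally show ?thesis by simp
  qed
  also have "\<dots> \<le> (LBINT x. B2 * (norm h)\<^sup>2 * ?H (\<sigma> x))"
  proof (rule integral_mono)
    show "integrable lborel (\<lambda>x. B2 * (norm h)\<^sup>2 * ?H (\<sigma> x))" using iH by simp
    have it: "integrable lborel (\<lambda>x. \<eta> (x + (- k)) * ?H (\<sigma> x))" for k
      using integrable_translate[OF _ i\<eta>[OF iHs[of k]], of "- k"] by simp
    show "integrable lborel (\<lambda>x. (1 / 2) * ((\<eta> (x + (- h)) * ?H (\<sigma> x)) + \<eta> (x + h) * ?H (\<sigma> x)) - \<eta> x * ?H (\<sigma> x))"
      using it[of h] it[of "- h"] i\<eta>[OF iH] by (intro Bochner_Integration.integrable_diff integrable_mult_right Bochner_Integration.integrable_add) auto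
    fix x
    have H0: "?H (\<sigma> x) \<ge> 0" using p1 by (simp add: flux_density_nonneg)
    have "(1 / 2) * ((\<eta> (x + (- h)) * ?H (\<sigma> x)) + \<eta> (x + h) * ?H (\<sigma> x)) - \<eta> x * ?H (\<sigma> x)
       = ((\<eta> (x + h) + \<eta> (x - h) - 2 * \<eta> x) / 2) * ?H (\<sigma> x)"
      by (simp add: algebra_simps)
    also have "\<dots> \<le> (B2 * (norm h)\<^sup>2) * ?H (\<sigma> x)"
    proof (rule mult_right_mono[OF _ H0])
      have "a / 2 \<le> b" if "\<bar>a\<bar> \<le> b" for a b :: real using that by linarith
      then show "(\<eta> (x + h) + \<eta> (x - h) - 2 * \<eta> x) / 2 \<le> B2 * (norm h)\<^sup>2" using B2 by blast
    qed
    finally show "(1 / 2) * ((\<eta> (x + (- h)) * ?H (\<sigma> x)) + \<eta> (x + h) * ?H (\<sigma> x)) - \<eta> x * ?H (\<sigma> x)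
      \<le> B2 * (norm h)\<^sup>2 * ?H (\<sigma> x)" .
  qed
  also have "\<dots> = B2 * (norm h)\<^sup>2 * E" by (simp add: E_def)
  finally have intQ: "(LBINT x. Q x) \<le> B2 * (norm h)\<^sup>2 * E" .
  have "(LBINT x. ?H (\<tau> x) + D x) \<le> (LBINT x. ?H (\<sigma> x) + Q x + P x)"
    by (intro integral_mono pw Bochner_Integration.integrable_add iHt iD iH iQ iP)
  then have "(LBINT x. ?H (\<tau> x)) + (LBINT x. D x) \<le> E + (LBINT x. Q x) + (LBINT x. P x)"
    unfolding E_def by (simp only: integral_linear iHt iD iH iQ iP)
  then have "(LBINT x. D x) \<le> B2 * (norm h)\<^sup>2 * E + \<rho> * (measure lborel L + 2 * 2 powr p * (3 * M + CR))"
    using le intQ intP by linarith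
  moreover have "(LBINT x. D x) = (1 / (p * 2 powr p)) * (LBINT x. \<eta> x * norm (\<sigma> (x + h) - \<sigma> x) powr p)"
    unfolding Deq by simp
  ultimately show "(LBINT x. \<eta> x * norm (\<sigma> (x + h) - \<sigma> x) powr p)
     \<le> p * 2 powr p * (B2 * (norm h)\<^sup>2 * E + \<rho> * (measure lborel L + 2 * 2 powr p * (3 * M + CR)))"
    using p1 by (simp add: divide_le_eq mult.commute)
qed

text \<open>Take \<open>\<rho> = |h|\<close> to the power \<open>min (1 + \<alpha>) (1 + t/p)\<close>, the size of the remainder. This exponent is at most
  \<open>2\<close>, so the quadratic term is dominated as well.\<close>

lemma diff_bound_improve:
  assumes \<alpha>: "0 \<le> \<alpha>" "\<alpha> \<le> 1" and df: "diff_bound p (\<alpha> * p) \<Omega> f"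
    and t: "t \<ge> 0" and d\<sigma>: "diff_bound p t \<Omega> \<sigma>"
  shows "diff_bound p (min (1 + \<alpha>) (1 + t / p)) \<Omega> \<sigma>"
proof (rule diff_boundI)
  define \<theta> where "\<theta> = min (1 + \<alpha>) (1 + t / p)"
  have p1: "p > 1" "p > 0" using p by auto
  have \<theta>: "\<theta> \<ge> 0" "\<theta> \<le> 2" using \<alpha> t p1 by (auto simp: \<theta>_def)
  fix K assume K: "compact K" "K \<subseteq> \<Omega>"
  obtain \<eta> c where \<eta>: "\<eta> \<in> test_functions \<Omega>" and c: "c > 0" "\<And>x. 0 \<le> \<eta> x" "\<And>x. \<eta> x \<le> 1 / 2" "\<And>x. x \<in> K \<Longrightarrow> c \<le> \<eta> x"
    using cutoff_exists[OF K(1) \<Omega>(1) K(2)] by metis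
  have \<eta>1: "\<eta> x \<le> 1" for x using c(3)[of x] by simp
  obtain L where L: "compact L" "L \<subseteq> \<Omega>" "\<And>x. x \<notin> L \<Longrightarrow> \<eta> x = 0" using test_functionE[OF \<eta>] by metis
  obtain B2 where B2: "B2 > 0" "\<And>x h. \<bar>\<eta> (x + h) + \<eta> (x - h) - 2 * \<eta> x\<bar> \<le> B2 * (norm h)\<^sup>2"
    using test_function_second_difference[OF \<eta>] by metis
  obtain B where B: "B > 0" "\<And>x. norm (grad \<eta> x) \<le> B" using test_function_grad_bounded[OF \<eta>] by metis
  have [measurable]: "\<sigma> \<in> borel_measurable borel" "\<eta> \<in> borel_measurable borel"
    using \<sigma> \<eta> by (auto intro: Lp_borelD test_function_measurable)
  have bL: "L \<in> sets borel" using L(1) by (rule borel_compact)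
  obtain C1 \<delta>1 where C1: "C1 \<ge> 0" "\<delta>1 > 0" "\<delta>1 \<le> 1" "\<forall>h. norm h < \<delta>1 \<longrightarrow>
    int_powr p L (\<lambda>x. f (x + h) - f x) \<le> ennreal (C1 * norm h powr (\<alpha> * p))"
    using diff_boundD[OF df L(1,2)] by blast
  obtain C2 \<delta>2 where C2: "C2 \<ge> 0" "\<delta>2 > 0" "\<delta>2 \<le> 1" "\<forall>h. norm h < \<delta>2 \<longrightarrow>
    int_powr p L (\<lambda>x. \<sigma> (x + h) - \<sigma> x) \<le> ennreal (C2 * norm h powr t)"
    using diff_boundD[OF d\<sigma> L(1,2)] by blast
  define \<delta> where "\<delta> = min \<delta>1 \<delta>2"
  have \<delta>: "\<delta> > 0" "\<delta> \<le> 1" using C1 C2 by (auto simp: \<delta>_def)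
  define CR where "CR = 2 * 4 powr p * (C1 + B powr p * C2)"
  have CR: "CR \<ge> 0" using C1 C2 by (simp add: CR_def)
  define E where "E = (LBINT x. flux_density p (\<sigma> x))"
  define M where "M = (LBINT x. norm (\<sigma> x) powr p)"
  have E: "E \<ge> 0" unfolding E_def using p1 by (simp add: flux_density_nonneg)
  have M: "M \<ge> 0" unfolding M_def by simp
  define A where "A = measure lborel L + 2 * 2 powr p * (3 * M + CR)"
  have A: "A \<ge> 0" using M CR by (simp add: A_def)
  define C where "C = (p * 2 powr p * (B2 * E + A)) / c"
  have C: "C \<ge> 0" using p1 B2 E A c(1) by (simp add: C_def)
  have "int_powr p K (\<lambda>x. \<sigma> (x + h) - \<sigma> x) \<le> ennreal (C * norm h powr \<theta>)"
    if h: "norm h < \<delta>" for h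
  proof (cases "h = 0")
    case False
    define \<rho> where "\<rho> = norm h powr \<theta>"
    have h1: "norm h \<le> 1" using h \<delta> by linarith
    have \<rho>: "0 < \<rho>" "\<rho> \<le> 1"
      using False h1 \<theta> powr_mono2[of \<theta> "norm h" 1] by (auto simp: \<rho>_def)
    have R: "int_powr p L (\<lambda>x. shift_remainder \<eta> h f \<sigma> x) \<le> ennreal (CR * \<rho> powr p)"
      unfolding CR_def \<rho>_def \<theta>_def
      by (rule shift_remainder_integral_le[OF \<sigma>(1) f p1(1) bL test_function_smooth[OF \<eta>] c(2) \<eta>1 less_imp_le[OF B(1)] B(2)
            t \<alpha>(1) C1(1) C2(1), where \<delta> = \<delta>])
         (use C1 C2 h h1 in \<open>auto simp: \<delta>_def\<close>)
    note est = minimizer_difference_estimate[OF \<eta> c(2,3) L B2(2) \<rho> CR R]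
    have i: "(LBINT x. \<eta> x * norm (\<sigma> (x + h) - \<sigma> x) powr p) \<le> p * 2 powr p * (B2 * (norm h)\<^sup>2 * E + \<rho> * A)"
      unfolding A_def E_def M_def by (rule est(1))
    have "(norm h)\<^sup>2 = norm h powr 2" by simp
    also have "\<dots> \<le> \<rho>" unfolding \<rho>_def using h1 \<theta> by (intro powr_mono') auto
    finally have "B2 * (norm h)\<^sup>2 * E + \<rho> * A \<le> B2 * \<rho> * E + \<rho> * A"
      using B2 E by (intro add_right_mono mult_right_mono mult_left_mono) auto
    then have "p * 2 powr p * (B2 * (norm h)\<^sup>2 * E + \<rho> * A) \<le> p * 2 powr p * (B2 * \<rho> * E + \<rho> * A)"
      using p1 by (intro mult_left_mono) auto
    then have ii: "(1 / c) * (LBINT x. \<eta> x * norm (\<sigma> (x + h) - \<sigma> x) powr p) \<le> (1 / c) * (p * 2 powr p * (B2 * \<rho> * E + \<rho> * A))"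
      using i c(1) by (intro mult_left_mono) auto
    have "int_powr p K (\<lambda>x. \<sigma> (x + h) - \<sigma> x)
      \<le> (\<integral>\<^sup>+x. ennreal ((1 / c) * (\<eta> x * norm (\<sigma> (x + h) - \<sigma> x) powr p)) \<partial>lborel)"
    proof (intro nn_integral_mono ennreal_leI)
      fix x
      show "indicator K x * norm (\<sigma> (x + h) - \<sigma> x) powr p \<le> (1 / c) * (\<eta> x * norm (\<sigma> (x + h) - \<sigma> x) powr p)"
      proof (cases "x \<in> K")
        case True
        have "c * norm (\<sigma> (x + h) - \<sigma> x) powr p \<le> \<eta> x * norm (\<sigma> (x + h) - \<sigma> x) powr p"
          using c(4)[OF True] by (intro mult_right_mono) auto
        then show ?thesis using True c(1) by (simp add: field_simps)
      next
        case False
        then show ?thesis using c(1) c(2)[of x] by simp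
      qed
    qed
    also have "\<dots> = ennreal (LBINT x. (1 / c) * (\<eta> x * norm (\<sigma> (x + h) - \<sigma> x) powr p))"
    proof (rule nn_integral_eq_integral)
      show "integrable lborel (\<lambda>x. (1 / c) * (\<eta> x * norm (\<sigma> (x + h) - \<sigma> x) powr p))"
        using est(2) by (rule integrable_mult_right)
      show "AE x in lborel. 0 \<le> (1 / c) * (\<eta> x * norm (\<sigma> (x + h) - \<sigma> x) powr p)"
        using c(1,2) by (intro AE_I2) simp
    qed
    also have "\<dots> = ennreal ((1 / c) * (LBINT x. \<eta> x * norm (\<sigma> (x + h) - \<sigma> x) powr p))"
      by (simp only: integral_mult_right_zero)
    also have "\<dots> \<le> ennreal ((1 / c) * (p * 2 powr p * (B2 * \<rho> * E + \<rho> * A)))"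
      by (rule ennreal_leI[OF ii])
    also have "(1 / c) * (p * 2 powr p * (B2 * \<rho> * E + \<rho> * A)) = C * norm h powr \<theta>"
      by (simp add: C_def \<rho>_def algebra_simps add_divide_distrib)
    finally show ?thesis .
  qed simp
  then show "\<exists>C\<ge>0. \<exists>\<delta>>0. \<forall>h. norm h < \<delta> \<longrightarrow>
     int_powr p K (\<lambda>x. \<sigma> (x + h) - \<sigma> x) \<le> ennreal (C * norm h powr min (1 + \<alpha>) (1 + t / p))"
    using C \<delta>(1) unfolding \<theta>_def by blast
qed

text \<open>For \<open>t \<le> T < q\<close> the step \<open>1 + t/p - t = 1 - t/q\<close> is at least \<open>e = 1 - T/q\<close>, so finitely many
  improvements reach \<open>T\<close>.\<close>

lemma minimizer_diff_bound:
  assumes \<alpha>: "0 \<le> \<alpha>" "\<alpha> \<le> 1" and df: "diff_bound p (\<alpha> * p) \<Omega> f"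
    and T: "0 \<le> T" "T < q" "T \<le> 1 + \<alpha>"
  shows "diff_bound p T \<Omega> \<sigma>"
proof -
  define e where "e = 1 - T / q"
  have e: "e > 0" using T q by (simp add: e_def)
  have pq: "1 / p = 1 - 1 / q" using q by simp
  have step: "diff_bound p (min T (real k * e)) \<Omega> \<sigma>" for k
  proof (induction k)
    case 0
    have "int_powr p K (\<lambda>x. \<sigma> (x + h) - \<sigma> x)
        \<le> ennreal ((LBINT x. norm (2 *\<^sub>R \<sigma> x) powr p + norm (2 *\<^sub>R \<sigma> x) powr p) * norm h powr 0)" for K h
    proof (cases "h = 0")
      case False
      have [measurable]: "\<sigma> \<in> borel_measurable borel" using \<sigma>(1) by (rule Lp_borelD)
      let ?I = "LBINT x. norm (\<sigma> x) powr p"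
      have "int_powr p K (\<lambda>x. \<sigma> (x + h) - \<sigma> x) \<le> ennreal (2 powr p * ?I + 2 powr p * ?I)"
      proof (rule nn_integral_bound_two)
        show "(\<integral>\<^sup>+x. ennreal (norm (\<sigma> (x + h)) powr p) \<partial>lborel) \<le> ennreal ?I"
          using nn_integral_translate[of "\<lambda>x. ennreal (norm (\<sigma> x) powr p)" h] nn_integral_Lp_borel[OF \<sigma>(1)] by simp
        show "(\<integral>\<^sup>+x. ennreal (norm (\<sigma> x) powr p) \<partial>lborel) \<le> ennreal ?I"
          using nn_integral_Lp_borel[OF \<sigma>(1)] by simp
        fix x
        show "indicator K x * norm (\<sigma> (x + h) - \<sigma> x) powr p \<le> 2 powr p * norm (\<sigma> (x + h)) powr p + 2 powr p * norm (\<sigma> x) powr p"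
          using norm_diff_powr_le[of p "\<sigma> (x + h)" "\<sigma> x"] p by (cases "x \<in> K") (auto simp: algebra_simps)
      qed auto
      then show ?thesis
        using False Lp_borel_integrable[OF \<sigma>(1)] by (simp add: powr_mult)
    qed simp
    then have "diff_bound p 0 \<Omega> \<sigma>"
      by (intro diff_boundI exI[of _ "LBINT x. norm (2 *\<^sub>R \<sigma> x) powr p + norm (2 *\<^sub>R \<sigma> x) powr p"] conjI exI[of _ 1]) auto
    then show ?case using T by simp
  next
    case (Suc k)
    define t where "t = min T (real k * e)"
    have t: "t \<ge> 0" "t \<le> T" using T e by (auto simp: t_def)
    have "diff_bound p (min (1 + \<alpha>) (1 + t / p)) \<Omega> \<sigma>"
      using Suc t(1) by (intro diff_bound_improve[OF \<alpha> df]) (auto simp: t_def)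
    moreover have "min T (real (Suc k) * e) \<le> min (1 + \<alpha>) (1 + t / p)"
    proof -
      have "t / q \<le> T / q" using t q by (intro divide_right_mono) auto
      moreover have "t / p = t * (1 / p)" by simp
      then have "t / p = t - t / q" unfolding pq by (simp add: right_diff_distrib)
      ultimately have "t + e \<le> 1 + t / p" by (simp add: e_def)
      moreover have "min T (real (Suc k) * e) \<le> t + e" using e by (auto simp: t_def min_def algebra_simps)
      ultimately show ?thesis using T by auto
    qed
    ultimately show ?case by (rule diff_bound_mono)
  qed
  obtain k :: nat where "T / e \<le> real k" using real_arch_simple by blast
  then have "min T (real k * e) = T" using e by (simp add: min_def field_simps)
  then show ?thesis using step[of k] by simp
qed

end

section \<open>Higher integrability from difference bounds\<close>

text \<open>Stated with the extended integral, so that finiteness is a conclusion and not a convention.\<close>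

definition loc_integrable :: "real \<Rightarrow> 'a::euclidean_space set \<Rightarrow> ('a \<Rightarrow> 'b::euclidean_space) \<Rightarrow> bool" where
  "loc_integrable s \<Omega> u \<longleftrightarrow>
     (\<forall>K. compact K \<and> K \<subseteq> \<Omega> \<longrightarrow> int_powr s K u < \<infinity>)"

text \<open>Let \<open>|u(x)| > \<mu>\<close>. By Chebyshev's inequality the set where \<open>|u| > \<mu>/2\<close> has measure at most a multiple of
  \<open>\<mu>\<close> to the power \<open>-s\<close>, hence fills at most half of a ball about \<open>x\<close> whose radius \<open>r\<close> is a large
  multiple of \<open>\<mu>\<close> to the power \<open>-s/n\<close>. On the other half \<open>|u(x + h) - u(x)| > \<mu>/2\<close>. Integrating over
  all such \<open>x\<close> and exchanging the integrals bounds the measure of the superlevel set by a multiple of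
  \<open>\<mu>\<^sup>-\<^sup>p r\<^sup>t\<close>. The threshold \<open>\<Lambda>\<close> keeps \<open>r\<close> below the distance to the boundary and below the range of
  the difference bound.\<close>

lemma superlevel_decay:
  fixes u :: "'a::euclidean_space \<Rightarrow> 'b::euclidean_space"
  assumes \<Omega>: "open \<Omega>" and u [measurable]: "u \<in> borel_measurable borel" and p: "p > 0" and t: "t \<ge> 0" and s: "s > 0"
    and d: "diff_bound p t \<Omega> u" and loc: "loc_integrable s \<Omega> u" and K: "compact K" "K \<subseteq> \<Omega>"
  shows "\<exists>C\<ge>0. \<exists>\<Lambda>\<ge>1. \<forall>\<mu>\<ge>\<Lambda>. emeasure lborel {x \<in> K. norm (u x) > \<mu>}
     \<le> ennreal (C * \<mu> powr (- (p + t * s / real DIM('a))))"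
proof -
  let ?n = "real DIM('a)"
  have n: "?n > 0" by simp
  obtain e where e: "e > 0" "(\<Union>x\<in>K. cball x e) \<subseteq> \<Omega>"
    using compact_subset_open_imp_cball_epsilon_subset[OF K(1) \<Omega> K(2)] by metis
  define K' where "K' = (\<Union>x\<in>K. \<Union>y\<in>cball 0 e. {x + y})"
  have K': "compact K'" unfolding K'_def by (rule compact_sums'[OF K(1) compact_cball])
  have K'sub: "K' \<subseteq> \<Omega>"
  proof
    fix y assume "y \<in> K'"
    then obtain x z where "x \<in> K" "norm z \<le> e" "y = x + z" by (auto simp: K'_def)
    then have "y \<in> (\<Union>x\<in>K. cball x e)" by (intro UN_I[of x]) (auto simp: dist_norm)
    then show "y \<in> \<Omega>" using e(2) by blast
  qed
  have [measurable]: "K \<in> sets borel" "K' \<in> sets borel" using K(1) K' by (auto intro: borel_compact)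
  have "int_powr s K' u < \<infinity>"
    using loc K' K'sub by (auto simp: loc_integrable_def)
  then obtain N where N: "N \<ge> 0" "int_powr s K' u = ennreal N"
    by (cases "\<integral>\<^sup>+x. ennreal (indicator K' x * norm (u x) powr s) \<partial>lborel" rule: ennreal_cases) auto
  obtain C0 \<delta> where C0: "C0 \<ge> 0" "\<delta> > 0" "\<delta> \<le> 1" "\<forall>h. norm h < \<delta> \<longrightarrow>
    int_powr p K (\<lambda>x. u (x + h) - u x) \<le> ennreal (C0 * norm h powr t)"
    using diff_boundD[OF d K] by blast
  define b where "b = unit_ball_vol ?n"
  have b: "b > 0" by (simp add: b_def)
  have ball: "emeasure lborel (ball (0::'a) r) = ennreal (b * r powr ?n)" if "r > 0" for r
    using emeasure_ball[of r "0::'a"] that by (simp add: b_def powr_realpow)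
  \<comment> \<open>This makes the volume of the ball more than twice the Chebyshev bound.\<close>
  define a where "a = ((2 * 2 powr s * N + 1) / b) powr (1 / ?n)"
  have a: "a > 0" using N b by (simp add: a_def add_nonneg_eq_0_iff)
  have an: "b * a powr ?n = 2 * 2 powr s * N + 1"
    using N b n by (simp add: a_def powr_powr)
  define r0 where "r0 = min e \<delta>"
  have r0: "r0 > 0" using e C0 by (simp add: r0_def)
  define \<Lambda> where "\<Lambda> = max 1 ((a / r0) powr (?n / s))"
  define C where "C = 2 * 2 powr p * (C0 * a powr t)"
  have C: "C \<ge> 0" using C0 by (simp add: C_def)
  have "emeasure lborel {x \<in> K. norm (u x) > \<mu>} \<le> ennreal (C * \<mu> powr (- (p + t * s / ?n)))" if lam: "\<mu> \<ge> \<Lambda>" for \<mu>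
  proof -
    have l1: "\<mu> \<ge> 1" using lam by (simp add: \<Lambda>_def)
    then have l: "\<mu> > 0" by simp
    define r where "r = a * \<mu> powr (- s / ?n)"
    have r: "r > 0" using a l by (simp add: r_def)
    have "r \<le> r0"
    proof -
      have "((a / r0) powr (?n / s)) powr (s / ?n) \<le> \<mu> powr (s / ?n)"
        using lam s n by (intro powr_mono2) (auto simp: \<Lambda>_def)
      then have "a / r0 \<le> \<mu> powr (s / ?n)" using s n a r0 by (simp add: powr_powr)
      then have "a \<le> r0 * \<mu> powr (s / ?n)" using r0 by (simp add: field_simps)
      then show ?thesis using l by (simp add: r_def powr_minus field_simps)
    qed
    then have re: "r \<le> e" "r \<le> \<delta>" by (auto simp: r0_def)
    have rn: "b * r powr ?n = (2 * 2 powr s * N + 1) * \<mu> powr (- s)"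
    proof -
      have "r powr ?n = a powr ?n * \<mu> powr (- s)" using a l n by (simp add: r_def powr_mult powr_powr)
      then show ?thesis using an by (simp add: mult.assoc[symmetric])
    qed
    define V where "V = b * r powr ?n"
    have V: "V > 0" using b r by (simp add: V_def)
    define S where "S = {x \<in> K. norm (u x) > \<mu>}"
    have [measurable]: "ball (0::'a) r \<in> sets borel" by simp
    have [measurable]: "S \<in> sets borel" unfolding S_def by measurable
    have good: "ennreal (V / 2 * (\<mu> / 2) powr p) \<le>
        (\<integral>\<^sup>+h. ennreal (indicator (ball 0 r) h * (indicator K x * norm (u (x + h) - u x) powr p)) \<partial>lborel)"
      if x: "x \<in> S" for x
    proof -
      define A where "A = {h \<in> ball 0 r. norm (u (x + h)) \<le> \<mu> / 2}"
      define A' where "A' = {h \<in> ball 0 r. norm (u (x + h)) > \<mu> / 2}"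
      have [measurable]: "A \<in> sets borel" "A' \<in> sets borel" unfolding A_def A'_def by measurable
      have "emeasure lborel A' = (\<integral>\<^sup>+h. indicator A' h \<partial>lborel)" by simp
      also have "\<dots> \<le> (\<integral>\<^sup>+h. ennreal ((2 / \<mu>) powr s) * ennreal (indicator K' (h + x) * norm (u (h + x)) powr s) \<partial>lborel)"
      proof (rule nn_integral_mono)
        fix h
        show "indicator A' h \<le> ennreal ((2 / \<mu>) powr s) * ennreal (indicator K' (h + x) * norm (u (h + x)) powr s)"
        proof (cases "h \<in> A'")
          case True
          then have "norm h \<le> e" "x \<in> K" using re x by (auto simp: A'_def S_def)
          then have "h + x \<in> K'" unfolding K'_def by (intro UN_I[of x] UN_I[of h]) auto
          moreover have "1 \<le> (2 / \<mu>) powr s * norm (u (h + x)) powr s"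
          proof -
            have "1 \<le> (2 / \<mu>) * norm (u (h + x))" using True l by (simp add: A'_def field_simps)
            then have "1 powr s \<le> ((2 / \<mu>) * norm (u (h + x))) powr s" using s by (intro powr_mono2) auto
            then show ?thesis using l powr_mult[of "2 / \<mu>" "norm (u (h + x))" s] by simp
          qed
          ultimately show ?thesis using True
            by (simp flip: ennreal_mult add: ennreal_ge_1)
        qed simp
      qed
      also have "\<dots> = ennreal ((2 / \<mu>) powr s) * (\<integral>\<^sup>+h. ennreal (indicator K' (h + x) * norm (u (h + x)) powr s) \<partial>lborel)"
        by (rule nn_integral_cmult) measurable
      also have "\<dots> = ennreal ((2 / \<mu>) powr s * N)"
        using nn_integral_translate[of "\<lambda>x. ennreal (indicator K' x * norm (u x) powr s)" x] N by (simp add: ennreal_mult)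
      also have "\<dots> \<le> ennreal (V / 2)"
      proof (rule ennreal_leI)
        have "(2 / \<mu>) powr s * N = (2 powr s * N) * \<mu> powr (- s)" using l by (simp add: powr_divide powr_minus_divide)
        also have "\<dots> \<le> ((2 * 2 powr s * N + 1) / 2) * \<mu> powr (- s)" by (intro mult_right_mono) auto
        also have "\<dots> = V / 2" unfolding V_def rn by simp
        finally show "(2 / \<mu>) powr s * N \<le> V / 2" .
      qed
      finally have bad: "emeasure lborel A' \<le> ennreal (V / 2)" .
      have "ennreal V = emeasure lborel (A \<union> A')"
      proof -
        have "A \<union> A' = ball 0 r" by (auto simp: A_def A'_def)
        then show ?thesis using ball[OF r] by (simp add: V_def)
      qed
      also have "\<dots> \<le> emeasure lborel A + emeasure lborel A'" by (intro emeasure_subadditive) auto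
      also have "\<dots> \<le> emeasure lborel A + ennreal (V / 2)" by (intro add_left_mono bad)
      finally have "ennreal V - ennreal (V / 2) \<le> emeasure lborel A"
        by (simp add: ennreal_minus_le_iff add.commute)
      then have A: "ennreal (V / 2) \<le> emeasure lborel A" using V by (simp add: ennreal_minus)
      have "ennreal (V / 2 * (\<mu> / 2) powr p) = ennreal ((\<mu> / 2) powr p) * ennreal (V / 2)"
        using V by (simp add: ennreal_mult[symmetric] mult.commute)
      also have "\<dots> \<le> ennreal ((\<mu> / 2) powr p) * emeasure lborel A" by (intro mult_left_mono A) auto
      also have "\<dots> = (\<integral>\<^sup>+h. ennreal ((\<mu> / 2) powr p) * indicator A h \<partial>lborel)"
        by (simp add: nn_integral_cmult)
      also have "\<dots> \<le> (\<integral>\<^sup>+h. ennreal (indicator (ball 0 r) h * (indicator K x * norm (u (x + h) - u x) powr p)) \<partial>lborel)"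
      proof (rule nn_integral_mono)
        fix h
        show "ennreal ((\<mu> / 2) powr p) * indicator A h \<le> ennreal (indicator (ball 0 r) h * (indicator K x * norm (u (x + h) - u x) powr p))"
        proof (cases "h \<in> A")
          case True
          have "norm (u x) \<le> norm (u (x + h) - u x) + norm (u (x + h))"
            using norm_triangle_ineq4[of "u (x + h) - u x" "u (x + h)"] by simp
          then have "\<mu> / 2 \<le> norm (u (x + h) - u x)" using True x by (simp add: A_def S_def)
          then have "(\<mu> / 2) powr p \<le> norm (u (x + h) - u x) powr p" using l p by (intro powr_mono2) auto
          then show ?thesis using True x by (simp add: A_def S_def ennreal_leI)
        qed simp
      qed
      finally show ?thesis .
    qed
    have "ennreal (V / 2 * (\<mu> / 2) powr p) * emeasure lborel S = (\<integral>\<^sup>+x. ennreal (V / 2 * (\<mu> / 2) powr p) * indicator S x \<partial>lborel)"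
      by (simp add: nn_integral_cmult)
    also have "\<dots> \<le> (\<integral>\<^sup>+x. \<integral>\<^sup>+h. ennreal (indicator (ball 0 r) h * (indicator K x * norm (u (x + h) - u x) powr p)) \<partial>lborel \<partial>lborel)"
      using good by (intro nn_integral_mono) (auto simp: indicator_def[of S])
    also have "\<dots> = (\<integral>\<^sup>+h. \<integral>\<^sup>+x. ennreal (indicator (ball 0 r) h * (indicator K x * norm (u (x + h) - u x) powr p)) \<partial>lborel \<partial>lborel)"
      by (rule lborel_pair.Fubini'[symmetric]) measurable
    also have "\<dots> \<le> (\<integral>\<^sup>+h. ennreal (C0 * r powr t) * indicator (ball (0::'a) r) h \<partial>lborel)"
    proof (rule nn_integral_mono)
      fix h :: 'a
      show "(\<integral>\<^sup>+x. ennreal (indicator (ball 0 r) h * (indicator K x * norm (u (x + h) - u x) powr p)) \<partial>lborel)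
         \<le> ennreal (C0 * r powr t) * indicator (ball 0 r) h"
      proof (cases "h \<in> ball 0 r")
        case True
        then have h: "norm h < r" by simp
        then have "int_powr p K (\<lambda>x. u (x + h) - u x) \<le> ennreal (C0 * norm h powr t)"
          using C0(4) re by auto
        also have "\<dots> \<le> ennreal (C0 * r powr t)"
          using h t C0 by (intro ennreal_leI mult_left_mono powr_mono2) auto
        finally show ?thesis using True by simp
      qed simp
    qed
    also have "\<dots> = ennreal (C0 * r powr t) * ennreal V"
      using ball[OF r] by (simp add: nn_integral_cmult V_def)
    finally have main: "ennreal (V / 2 * (\<mu> / 2) powr p) * emeasure lborel S \<le> ennreal (C0 * r powr t * V)"
      using V C0 by (simp add: ennreal_mult)
    have W: "V / 2 * (\<mu> / 2) powr p > 0" using V l by simp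
    have "emeasure lborel S \<le> emeasure lborel K" unfolding S_def by (intro emeasure_mono) auto
    also have "\<dots> < \<infinity>" using K(1) by (intro emeasure_bounded_finite compact_imp_bounded)
    finally obtain m where m: "m \<ge> 0" "emeasure lborel S = ennreal m"
      by (cases "emeasure lborel S" rule: ennreal_cases) auto
    have "V / 2 * (\<mu> / 2) powr p * m \<le> C0 * r powr t * V"
      using main W m C0 V by (simp add: m(2) ennreal_mult[symmetric] ennreal_le_iff)
    then have "(\<mu> / 2) powr p * m \<le> 2 * (C0 * r powr t)"
      using V by (simp add: field_simps)
    then have "m \<le> 2 * 2 powr p * (C0 * r powr t) * \<mu> powr (- p)"
      using l by (simp add: powr_divide powr_minus field_simps)
    also have "r powr t = a powr t * \<mu> powr (- (t * s / ?n))"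
      using a l by (simp add: r_def powr_mult powr_powr algebra_simps)
    also have "2 * 2 powr p * (C0 * (a powr t * \<mu> powr (- (t * s / ?n)))) * \<mu> powr (- p) = C * (\<mu> powr (- p) * \<mu> powr (- (t * s / ?n)))"
      by (simp add: C_def algebra_simps)
    also have "\<mu> powr (- p) * \<mu> powr (- (t * s / ?n)) = \<mu> powr (- (p + t * s / ?n))"
      by (simp add: powr_add[symmetric])
    finally show ?thesis using m by (simp add: S_def ennreal_leI)
  qed
  moreover have "\<Lambda> \<ge> 1" by (simp add: \<Lambda>_def)
  ultimately show ?thesis using C by blast
qed

text \<open>Sum over the dyadic layers between \<open>2\<^sup>j \<Lambda>\<close> and \<open>2\<^sup>j\<^sup>+\<^sup>1 \<Lambda>\<close>; their contributions form a geometric series of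
  ratio \<open>2 powr (s - \<kappa>)\<close>.\<close>

lemma integrable_of_superlevel_decay:
  fixes u :: "'a::euclidean_space \<Rightarrow> 'b::euclidean_space"
  assumes u [measurable]: "u \<in> borel_measurable borel" and K: "compact K" and C: "C \<ge> 0" and \<Lambda>: "\<Lambda> \<ge> 1"
    and decay: "\<And>\<mu>. \<mu> \<ge> \<Lambda> \<Longrightarrow> emeasure lborel {x \<in> K. norm (u x) > \<mu>} \<le> ennreal (C * \<mu> powr (- \<kappa>))"
    and s: "0 < s" "s < \<kappa>"
  shows "int_powr s K u < \<infinity>"
proof -
  have [measurable]: "K \<in> sets borel" using K by (rule borel_compact)
  have l0: "\<Lambda> > 0" using \<Lambda> by simp
  define l where "l = (\<lambda>j::nat. 2 ^ j * \<Lambda>)"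
  define S where "S = (\<lambda>j. {x \<in> K. norm (u x) > l j})"
  have [measurable]: "S j \<in> sets borel" for j unfolding S_def by measurable
  have lpos: "l j > 0" "l j \<ge> \<Lambda>" for j using l0 by (auto simp: l_def)
  have pw: "ennreal (indicator K x * norm (u x) powr s)
      \<le> ennreal (\<Lambda> powr s) * indicator K x + (\<Sum>j. ennreal (l (Suc j) powr s) * indicator (S j) x)" for x
  proof (cases "x \<in> K \<and> norm (u x) > \<Lambda>")
    case False
    then show ?thesis
      using s by (cases "x \<in> K") (auto intro!: ennreal_leI powr_mono2 add_increasing2)
  next
    case True
    have "\<exists>k. norm (u x) \<le> l k"
    proof -
      obtain k where "norm (u x) / \<Lambda> < 2 ^ k" using real_arch_pow[of 2 "norm (u x) / \<Lambda>"] by auto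
      then show ?thesis using l0 by (intro exI[of _ k]) (simp add: l_def field_simps)
    qed
    define k where "k = (LEAST k. norm (u x) \<le> l k)"
    have k: "norm (u x) \<le> l k" unfolding k_def by (rule LeastI_ex) fact
    have "k \<noteq> 0"
    proof
      assume "k = 0"
      then show False using k True by (simp add: l_def)
    qed
    then obtain j where j: "k = Suc j" by (cases k) auto
    have "\<not> norm (u x) \<le> l j" using not_less_Least[of j "\<lambda>k. norm (u x) \<le> l k"] j by (simp add: k_def)
    then have "x \<in> S j" using True by (simp add: S_def)
    have "ennreal (indicator K x * norm (u x) powr s) \<le> ennreal (l (Suc j) powr s) * indicator (S j) x"
      using True k j \<open>x \<in> S j\<close> s by (auto intro!: ennreal_leI powr_mono2)
    also have "\<dots> \<le> (\<Sum>j. ennreal (l (Suc j) powr s) * indicator (S j) x)"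
    proof -
      have "F j \<le> (\<Sum>j. F j)" for F :: "nat \<Rightarrow> ennreal"
        using sum_le_suminf[of F "{j}"] by simp
      then show ?thesis .
    qed
    finally show ?thesis by (simp add: add_increasing)
  qed
  have lin: "int_powr s K u
     \<le> ennreal (\<Lambda> powr s) * emeasure lborel K + (\<Sum>j. ennreal (l (Suc j) powr s) * emeasure lborel (S j))"
  proof -
    have "int_powr s K u
      \<le> (\<integral>\<^sup>+x. ennreal (\<Lambda> powr s) * indicator K x + (\<Sum>j. ennreal (l (Suc j) powr s) * indicator (S j) x) \<partial>lborel)"
      by (intro nn_integral_mono pw)
    also have "\<dots> = ennreal (\<Lambda> powr s) * emeasure lborel K + (\<Sum>j. ennreal (l (Suc j) powr s) * emeasure lborel (S j))"
      by (subst nn_integral_add) (auto simp: nn_integral_suminf nn_integral_cmult)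
    finally show ?thesis .
  qed
  define \<gamma> where "\<gamma> = 2 powr (s - \<kappa>)"
  have \<gamma>: "0 < \<gamma>" "\<gamma> < 1" using s powr_less_mono[of "s - \<kappa>" 0 2] by (auto simp: \<gamma>_def)
  have jth: "ennreal (l (Suc j) powr s) * emeasure lborel (S j) \<le> ennreal ((2 powr s * C * \<Lambda> powr (s - \<kappa>)) * \<gamma> ^ j)" for j
  proof -
    have "ennreal (l (Suc j) powr s) * emeasure lborel (S j) \<le> ennreal (l (Suc j) powr s) * ennreal (C * l j powr (- \<kappa>))"
      unfolding S_def by (intro mult_left_mono decay lpos) auto
    also have "\<dots> = ennreal (l (Suc j) powr s * (C * l j powr (- \<kappa>)))"
      using C by (simp add: ennreal_mult)
    also have "l (Suc j) powr s * (C * l j powr (- \<kappa>)) = (2 powr s * C * \<Lambda> powr (s - \<kappa>)) * \<gamma> ^ j"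
    proof -
      have "l (Suc j) powr s = 2 powr s * l j powr s" using lpos(1)[of j] by (simp add: l_def powr_mult mult.assoc)
      then have "l (Suc j) powr s * (C * l j powr (- \<kappa>)) = 2 powr s * C * (l j powr s * l j powr (- \<kappa>))" by simp
      also have "l j powr s * l j powr (- \<kappa>) = l j powr (s - \<kappa>)" by (simp add: powr_add[symmetric])
      also have "\<dots> = (2 powr real j) powr (s - \<kappa>) * \<Lambda> powr (s - \<kappa>)"
        using l0 by (simp add: l_def powr_mult powr_realpow)
      also have "(2 powr real j) powr (s - \<kappa>) = \<gamma> ^ j"
        using \<gamma>(1) by (simp add: \<gamma>_def powr_powr mult.commute flip: powr_realpow)
      finally show ?thesis by (simp only: ac_simps)
    qed
    finally show ?thesis .
  qed
  have "(\<Sum>j. ennreal (l (Suc j) powr s) * emeasure lborel (S j)) \<le> (\<Sum>j. ennreal ((2 powr s * C * \<Lambda> powr (s - \<kappa>)) * \<gamma> ^ j))"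
    by (intro suminf_le jth) auto
  also have "\<dots> < \<infinity>"
  proof -
    have "summable (\<lambda>j. (2 powr s * C * \<Lambda> powr (s - \<kappa>)) * \<gamma> ^ j)"
      using \<gamma> by (intro summable_mult summable_geometric) auto
    then have "(\<Sum>j. ennreal ((2 powr s * C * \<Lambda> powr (s - \<kappa>)) * \<gamma> ^ j)) \<noteq> top"
      using C \<gamma>(1) by (intro ennreal_suminf_neq_top) auto
    then show ?thesis by (simp add: less_top)
  qed
  finally have 1: "(\<Sum>j. ennreal (l (Suc j) powr s) * emeasure lborel (S j)) < \<infinity>" .
  have "emeasure lborel K < \<infinity>" using K by (intro emeasure_bounded_finite compact_imp_bounded)
  then have "ennreal (\<Lambda> powr s) * emeasure lborel K < \<infinity>" by (simp add: ennreal_mult_less_top)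
  with 1 have "ennreal (\<Lambda> powr s) * emeasure lborel K + (\<Sum>j. ennreal (l (Suc j) powr s) * emeasure lborel (S j)) < \<infinity>"
    by simp
  with lin show ?thesis by (rule le_less_trans)
qed

lemma loc_integrable_mono:
  fixes u :: "'a::euclidean_space \<Rightarrow> 'b::euclidean_space"
  assumes "loc_integrable s \<Omega> u" "0 < r" "r \<le> s" and [measurable]: "u \<in> borel_measurable borel"
  shows "loc_integrable r \<Omega> u"
  unfolding loc_integrable_def
proof (intro allI impI)
  fix K :: "'a set" assume K: "compact K \<and> K \<subseteq> \<Omega>"
  then have [measurable]: "K \<in> sets borel" by (auto intro: borel_compact)
  have "int_powr r K u
     \<le> (\<integral>\<^sup>+x. indicator K x + ennreal (indicator K x * norm (u x) powr s) \<partial>lborel)"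
  proof (rule nn_integral_mono)
    fix x
    have "norm (u x) powr r \<le> 1 + (norm (u x) powr r) powr (s / r)"
      using assms by (intro le_one_plus_powr) auto
    then have "norm (u x) powr r \<le> 1 + norm (u x) powr s" using assms by (simp add: powr_powr)
    then show "ennreal (indicator K x * norm (u x) powr r) \<le> indicator K x + ennreal (indicator K x * norm (u x) powr s)"
      by (cases "x \<in> K") (auto simp flip: ennreal_1 ennreal_plus intro!: ennreal_leI)
  qed
  also have "\<dots> = emeasure lborel K + int_powr s K u"
    by (subst nn_integral_add) auto
  also have "\<dots> < \<infinity>"
    using assms(1) K emeasure_bounded_finite[OF compact_imp_bounded, of K] by (simp add: loc_integrable_def)
  finally show "int_powr r K u < \<infinity>" .
qed

text \<open>The step from \<open>r \<le> s\<close> to \<open>p + tr/n\<close> gains at least \<open>p - s(1 - t/n) > 0\<close>. Only half of this, \<open>e\<close>, is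
  used, since decay of the superlevel sets gives integrability for strictly smaller exponents.\<close>

lemma loc_integrable_of_diff_bound:
  fixes u :: "'a::euclidean_space \<Rightarrow> 'b::euclidean_space"
  assumes \<Omega>: "open \<Omega>" and u: "Lp_borel p u" and p: "p > 0" and t: "0 \<le> t" "t < real DIM('a)"
    and d: "diff_bound p t \<Omega> u" and s: "s > 0" "s < real DIM('a) * p / (real DIM('a) - t)"
  shows "loc_integrable s \<Omega> u"
proof -
  let ?n = "real DIM('a)"
  have n: "?n > 0" by simp
  have m: "u \<in> borel_measurable borel" using u by (rule Lp_borelD)
  define e where "e = (p - s * (1 - t / ?n)) / 2"
  have e: "e > 0"
  proof -
    have "s * (?n - t) < ?n * p" using s t by (simp add: pos_less_divide_eq)
    then have "s * (1 - t / ?n) < p" using n by (simp add: field_simps)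
    then show ?thesis by (simp add: e_def)
  qed
  have step: "loc_integrable (min s (p + real k * e)) \<Omega> u" for k
  proof (induction k)
    case 0
    have "loc_integrable p \<Omega> u"
      unfolding loc_integrable_def
    proof (intro allI impI)
      fix K :: "'a set"
      have "int_powr p K u \<le> (\<integral>\<^sup>+x. ennreal (norm (u x) powr p) \<partial>lborel)"
        by (intro nn_integral_mono ennreal_leI) (auto simp: indicator_def)
      also have "\<dots> < \<infinity>" using u by (simp add: Lp_borel_iff)
      finally show "int_powr p K u < \<infinity>" .
    qed
    then show ?case by (rule loc_integrable_mono) (use s p m in auto)
  next
    case (Suc k)
    define r where "r = min s (p + real k * e)"
    have r: "r > 0" "r \<le> s" using s p e by (auto simp: r_def min_def intro: add_pos_nonneg)
    have lt: "min s (p + real (Suc k) * e) < p + t * r / ?n"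
    proof -
      have "r * (1 - t / ?n) \<le> s * (1 - t / ?n)" using r t n by (intro mult_right_mono) (auto simp: field_simps)
      moreover have "r * (1 - t / ?n) = r - t * r / ?n" by (simp add: algebra_simps)
      moreover have "2 * e = p - s * (1 - t / ?n)" by (simp add: e_def)
      ultimately have "r + 2 * e \<le> p + t * r / ?n" by linarith
      moreover have "min s (p + real (Suc k) * e) \<le> r + e" using e by (auto simp: r_def min_def algebra_simps)
      ultimately show ?thesis using e by linarith
    qed
    show ?case
      unfolding loc_integrable_def
    proof (intro allI impI)
      fix K assume K: "compact K \<and> K \<subseteq> \<Omega>"
      obtain C \<Lambda> where "C \<ge> 0" "\<Lambda> \<ge> 1"
        "\<forall>\<mu>\<ge>\<Lambda>. emeasure lborel {x \<in> K. norm (u x) > \<mu>} \<le> ennreal (C * \<mu> powr (- (p + t * r / ?n)))"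
        using superlevel_decay[OF \<Omega> m p t(1) r(1) d Suc[folded r_def]] K by blast
      then show "(\<integral>\<^sup>+x. ennreal (indicator K x * norm (u x) powr min s (p + real (Suc k) * e)) \<partial>lborel) < \<infinity>"
        using K lt s p e by (intro integrable_of_superlevel_decay[OF m, of K C \<Lambda> "p + t * r / ?n"]) (auto intro: add_pos_nonneg)
    qed
  qed
  obtain k :: nat where "(s - p) / e \<le> real k" using real_arch_simple by blast
  then have "min s (p + real k * e) = s" using e by (simp add: min_def field_simps)
  then show ?thesis using step[of k] by simp
qed

lemma Lp_loc_of_loc_integrable:
  assumes \<Omega>: "\<Omega> \<in> sets borel" and rep: "represents \<Omega> u v" and u: "u \<in> borel_measurable (lebesgue_on \<Omega>)"
    and loc: "loc_integrable s \<Omega> v" and s: "s > 0"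
  shows "u \<in> Lp_loc s \<Omega>"
  unfolding Lp_loc_def
proof safe
  fix K assume K: "compact K" "K \<subseteq> \<Omega>"
  have bK [measurable]: "K \<in> sets borel" using K(1) by (rule borel_compact)
  have [measurable]: "v \<in> borel_measurable borel" using rep by (simp add: represents_def)
  have rK: "represents K u (\<lambda>x. indicator K x *\<^sub>R v x)"
    using rep K(2) by (auto simp: represents_def elim!: eventually_mono)
  have uK: "u \<in> borel_measurable (lebesgue_on K)"
    using u K(2) by (rule measurable_restrict_mono)
  have "(\<integral>\<^sup>+x. ennreal (norm (indicator K x *\<^sub>R v x) powr s) \<partial>lborel) = int_powr s K v"
    using s by (intro nn_integral_cong) (auto simp: indicator_def)
  then have "Lp_borel s (\<lambda>x. indicator K x *\<^sub>R v x)"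
    using loc K by (auto simp: Lp_borel_iff loc_integrable_def)
  then show "u \<in> Lp_on s K" using Lp_on_represents[OF bK rK uK] by simp
qed

section \<open>Regularity of the minimizer\<close>

lemma energy_represents:
  assumes \<Omega>: "\<Omega> \<in> sets borel" and rep: "represents \<Omega> \<sigma> \<tau>" and m: "\<sigma> \<in> borel_measurable (lebesgue_on \<Omega>)"
  shows "energy p \<Omega> \<sigma> = (LBINT x. flux_density p (\<tau> x))"
proof -
  have [measurable]: "\<sigma> \<in> borel_measurable (lebesgue_on \<Omega>)" "\<tau> \<in> borel_measurable borel"
    using m rep by (auto simp: represents_def)
  have "energy p \<Omega> \<sigma> = (LBINT x. indicator \<Omega> x *\<^sub>R flux_density p (\<tau> x))"
    unfolding energy_def flux_density_def
    using rep by (intro integral_lebesgue_on_eq[OF \<Omega>]) (auto simp: represents_def elim!: eventually_mono)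
  also have "(\<lambda>x. indicator \<Omega> x *\<^sub>R flux_density p (\<tau> x)) = (\<lambda>x. flux_density p (\<tau> x))"
    using rep by (auto simp: represents_def indicator_def fun_eq_iff)
  finally show ?thesis .
qed

lemma minimizer_higher_integrability:
  fixes \<Omega> :: "'a::euclidean_space set"
  assumes \<Omega>: "open \<Omega>" "bounded \<Omega>" and q: "1 < q" "q < 2" and p: "p = q / (q - 1)"
    and f: "represents \<Omega> f f'" "f \<in> Lp_on p \<Omega>"
    and min: "is_arg_min (energy p \<Omega>) (admissible p q \<Omega> f) \<sigma>0"
    and \<alpha>: "0 \<le> \<alpha>" "\<alpha> \<le> 1" and df: "diff_bound p (\<alpha> * p) \<Omega> f'"
    and T: "0 \<le> T" "T < q" "T \<le> 1 + \<alpha>" "T < real DIM('a)"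
    and s: "s > 0" "s < real DIM('a) * p / (real DIM('a) - T)"
  shows "\<sigma>0 \<in> Lp_loc s \<Omega>"
proof -
  have p2: "p > 2" unfolding p using q by (simp add: pos_less_divide_eq)
  have pq: "1 / p + 1 / q = 1" unfolding p using q by (simp add: field_simps)
  have b\<Omega>: "\<Omega> \<in> sets borel" using \<Omega>(1) by auto
  have adm: "admissible p q \<Omega> f \<sigma>0" and least: "\<And>\<tau>. admissible p q \<Omega> f \<tau> \<Longrightarrow> energy p \<Omega> \<sigma>0 \<le> energy p \<Omega> \<tau>"
    using min by (auto simp: is_arg_min_def not_less)
  have m\<sigma>: "\<sigma>0 \<in> borel_measurable (lebesgue_on \<Omega>)" and mf: "f \<in> borel_measurable (lebesgue_on \<Omega>)"
    using adm f by (auto simp: admissible_def Lp_on_def)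
  obtain \<sigma> where \<sigma>: "represents \<Omega> \<sigma>0 \<sigma>" using representative_exists[OF b\<Omega> m\<sigma>] by metis
  have L\<sigma>: "Lp_borel p \<sigma>" using Lp_on_represents[OF b\<Omega> \<sigma> m\<sigma>] adm by (simp add: admissible_def)
  have Lf: "Lp_borel p f'" using Lp_on_represents[OF b\<Omega> f(1) mf] f(2) by simp
  have off: "\<sigma> x = 0" if "x \<notin> \<Omega>" for x using \<sigma> that by (simp add: represents_def)
  have neu: "borel_neumann q \<Omega> f' \<sigma>" by (rule admissible_imp_borel_neumann[OF b\<Omega> q(1) \<sigma> f(1) mf adm])
  have minimal: "(LBINT x. flux_density p (\<sigma> x)) \<le> (LBINT x. flux_density p (\<tau> x))"
    if \<tau>: "Lp_borel p \<tau>" "\<And>x. x \<notin> \<Omega> \<Longrightarrow> \<tau> x = 0" "borel_neumann q \<Omega> f' \<tau>" for \<tau>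
  proof -
    have "admissible p q \<Omega> f \<tau>" by (rule borel_neumann_imp_admissible[OF b\<Omega> q(1) \<tau>(1,2) f(1) mf \<tau>(3)])
    then have "energy p \<Omega> \<sigma>0 \<le> energy p \<Omega> \<tau>" by (rule least)
    then show ?thesis
      using energy_represents[OF b\<Omega> \<sigma> m\<sigma>]
        energy_represents[OF b\<Omega> represents_self borel_measurable_lebesgue_on, of \<tau>] Lp_borelD[OF \<tau>(1)] \<tau>(2) by auto
  qed
  interpret M: flux_minimizer \<Omega> p q f' \<sigma>
    by (rule flux_minimizer.intro[OF \<Omega> p2 q(1) pq L\<sigma> off Lf neu minimal])
  have "diff_bound p T \<Omega> \<sigma>" by (rule M.minimizer_diff_bound[OF \<alpha> df T(1-3)])
  then have "loc_integrable s \<Omega> \<sigma>"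
    using p2 T s by (intro loc_integrable_of_diff_bound[OF \<Omega>(1) L\<sigma> _ T(1)]) auto
  then show ?thesis by (rule Lp_loc_of_loc_integrable[OF b\<Omega> \<sigma> m\<sigma> _ s(1)])
qed

theorem corollary1p4:
  fixes \<Omega> :: "(real ^ 'n) set"
    and f :: "real ^ 'n \<Rightarrow> real"
    and \<sigma>0 :: "real ^ 'n \<Rightarrow> real ^ 'n"
    and p q \<alpha> n :: real
  assumes "n = real CARD('n)" and "n \<ge> 2"
    and "1 < q" and "q < 2" and "p = q / (q - 1)"
    and "0 < \<alpha>" and "\<alpha> < 1"
    and "open \<Omega>" and "bounded \<Omega>" and "connected \<Omega>" and "lipschitz_boundary \<Omega>"
    and "f \<in> Lp_on p \<Omega>" and "(\<integral>x. f x \<partial>lebesgue_on \<Omega>) = 0"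
    and "is_arg_min (energy p \<Omega>) (admissible p q \<Omega> f) \<sigma>0"
  shows "(f \<in> W1p_loc p \<Omega> \<longrightarrow>
            (\<forall>r. 1 \<le> r \<and> r < n * p * (3 - q) / (n * (3 - q) - 2) \<longrightarrow> \<sigma>0 \<in> Lp_loc r \<Omega>)) \<and>
         (f \<in> Besov_loc \<alpha> p \<Omega> \<longrightarrow>
            (\<alpha> < (q - 1) / (3 - q) \<longrightarrow>
              (\<forall>s. 1 \<le> s \<and> s < n * p / (n - \<alpha> - 1) \<longrightarrow> \<sigma>0 \<in> Lp_loc s \<Omega>)) \<and>
            ((q - 1) / (3 - q) \<le> \<alpha> \<longrightarrow>
              (\<forall>s. 1 \<le> s \<and> s < n * p * (3 - q) / (n * (3 - q) - 2) \<longrightarrow> \<sigma>0 \<in> Lp_loc s \<Omega>)))"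
proof -
  have p1: "p > 1" unfolding assms(5) using assms(3) by (simp add: pos_less_divide_eq)
  have b\<Omega>: "\<Omega> \<in> sets borel" using assms(8) by auto
  have mf: "f \<in> borel_measurable (lebesgue_on \<Omega>)" using assms(12) by (simp add: Lp_on_def)
  obtain f' where rep: "represents \<Omega> f f'" using representative_exists[OF b\<Omega> mf] by metis
  have Lf: "Lp_borel p f'" using Lp_on_represents[OF b\<Omega> rep mf] assms(12) by simp
  have n: "real DIM(real ^ 'n) = n" using assms(1) by simp
  note reg = minimizer_higher_integrability[OF assms(8,9,3,4,5) rep assms(12,14), unfolded n]
  \<comment> \<open>The difference exponent that belongs to the integrability exponent of the first and the last case.\<close>
  define T where "T = 2 / (3 - q)"
  have "(q - 1) * (2 - q) > 0" using assms(3,4) by simp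
  then have "0 \<le> T" "T < q" "T = 1 + (q - 1) / (3 - q)"
    using assms(4) by (auto simp: T_def field_simps)
  then have T: "0 \<le> T" "T < q" "T < n" "T = 1 + (q - 1) / (3 - q)"
    using assms(2,4) by auto
  have exponent: "n * p * (3 - q) / (n * (3 - q) - 2) = n * p / (n - T)"
  proof -
    have "n * (3 - q) - 2 = (n - T) * (3 - q)" using assms(4) by (simp add: T_def field_simps)
    then show ?thesis using assms(4) by simp
  qed
  have W: "\<sigma>0 \<in> Lp_loc r \<Omega>" if "f \<in> W1p_loc p \<Omega>" "1 \<le> r" "r < n * p / (n - T)" for r
  proof (rule reg)
    show "diff_bound p (1 * p) \<Omega> f'"
      using diff_bound_of_W1p_loc[OF assms(8) p1 that(1) rep Lf] by simp
  qed (use T that assms(3,4) in auto)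
  have B: "\<sigma>0 \<in> Lp_loc s \<Omega>"
    if "f \<in> Besov_loc \<alpha> p \<Omega>" "0 \<le> t" "t < q" "t \<le> 1 + \<alpha>" "t < n" "1 \<le> s" "s < n * p / (n - t)" for s t
  proof (rule reg)
    show "diff_bound p (\<alpha> * p) \<Omega> f'"
      by (rule diff_bound_of_Besov_loc[OF assms(8) p1 assms(6,7) that(1) rep Lf])
  qed (use that assms(6,7) in auto)
  show ?thesis
  proof (intro conjI impI allI)
    fix r assume "f \<in> W1p_loc p \<Omega>" "1 \<le> r \<and> r < n * p * (3 - q) / (n * (3 - q) - 2)"
    then show "\<sigma>0 \<in> Lp_loc r \<Omega>" unfolding exponent by (intro W) auto
  next
    fix s assume "f \<in> Besov_loc \<alpha> p \<Omega>" "\<alpha> < (q - 1) / (3 - q)" "1 \<le> s \<and> s < n * p / (n - \<alpha> - 1)"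
    then show "\<sigma>0 \<in> Lp_loc s \<Omega>"
      using T assms(2,6,7) by (intro B[of "1 + \<alpha>"]) (auto simp: algebra_simps)
  next
    fix s assume "f \<in> Besov_loc \<alpha> p \<Omega>" "(q - 1) / (3 - q) \<le> \<alpha>" "1 \<le> s \<and> s < n * p * (3 - q) / (n * (3 - q) - 2)"
    then show "\<sigma>0 \<in> Lp_loc s \<Omega>" unfolding exponent using T by (intro B[of T]) auto
  qed
qed

end
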